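(* Let $n\ge 2$. (i) Let $F_n=G*H$ be a free splitting. The stabilizer in $\mathrm{Out}(F_n)$ of the conjugacy class of the free splitting $F_n=G*H$ is a coarse Lipschitz retract of $\mathrm{Out}(F_n)$. (ii) Let $G<F_n$ be a free factor of corank $1$. Then the stabilizer in $\mathrm{Out}(F_n)$ of the conjugacy class of $G$ is a coarse Lipschitz retract of $\mathrm{Out}(F_n)$.
   Context: $F_n$ is the free group of rank $n$. A free splitting $F_n=G*H$ consists of two subgroups $G,H<F_n$ such that the homomorphism $G*H\to F_n$ induced by the inclusions is an isomorphism. A corank $1$ free factor is a subgroup $G<F_n$ of rank $n-1$ for which there is a cyclic subgroup $H<F_n$ with $F_n=G*H$. An automorphism of $F_n$ preserves the free splitting $G*H$ if it preserves both $G$ and $H$ setwise; it preserves the corank $1$ free factor $G$ if it preserves $G$ setwise (no condition on $H$). An element $\varphi\in\mathrm{Out}(F_n)$ preserves the conjugacy class of the free splitting $G*H$ (respectively of the corank $1$ free factor $G$) if some representative $f\in\mathrm{Aut}(F_n)$ of $\varphi$ preserves $G*H$ (respectively $G$); the stabilizer is the subgroup of all such $\varphi$. Finitely generated groups are viewed as metric spaces via word metrics. A coarse Lipschitz retraction of a metric space $X$ onto a subspace $Y$ is a map $p:X\to Y$ which is coarsely Lipschitz (there is $L\ge1$ with $d(p(x),p(x'))\le L\,d(x,x')+L$ for all $x,x'$) and restricts to the identity on $Y$; then $Y$ is called a coarse Lipschitz retract of $X$. *)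

theory Defs
  imports "HOL-Algebra.Bij" "HOL-Algebra.Coset" "HOL-Algebra.Elementary_Groups"
     "HOL-Analysis.Abstract_Metric_Spaces"
begin

section \<open>Words in a group\<close>

definition word_prod :: "('a, 'b) monoid_scheme \<Rightarrow> 'a list \<Rightarrow> 'a"
  where "word_prod G w = foldr (\<otimes>\<^bsub>G\<^esub>) w \<one>\<^bsub>G\<^esub>"

context group
begin

lemma word_prod_Nil [simp]: "word_prod G [] = \<one>"
  by (simp add: word_prod_def)

lemma word_prod_Cons [simp]: "word_prod G (x # w) = x \<otimes> word_prod G w"
  by (simp add: word_prod_def)

lemma word_prod_closed [simp, intro]:
  "set w \<subseteq> carrier G \<Longrightarrow> word_prod G w \<in> carrier G"
  by (induction w) auto

lemma word_prod_append:
  "set u \<subseteq> carrier G \<Longrightarrow> set v \<subseteq> carrier G \<Longrightarrow>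
     word_prod G (u @ v) = word_prod G u \<otimes> word_prod G v"
  by (induction u) (auto simp: m_assoc)

lemma word_prod_rev_inv:
  "set w \<subseteq> carrier G \<Longrightarrow> word_prod G (rev (map (m_inv G) w)) = inv (word_prod G w)"
proof (induction w)
  case (Cons x w)
  have "word_prod G (rev (map (m_inv G) w) @ [inv x])
      = word_prod G (rev (map (m_inv G) w)) \<otimes> word_prod G [inv x]"
    using Cons.prems by (intro word_prod_append) auto
  then show ?case
    using Cons by (simp add: inv_mult_group)
qed simp

end


section \<open>Free groups of finite rank\<close>

text \<open>A letter \<open>(b, True)\<close> stands for \<open>b\<close>, and \<open>(b, False)\<close> for its inverse.\<close>

definition letter_value :: "('a, 'b) monoid_scheme \<Rightarrow> 'a \<times> bool \<Rightarrow> 'a"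
  where "letter_value F x = (if snd x then fst x else inv\<^bsub>F\<^esub> (fst x))"

definition reduced_words :: "'a set \<Rightarrow> ('a \<times> bool) list set"
  where "reduced_words B =
    {w \<in> lists (B \<times> UNIV). successively (\<lambda>x y. fst x = fst y \<longrightarrow> snd x = snd y) w}"

text \<open>A free basis: every element of the group is the value of exactly one freely reduced
  word in the basis.\<close>

definition free_basis :: "('a, 'b) monoid_scheme \<Rightarrow> 'a set \<Rightarrow> bool"
  where "free_basis F B \<longleftrightarrow> B \<subseteq> carrier F \<and>
    bij_betw (\<lambda>w. word_prod F (map (letter_value F) w)) (reduced_words B) (carrier F)"

definition free_group_of_rank :: "('a, 'b) monoid_scheme \<Rightarrow> nat \<Rightarrow> bool"
  where "free_group_of_rank F n \<longleftrightarrow> group F \<and> (\<exists>B. free_basis F B \<and> finite B \<and> card B = n)"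


section \<open>Free products\<close>

text \<open>The congruence on the free monoid over the disjoint union of two groups whose quotient
  is their free product.\<close>

inductive_set free_product_rel ::
  "('a, 'c) monoid_scheme \<Rightarrow> ('b, 'd) monoid_scheme \<Rightarrow> (('a + 'b) list \<times> ('a + 'b) list) set"
  for G H
where
  refl: "w \<in> lists (carrier G <+> carrier H) \<Longrightarrow> (w, w) \<in> free_product_rel G H"
| sym: "(u, v) \<in> free_product_rel G H \<Longrightarrow> (v, u) \<in> free_product_rel G H"
| trans: "(u, v) \<in> free_product_rel G H \<Longrightarrow> (v, w) \<in> free_product_rel G H
    \<Longrightarrow> (u, w) \<in> free_product_rel G H"
| append: "(u, u') \<in> free_product_rel G H \<Longrightarrow> (v, v') \<in> free_product_rel G H
    \<Longrightarrow> (u @ v, u' @ v') \<in> free_product_rel G H"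
| one_left: "([Inl \<one>\<^bsub>G\<^esub>], []) \<in> free_product_rel G H"
| one_right: "([Inr \<one>\<^bsub>H\<^esub>], []) \<in> free_product_rel G H"
| mult_left: "a \<in> carrier G \<Longrightarrow> b \<in> carrier G
    \<Longrightarrow> ([Inl a, Inl b], [Inl (a \<otimes>\<^bsub>G\<^esub> b)]) \<in> free_product_rel G H"
| mult_right: "a \<in> carrier H \<Longrightarrow> b \<in> carrier H
    \<Longrightarrow> ([Inr a, Inr b], [Inr (a \<otimes>\<^bsub>H\<^esub> b)]) \<in> free_product_rel G H"

definition free_product ::
  "('a, 'c) monoid_scheme \<Rightarrow> ('b, 'd) monoid_scheme \<Rightarrow> ('a + 'b) list set monoid"
  where "free_product G H =
    \<lparr>carrier = lists (carrier G <+> carrier H) // free_product_rel G H,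
     monoid.mult = \<lambda>A B. \<Union>u\<in>A. \<Union>v\<in>B. free_product_rel G H `` {u @ v},
     one = free_product_rel G H `` {[]}\<rparr>"

text \<open>The map from the free product to \<open>K\<close> induced by \<open>f\<close> and \<open>g\<close>; it is well defined
  when these are homomorphisms (see below).\<close>

definition free_product_lift ::
  "('k, 'e) monoid_scheme \<Rightarrow> ('a \<Rightarrow> 'k) \<Rightarrow> ('b \<Rightarrow> 'k) \<Rightarrow> ('a + 'b) list set \<Rightarrow> 'k"
  where "free_product_lift K f g A = the_elem ((\<lambda>w. word_prod K (map (case_sum f g) w)) ` A)"

lemma equiv_free_product_rel:
  assumes "group G" "group H"
  shows "equiv (lists (carrier G <+> carrier H)) (free_product_rel G H)"
proof -
  interpret G: group G by fact
  interpret H: group H by fact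
  have *: "u \<in> lists (carrier G <+> carrier H) \<and> v \<in> lists (carrier G <+> carrier H)"
    if "(u, v) \<in> free_product_rel G H" for u v
    using that by induction (auto simp: lists_eq_set)
  show ?thesis
  proof (rule equivI)
    show "free_product_rel G H
        \<subseteq> lists (carrier G <+> carrier H) \<times> lists (carrier G <+> carrier H)"
      using * by auto
    show "refl_on (lists (carrier G <+> carrier H)) (free_product_rel G H)"
      by (rule refl_onI) (rule free_product_rel.refl)
    show "sym (free_product_rel G H)"
      by (rule symI) (rule free_product_rel.sym)
    show "trans (free_product_rel G H)"
      by (rule transI) (rule free_product_rel.trans)
  qed
qed

lemma free_product_mult:
  assumes "group G" "group H"
    and "u \<in> lists (carrier G <+> carrier H)" "v \<in> lists (carrier G <+> carrier H)"
  shows "free_product_rel G H `` {u} \<otimes>\<^bsub>free_product G H\<^esub> free_product_rel G H `` {v}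
       = free_product_rel G H `` {u @ v}"
proof -
  let ?R = "free_product_rel G H"
  note eq = equiv_free_product_rel[OF assms(1,2)]
  have "congruent2 ?R ?R (\<lambda>u v. ?R `` {u @ v})"
    by (rule congruent2I', rule equiv_class_eq[OF eq]) (rule free_product_rel.append)
  from UN_equiv_class2[OF eq eq this assms(3,4)] show ?thesis
    by (simp add: free_product_def)
qed

lemma group_free_product:
  assumes "group G" "group H"
  shows "group (free_product G H)"
proof -
  interpret G: group G by fact
  interpret H: group H by fact
  let ?R = "free_product_rel G H" and ?W = "lists (carrier G <+> carrier H)"
  note eq = equiv_free_product_rel[OF assms]
  note mult = free_product_mult[OF assms]
  have carr: "carrier (free_product G H) = ?W // ?R"
    and one: "\<one>\<^bsub>free_product G H\<^esub> = ?R `` {[]}"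
    by (simp_all add: free_product_def)
  have inverse: "\<exists>v\<in>?W. (v @ w, []) \<in> ?R" if "w \<in> ?W" for w
    using that
  proof (induction w)
    case Nil
    then show ?case by (intro bexI[of _ "[]"]) (auto intro: free_product_rel.refl)
  next
    case (Cons x w)
    then obtain v where v: "v \<in> ?W" "(v @ w, []) \<in> ?R" by auto
    obtain y where y: "y \<in> carrier G <+> carrier H" "([y, x], []) \<in> ?R"
    proof (cases x)
      case (Inl a)
      then have "a \<in> carrier G" using Cons.hyps by auto
      then have "([Inl (inv\<^bsub>G\<^esub> a), Inl a], [Inl \<one>\<^bsub>G\<^esub>]) \<in> ?R"
        using free_product_rel.mult_left[of "inv\<^bsub>G\<^esub> a" G a H] by simp
      then show ?thesis
        using that[of "Inl (inv\<^bsub>G\<^esub> a)"] \<open>a \<in> carrier G\<close> Inl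
          free_product_rel.trans[OF _ free_product_rel.one_left] by auto
    next
      case (Inr a)
      then have "a \<in> carrier H" using Cons.hyps by auto
      then have "([Inr (inv\<^bsub>H\<^esub> a), Inr a], [Inr \<one>\<^bsub>H\<^esub>]) \<in> ?R"
        using free_product_rel.mult_right[of "inv\<^bsub>H\<^esub> a" H a G] by simp
      then show ?thesis
        using that[of "Inr (inv\<^bsub>H\<^esub> a)"] \<open>a \<in> carrier H\<close> Inr
          free_product_rel.trans[OF _ free_product_rel.one_right] by auto
    qed
    have "(v @ [y, x] @ w, v @ [] @ w) \<in> ?R"
      using v y Cons.hyps by (intro free_product_rel.append free_product_rel.refl) auto
    then have "((v @ [y]) @ x # w, []) \<in> ?R"
      using free_product_rel.trans[OF _ v(2)] by simp
    then show ?case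
      using v y by (intro bexI[of _ "v @ [y]"]) auto
  qed
  show ?thesis
  proof (rule groupI)
    fix A B assume "A \<in> carrier (free_product G H)" "B \<in> carrier (free_product G H)"
    then obtain u v where "u \<in> ?W" "v \<in> ?W" "A = ?R `` {u}" "B = ?R `` {v}"
      by (auto simp: carr elim!: quotientE)
    then show "A \<otimes>\<^bsub>free_product G H\<^esub> B \<in> carrier (free_product G H)"
      by (simp add: carr mult quotientI)
  next
    show "\<one>\<^bsub>free_product G H\<^esub> \<in> carrier (free_product G H)"
      by (auto simp: carr one intro!: quotientI)
  next
    fix A B C
    assume "A \<in> carrier (free_product G H)" "B \<in> carrier (free_product G H)"
      "C \<in> carrier (free_product G H)"
    then obtain u v w where "u \<in> ?W" "v \<in> ?W" "w \<in> ?W"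
      "A = ?R `` {u}" "B = ?R `` {v}" "C = ?R `` {w}"
      by (auto simp: carr elim!: quotientE)
    then show "A \<otimes>\<^bsub>free_product G H\<^esub> B \<otimes>\<^bsub>free_product G H\<^esub> C
        = A \<otimes>\<^bsub>free_product G H\<^esub> (B \<otimes>\<^bsub>free_product G H\<^esub> C)"
      by (simp add: mult)
  next
    fix A assume "A \<in> carrier (free_product G H)"
    then obtain u where u: "u \<in> ?W" "A = ?R `` {u}"
      by (auto simp: carr elim!: quotientE)
    then show "\<one>\<^bsub>free_product G H\<^esub> \<otimes>\<^bsub>free_product G H\<^esub> A = A"
      by (simp add: one mult)
    obtain v where v: "v \<in> ?W" "(v @ u, []) \<in> ?R" using inverse u by blast
    then have "?R `` {v} \<otimes>\<^bsub>free_product G H\<^esub> A = \<one>\<^bsub>free_product G H\<^esub>"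
      using u v equiv_class_eq[OF eq v(2)] by (simp add: one mult)
    then show "\<exists>B\<in>carrier (free_product G H). B \<otimes>\<^bsub>free_product G H\<^esub> A = \<one>\<^bsub>free_product G H\<^esub>"
      using v by (intro bexI[of _ "?R `` {v}"]) (auto simp: carr intro!: quotientI)
  qed
qed

context
  fixes G :: "('a, 'c) monoid_scheme" and H :: "('b, 'd) monoid_scheme"
    and K :: "('k, 'e) monoid_scheme" and f g
  assumes G: "group G" and H: "group H" and K: "group K"
    and f: "f \<in> hom G K" and g: "g \<in> hom H K"
begin

lemma free_product_lift_class:
  assumes "w \<in> lists (carrier G <+> carrier H)"
  shows "free_product_lift K f g (free_product_rel G H `` {w})
       = word_prod K (map (case_sum f g) w)"
proof -
  interpret G: group G by (rule G)
  interpret H: group H by (rule H)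
  interpret K: group K by (rule K)
  interpret f: group_hom G K f by (unfold_locales) (rule f)
  interpret g: group_hom H K g by (unfold_locales) (rule g)
  have *: "set (map (case_sum f g) u) \<subseteq> carrier K \<and> set (map (case_sum f g) v) \<subseteq> carrier K \<and>
      word_prod K (map (case_sum f g) u) = word_prod K (map (case_sum f g) v)"
    if "(u, v) \<in> free_product_rel G H" for u v
    using that
  proof induction
    case (refl w)
    then show ?case by (auto simp: lists_eq_set)
  next
    case (append u u' v v')
    then show ?case by (simp add: K.word_prod_append)
  next
    case (trans u v w)
    then show ?case by metis
  qed (auto simp: K.m_assoc)
  let ?h = "\<lambda>w. word_prod K (map (case_sum f g) w)" and ?C = "free_product_rel G H `` {w}"
  have "?h ` ?C = (\<lambda>_. ?h w) ` ?C"
    using * by (intro image_cong) auto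
  also have "\<dots> = {?h w}"
    using free_product_rel.refl[OF assms] by (intro image_constant[of w]) auto
  finally show ?thesis
    by (simp add: free_product_lift_def)
qed

lemma free_product_lift_hom: "free_product_lift K f g \<in> hom (free_product G H) K"
proof -
  interpret K: group K by (rule K)
  have carr: "carrier (free_product G H)
      = lists (carrier G <+> carrier H) // free_product_rel G H"
    by (simp add: free_product_def)
  have sub: "set (map (case_sum f g) w) \<subseteq> carrier K"
    if "w \<in> lists (carrier G <+> carrier H)" for w
    using that f g by (auto simp: hom_def Pi_iff)
  show ?thesis
  proof (rule homI)
    fix A assume "A \<in> carrier (free_product G H)"
    then obtain u where "u \<in> lists (carrier G <+> carrier H)" "A = free_product_rel G H `` {u}"
      by (auto simp: carr elim!: quotientE)
    then show "free_product_lift K f g A \<in> carrier K"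
      using K.word_prod_closed[OF sub] by (simp add: free_product_lift_class)
  next
    fix A B assume "A \<in> carrier (free_product G H)" "B \<in> carrier (free_product G H)"
    then obtain u v where "u \<in> lists (carrier G <+> carrier H)" "A = free_product_rel G H `` {u}"
      "v \<in> lists (carrier G <+> carrier H)" "B = free_product_rel G H `` {v}"
      by (auto simp: carr elim!: quotientE)
    then show "free_product_lift K f g (A \<otimes>\<^bsub>free_product G H\<^esub> B)
        = free_product_lift K f g A \<otimes>\<^bsub>K\<^esub> free_product_lift K f g B"
      using K.word_prod_append[OF sub sub, of u v]
      by (simp add: free_product_mult[OF G H] free_product_lift_class)
  qed
qed

end


section \<open>Free splittings and corank one free factors\<close>

definition free_splitting :: "('a, 'b) monoid_scheme \<Rightarrow> 'a set \<Rightarrow> 'a set \<Rightarrow> bool"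
  where "free_splitting F G H \<longleftrightarrow> subgroup G F \<and> subgroup H F \<and>
    free_product_lift F (\<lambda>x. x) (\<lambda>x. x)
      \<in> iso (free_product (F\<lparr>carrier := G\<rparr>) (F\<lparr>carrier := H\<rparr>)) F"

definition corank1_free_factor :: "('a, 'b) monoid_scheme \<Rightarrow> nat \<Rightarrow> 'a set \<Rightarrow> bool"
  where "corank1_free_factor F n G \<longleftrightarrow> subgroup G F \<and>
    free_group_of_rank (F\<lparr>carrier := G\<rparr>) (n - 1) \<and>
    (\<exists>H. cyclic_group (F\<lparr>carrier := H\<rparr>) \<and> free_splitting F G H)"


section \<open>Outer automorphisms and stabilizers\<close>

definition inner_auto :: "('a, 'b) monoid_scheme \<Rightarrow> 'a \<Rightarrow> 'a \<Rightarrow> 'a"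
  where "inner_auto F x = (\<lambda>y\<in>carrier F. x \<otimes>\<^bsub>F\<^esub> y \<otimes>\<^bsub>F\<^esub> inv\<^bsub>F\<^esub> x)"

definition Inn :: "('a, 'b) monoid_scheme \<Rightarrow> ('a \<Rightarrow> 'a) set"
  where "Inn F = inner_auto F ` carrier F"

definition Out :: "('a, 'b) monoid_scheme \<Rightarrow> ('a \<Rightarrow> 'a) set monoid"
  where "Out F = AutoGroup F Mod Inn F"

text \<open>An element of \<open>Out F\<close> is a coset of \<open>Inn F\<close>, that is, the set of all automorphisms
  representing it.\<close>

definition stab_splitting ::
    "('a, 'b) monoid_scheme \<Rightarrow> 'a set \<Rightarrow> 'a set \<Rightarrow> ('a \<Rightarrow> 'a) set set"
  where "stab_splitting F G H = {\<phi> \<in> carrier (Out F). \<exists>f\<in>\<phi>. f ` G = G \<and> f ` H = H}"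

definition stab_factor :: "('a, 'b) monoid_scheme \<Rightarrow> 'a set \<Rightarrow> ('a \<Rightarrow> 'a) set set"
  where "stab_factor F G = {\<phi> \<in> carrier (Out F). \<exists>f\<in>\<phi>. f ` G = G}"

context group
begin

lemma AutoGroup_simps:
  "carrier (AutoGroup G) = auto G"
  "f \<in> auto G \<Longrightarrow> h \<in> auto G \<Longrightarrow> f \<otimes>\<^bsub>AutoGroup G\<^esub> h = compose (carrier G) f h"
  "\<one>\<^bsub>AutoGroup G\<^esub> = (\<lambda>x\<in>carrier G. x)"
  by (auto simp: AutoGroup_def BijGroup_def auto_def)

lemma inner_auto_compose:
  assumes "x \<in> carrier G" "y \<in> carrier G"
  shows "compose (carrier G) (inner_auto G x) (inner_auto G y) = inner_auto G (x \<otimes> y)"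
  using assms by (auto simp: fun_eq_iff compose_def inner_auto_def inv_mult_group m_assoc)

lemma inner_auto_one: "inner_auto G \<one> = (\<lambda>x\<in>carrier G. x)"
  by (auto simp: inner_auto_def)

lemma inner_auto_in_auto:
  assumes x: "x \<in> carrier G"
  shows "inner_auto G x \<in> auto G"
proof -
  have cancel: "inv x \<otimes> (x \<otimes> a) = a" "x \<otimes> (inv x \<otimes> a) = a" if "a \<in> carrier G" for a
    using x that by (simp_all flip: m_assoc)
  have "bij_betw (inner_auto G x) (carrier G) (carrier G)"
    using x by (intro bij_betw_byWitness[where f' = "inner_auto G (inv x)"])
      (auto simp: inner_auto_def m_assoc cancel)
  moreover have "inner_auto G x \<in> hom G G"
    using x by (intro homI) (auto simp: inner_auto_def m_assoc cancel)
  moreover have "inner_auto G x \<in> extensional (carrier G)"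
    by (simp add: inner_auto_def)
  ultimately show ?thesis
    by (simp add: auto_def Bij_def)
qed

lemma inner_auto_conj:
  assumes "f \<in> auto G" "x \<in> carrier G"
  shows "compose (carrier G) f (inner_auto G x) = compose (carrier G) (inner_auto G (f x)) f"
proof -
  interpret f: group_hom G G f
    using assms by unfold_locales (auto simp: auto_def)
  show ?thesis
    using assms by (auto simp: fun_eq_iff compose_def inner_auto_def)
qed

lemma Inn_normal: "Inn G \<lhd> AutoGroup G"
proof -
  interpret A: group "AutoGroup G" by (rule AutoGroup)
  have mult: "inner_auto G x \<otimes>\<^bsub>AutoGroup G\<^esub> inner_auto G y = inner_auto G (x \<otimes> y)"
    if "x \<in> carrier G" "y \<in> carrier G" for x y
    using that by (simp add: AutoGroup_simps inner_auto_in_auto inner_auto_compose)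
  have inv: "inv\<^bsub>AutoGroup G\<^esub> (inner_auto G x) = inner_auto G (inv x)" if "x \<in> carrier G" for x
    using that by (intro A.inv_equality)
      (auto simp: inner_auto_compose inner_auto_one AutoGroup_simps inner_auto_in_auto)
  have sub: "subgroup (Inn G) (AutoGroup G)"
  proof (rule A.subgroupI)
    show "Inn G \<subseteq> carrier (AutoGroup G)"
      by (auto simp: Inn_def AutoGroup_simps inner_auto_in_auto)
  qed (auto simp: Inn_def inv mult)
  have "f \<otimes>\<^bsub>AutoGroup G\<^esub> inner_auto G x \<otimes>\<^bsub>AutoGroup G\<^esub> inv\<^bsub>AutoGroup G\<^esub> f \<in> Inn G"
    if f: "f \<in> carrier (AutoGroup G)" and x: "x \<in> carrier G" for f x
  proof -
    have fx: "f x \<in> carrier G"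
      using f x by (auto simp: AutoGroup_simps auto_def hom_def)
    have "f \<otimes>\<^bsub>AutoGroup G\<^esub> inner_auto G x = inner_auto G (f x) \<otimes>\<^bsub>AutoGroup G\<^esub> f"
      using f x fx by (simp add: AutoGroup_simps inner_auto_in_auto inner_auto_conj)
    moreover have "inner_auto G (f x) \<in> carrier (AutoGroup G)"
      using fx by (simp add: AutoGroup_simps inner_auto_in_auto)
    ultimately show ?thesis
      using f fx by (simp add: A.m_assoc Inn_def)
  qed
  then show ?thesis
    unfolding A.normal_inv_iff using sub by (auto simp: Inn_def)
qed

lemma group_Out: "group (Out G)"
  unfolding Out_def by (rule normal.factorgroup_is_group[OF Inn_normal])

end


section \<open>Word metrics and coarse Lipschitz retracts\<close>

definition finite_generating_set :: "('a, 'b) monoid_scheme \<Rightarrow> 'a set \<Rightarrow> bool"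
  where "finite_generating_set G S \<longleftrightarrow> finite S \<and> S \<subseteq> carrier G \<and> generate G S = carrier G"

definition word_length :: "('a, 'b) monoid_scheme \<Rightarrow> 'a set \<Rightarrow> 'a \<Rightarrow> nat"
  where "word_length G S g =
    (LEAST k. \<exists>w\<in>lists (S \<union> m_inv G ` S). length w = k \<and> word_prod G w = g)"

text \<open>The value 0 outside the carrier is a convention needed for the library's locale of
  metric spaces, which demands symmetry everywhere.\<close>

definition word_dist :: "('a, 'b) monoid_scheme \<Rightarrow> 'a set \<Rightarrow> 'a \<Rightarrow> 'a \<Rightarrow> real"
  where "word_dist G S g h =
    (if g \<in> carrier G \<and> h \<in> carrier G then real (word_length G S (inv\<^bsub>G\<^esub> g \<otimes>\<^bsub>G\<^esub> h)) else 0)"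

lemma (in group) Metric_space_word_dist:
  assumes S: "S \<subseteq> carrier G" "generate G S = carrier G"
  shows "Metric_space (carrier G) (word_dist G S)"
proof -
  let ?L = "S \<union> m_inv G ` S"
  have L: "?L \<subseteq> carrier G" using S by auto
  then have sub: "set w \<subseteq> carrier G" if "w \<in> lists ?L" for w
    using that by (auto simp: lists_eq_set)
  have "\<exists>w\<in>lists ?L. word_prod G w = g" if "g \<in> generate G S" for g
    using that
  proof induction
    case one
    then show ?case by (intro bexI[of _ "[]"]) auto
  next
    case (incl h)
    then show ?case using S by (intro bexI[of _ "[h]"]) auto
  next
    case (inv h)
    then show ?case using S by (intro bexI[of _ "[inv h]"]) auto
  next
    case (eng h1 h2)
    then obtain u v where "u \<in> lists ?L" "word_prod G u = h1" "v \<in> lists ?L" "word_prod G v = h2"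
      by blast
    then show ?case using word_prod_append[OF sub sub]
      by (intro bexI[of _ "u @ v"]) auto
  qed
  then have ex: "\<exists>w\<in>lists ?L. word_prod G w = g" if "g \<in> carrier G" for g
    using that S by simp
  have wl: "\<exists>w\<in>lists ?L. length w = word_length G S g \<and> word_prod G w = g"
    if "g \<in> carrier G" for g
    unfolding word_length_def by (rule LeastI_ex) (use ex[OF that] in blast)
  have le: "word_length G S (word_prod G w) \<le> length w" if "w \<in> lists ?L" for w
    unfolding word_length_def by (rule Least_le) (use that in blast)
  have inv_le: "word_length G S (inv g) \<le> word_length G S g" if g: "g \<in> carrier G" for g
  proof -
    obtain w where w: "w \<in> lists ?L" "length w = word_length G S g" "word_prod G w = g"
      using wl[OF g] by blast
    have "inv x \<in> ?L" if "x \<in> ?L" for x using that S by auto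
    then have "rev (map (m_inv G) w) \<in> lists ?L"
      using w(1) by (induction w arbitrary: g) auto
    from le[OF this] show ?thesis
      using w word_prod_rev_inv[OF sub[OF w(1)]] by simp
  qed
  have inv_eq: "word_length G S (inv g) = word_length G S g" if "g \<in> carrier G" for g
    using inv_le[OF that] inv_le[of "inv g"] that by simp
  have mult_le: "word_length G S (g \<otimes> h) \<le> word_length G S g + word_length G S h"
    if g: "g \<in> carrier G" and h: "h \<in> carrier G" for g h
  proof -
    obtain u where u: "u \<in> lists ?L" "length u = word_length G S g" "word_prod G u = g"
      using wl[OF g] by blast
    obtain v where v: "v \<in> lists ?L" "length v = word_length G S h" "word_prod G v = h"
      using wl[OF h] by blast
    have "u @ v \<in> lists ?L" using u v by auto
    from le[OF this] show ?thesis
      using u v word_prod_append[OF sub[OF u(1)] sub[OF v(1)]] by simp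
  qed
  have zero: "word_length G S g = 0 \<longleftrightarrow> g = \<one>" if "g \<in> carrier G" for g
  proof
    show "g = \<one>" if "word_length G S g = 0" using wl[OF \<open>g \<in> carrier G\<close>] that by auto
    show "word_length G S g = 0" if "g = \<one>" using le[of "[]"] that by auto
  qed
  show ?thesis
  proof
    show "0 \<le> word_dist G S x y" for x y by (simp add: word_dist_def)
    show "word_dist G S x y = word_dist G S y x" for x y
      using inv_eq[of "inv x \<otimes> y"] by (auto simp: word_dist_def inv_mult_group)
    show "word_dist G S x y = 0 \<longleftrightarrow> x = y" if "x \<in> carrier G" "y \<in> carrier G" for x y
      using that zero[of "inv x \<otimes> y"] by (auto simp: word_dist_def inv_solve_left')
    show "word_dist G S x z \<le> word_dist G S x y + word_dist G S y z"
      if "x \<in> carrier G" "y \<in> carrier G" "z \<in> carrier G" for x y z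
    proof -
      have "(inv x \<otimes> y) \<otimes> (inv y \<otimes> z) = inv x \<otimes> ((y \<otimes> inv y) \<otimes> z)"
        using that by (simp only: m_assoc m_closed inv_closed)
      then have "(inv x \<otimes> y) \<otimes> (inv y \<otimes> z) = inv x \<otimes> z"
        using that by simp
      then show ?thesis
        using that mult_le[of "inv x \<otimes> y" "inv y \<otimes> z"] by (simp add: word_dist_def)
    qed
  qed
qed

definition coarse_lipschitz_retraction ::
    "'a set \<Rightarrow> ('a \<Rightarrow> 'a \<Rightarrow> real) \<Rightarrow> 'a set \<Rightarrow> ('a \<Rightarrow> 'a) \<Rightarrow> bool"
  where "coarse_lipschitz_retraction M d Y p \<longleftrightarrow>
    Y \<subseteq> M \<and> p \<in> M \<rightarrow> Y \<and> (\<forall>y\<in>Y. p y = y) \<and>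
    (\<exists>L\<ge>1. \<forall>x\<in>M. \<forall>x'\<in>M. d (p x) (p x') \<le> L * d x x' + L)"

definition coarse_lipschitz_retract :: "'a set \<Rightarrow> ('a \<Rightarrow> 'a \<Rightarrow> real) \<Rightarrow> 'a set \<Rightarrow> bool"
  where "coarse_lipschitz_retract M d Y \<longleftrightarrow> (\<exists>p. coarse_lipschitz_retraction M d Y p)"

end

theory Submission
  imports Defs
begin

text \<open>
  A class in \<open>Out F\<close> is a free basis \<open>X\<close> of \<open>F\<close> up to conjugation, and right multiplication by a
  generator changes \<open>X\<close> into a basis whose elements have bounded length in \<open>X\<close>. Given a free factor
  \<open>G\<close>, a connected fundamental domain \<open>D\<close> (a Schreier transversal) for the action of \<open>G\<close> on the Cayley
  tree of \<open>X\<close> yields the Nielsen--Schreier basis of \<open>G\<close>, consisting of the elements that move \<open>D\<close> to an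
  adjacent tile. It is crucial that if two adjacent bases \<open>X\<close> and \<open>X'\<close> have domains \<open>D\<close> and \<open>D'\<close> with a
  common vertex, then the two bases of \<open>G\<close> have bounded length in each other: a path in \<open>D'\<close> is
  traced in the tree of \<open>X\<close> by a path near \<open>D'\<close>; this path leaves each tile on the way to its end
  point at one of the boundedly many boundary vertices of that tile, and each vertex lies in a
  single translate of \<open>D'\<close>.

  A common vertex is obtained by letting \<open>D\<close> contain a prescribed end of \<open>F\<close>, which does
  not depend on \<open>X\<close>. For a splitting \<open>G * H\<close> the domain of \<open>G\<close> is taken at the end \<open>b\<^sup>\<infinity>\<close> with
  \<open>b \<in> H\<close>, and that of \<open>H\<close> at \<open>a\<^sup>\<infinity>\<close> with \<open>a \<in> G\<close>; the two Nielsen--Schreier bases together are the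
  image of \<open>X\<close>. For a factor \<open>G\<close> of corank one with complement generated by \<open>z\<close>, the domain of \<open>G\<close> is taken
  at the end \<open>a\<^sup>\<infinity>z\<^sup>-\<^sup>1\<close>, and the image of \<open>z\<close> is \<open>zc\<^sup>-\<^sup>1\<close>, where \<open>c\<close> names the tile containing the end
  \<open>a\<^sup>\<infinity>z\<close>. If \<open>X\<close> comes from an element of the stabilizer, the words not ending in a letter of \<open>G\<close> form
  such a domain, which gives back \<open>X\<close> up to bounded error.
\<close>

section \<open>Reduced words\<close>

text \<open>Without an anchor, a fundamental domain for \<open>G\<close> is determined only up to
  translation by \<open>G\<close>, and a translation conjugates the basis that it yields.
  Conjugating the two factors of a splitting independently gives partial conjugations, in general of
  unbounded length in \<open>Out F\<close>; the ends remove this freedom. An end can serve only if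
  it stays in a single tile, and the vertices \<open>a^n g\<close> do so once no conjugate
  \<open>g^-1 a^k g\<close> with \<open>k > 0\<close> lies in \<open>G\<close>. This holds for
  powers of an element of the other factor, and for \<open>g = z^-1\<close> and \<open>g = z\<close>
  in the corank one case.

  In corank one the complement is not preserved, and \<open>z\<close> is known only up to
  multiplication by elements of \<open>G\<close>. The second end measures this: if
  \<open>f z = z d\<close> with \<open>f\<close> in the stabilizer, the end through \<open>z\<close>
  lies in the tile \<open>d^-1\<close>, whence the formula with \<open>c^-1\<close>.

  All bounds are uniform in \<open>X\<close>: a tile has at most twice as many boundary vertices as
  \<open>G\<close> has rank, and the balls in \<open>X\<close> are images of the balls in one fixed
  basis. Bounds between bases become bounds in \<open>Out F\<close> because only finitely many
  automorphisms move a fixed finite basis into a given ball.\<close>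

definition flip :: "'a \<times> bool \<Rightarrow> 'a \<times> bool"
  where "flip l = (fst l, \<not> snd l)"

lemma flip_flip [simp]: "flip (flip l) = l"
  and fst_flip [simp]: "fst (flip l) = fst l"
  and snd_flip [simp]: "snd (flip l) \<longleftrightarrow> \<not> snd l"
  and flip_inject [simp]: "flip l = flip m \<longleftrightarrow> l = m"
  and flip_neq [simp]: "flip l \<noteq> l" "l \<noteq> flip l"
  by (auto simp: flip_def prod_eq_iff)

lemma not_flip_iff: "m \<noteq> flip l \<longleftrightarrow> (fst l = fst m \<longrightarrow> snd l = snd m)"
  by (cases l; cases m) (auto simp: flip_def)

lemma reduced_words_Nil [simp]: "[] \<in> reduced_words B"
  by (simp add: reduced_words_def)

lemma reduced_words_Cons:
  "l # w \<in> reduced_words B \<longleftrightarrow> fst l \<in> B \<and> w \<in> reduced_words B \<and> (w \<noteq> [] \<longrightarrow> hd w \<noteq> flip l)"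
  by (cases w) (auto simp: reduced_words_def not_flip_iff mem_Times_iff)

lemma reduced_words_append:
  "u @ v \<in> reduced_words B \<longleftrightarrow> u \<in> reduced_words B \<and> v \<in> reduced_words B \<and>
     (u \<noteq> [] \<longrightarrow> v \<noteq> [] \<longrightarrow> hd v \<noteq> flip (last u))"
proof (induction u)
  case (Cons l u)
  then show ?case by (cases u) (auto simp: reduced_words_Cons)
qed simp

lemma reduced_words_letters: "w \<in> reduced_words B \<Longrightarrow> fst ` set w \<subseteq> B"
  by (auto simp: reduced_words_def lists_eq_set)

lemma reduced_words_mono: "w \<in> reduced_words B \<Longrightarrow> B \<subseteq> C \<Longrightarrow> w \<in> reduced_words C"
  unfolding reduced_words_def by (auto simp: lists_eq_set subset_iff)

definition map_letter :: "('a \<Rightarrow> 'b) \<Rightarrow> 'a \<times> bool \<Rightarrow> 'b \<times> bool"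
  where "map_letter f l = (f (fst l), snd l)"

lemma map_letter_simps [simp]:
  "fst (map_letter f l) = f (fst l)" "snd (map_letter f l) = snd l"
  "map_letter f (flip l) = flip (map_letter f l)"
  by (simp_all add: map_letter_def flip_def)

text \<open>Left multiplication by a letter, seen on normal forms: prepending a letter to a reduced
  word causes at most one cancellation.\<close>

definition cons_red :: "'a \<times> bool \<Rightarrow> ('a \<times> bool) list \<Rightarrow> ('a \<times> bool) list"
  where "cons_red l w = (if w \<noteq> [] \<and> hd w = flip l then tl w else l # w)"

lemma cons_red_reduced:
  "w \<in> reduced_words B \<Longrightarrow> fst l \<in> B \<Longrightarrow> cons_red l w \<in> reduced_words B"
  by (cases w) (auto simp: cons_red_def reduced_words_Cons)

lemma cons_red_flip: "w \<in> reduced_words B \<Longrightarrow> cons_red (flip l) (cons_red l w) = w"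
  by (cases w; cases "tl w") (auto simp: cons_red_def reduced_words_Cons)

lemma cons_red_flip': "w \<in> reduced_words B \<Longrightarrow> cons_red l (cons_red (flip l) w) = w"
  using cons_red_flip[of w B "flip l"] by simp

lemma cons_red_Cons: "l # w \<in> reduced_words B \<Longrightarrow> cons_red l w = l # w"
  by (auto simp: cons_red_def reduced_words_Cons)

definition word_inv :: "('a \<times> bool) list \<Rightarrow> ('a \<times> bool) list"
  where "word_inv w = rev (map flip w)"

lemma word_inv_simps [simp]:
  "word_inv [] = []" "word_inv (l # w) = word_inv w @ [flip l]"
  "word_inv (u @ v) = word_inv v @ word_inv u" "word_inv (word_inv w) = w"
  "word_inv w = [] \<longleftrightarrow> w = []" "length (word_inv w) = length w"
  by (auto simp: word_inv_def rev_map comp_def)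

lemma hd_word_inv: "w \<noteq> [] \<Longrightarrow> hd (word_inv w) = flip (last w)"
  by (simp add: word_inv_def hd_rev last_map)

lemma last_word_inv: "w \<noteq> [] \<Longrightarrow> last (word_inv w) = flip (hd w)"
  by (simp add: word_inv_def last_rev hd_map)

lemma fst_set_word_inv [simp]: "fst ` set (word_inv w) = fst ` set w"
  by (force simp: word_inv_def)

lemma word_inv_reduced: "w \<in> reduced_words B \<Longrightarrow> word_inv w \<in> reduced_words B"
  by (induction w) (auto simp: reduced_words_Cons reduced_words_append last_word_inv)

definition wval :: "('a, 'b) monoid_scheme \<Rightarrow> ('a \<times> bool) list \<Rightarrow> 'a"
  where "wval G w = word_prod G (map (letter_value G) w)"

text \<open>Words may be unreduced and \<open>B\<close> may be any set, so that bounds pass to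
  products, inverses and homomorphic images by plain concatenation.\<close>

definition ball_of :: "('a, 'b) monoid_scheme \<Rightarrow> 'a set \<Rightarrow> nat \<Rightarrow> 'a set"
  where "ball_of G B k = {wval G w |w. fst ` set w \<subseteq> B \<and> length w \<le> k}"

definition nform :: "('a, 'b) monoid_scheme \<Rightarrow> 'a set \<Rightarrow> 'a \<Rightarrow> ('a \<times> bool) list"
  where "nform G B = the_inv_into (reduced_words B) (wval G)"

lemma free_basis_iff:
  "free_basis F B \<longleftrightarrow> B \<subseteq> carrier F \<and> bij_betw (wval F) (reduced_words B) (carrier F)"
  unfolding free_basis_def wval_def ..

lemma finite_ball_of:
  assumes "finite B"
  shows "finite (ball_of G B k)"
proof (rule finite_subset)
  show "ball_of G B k \<subseteq> wval G ` {w. set w \<subseteq> B \<times> (UNIV :: bool set) \<and> length w \<le> k}"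
    by (force simp: ball_of_def)
  show "finite (wval G ` {w. set w \<subseteq> B \<times> (UNIV :: bool set) \<and> length w \<le> k})"
    using assms by (intro finite_imageI finite_lists_length_le) auto
qed

lemma ball_of_mono: "k \<le> m \<Longrightarrow> B \<subseteq> C \<Longrightarrow> ball_of G B k \<subseteq> ball_of G C m"
  by (force simp: ball_of_def)

context group
begin

lemma letter_value_closed [simp]:
  "fst l \<in> carrier G \<Longrightarrow> letter_value G l \<in> carrier G"
  by (simp add: letter_value_def)

lemma letter_value_flip [simp]:
  "fst l \<in> carrier G \<Longrightarrow> letter_value G (flip l) = inv (letter_value G l)"
  by (simp add: letter_value_def)

lemma wval_Nil [simp]: "wval G [] = \<one>"
  and wval_Cons [simp]: "wval G (l # w) = letter_value G l \<otimes> wval G w"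
  by (simp_all add: wval_def)

lemma wval_closed [simp]: "fst ` set w \<subseteq> carrier G \<Longrightarrow> wval G w \<in> carrier G"
  by (induction w) auto

lemma wval_append:
  "fst ` set u \<subseteq> carrier G \<Longrightarrow> fst ` set v \<subseteq> carrier G \<Longrightarrow> wval G (u @ v) = wval G u \<otimes> wval G v"
  by (induction u) (auto simp: m_assoc)

lemma wval_inv: "fst ` set w \<subseteq> carrier G \<Longrightarrow> wval G (word_inv w) = inv (wval G w)"
  by (induction w) (auto simp: wval_append inv_mult_group)

lemma cancel_left: "x \<in> carrier G \<Longrightarrow> y \<in> carrier G \<Longrightarrow> inv x \<otimes> (x \<otimes> y) = y"
  "x \<in> carrier G \<Longrightarrow> y \<in> carrier G \<Longrightarrow> x \<otimes> (inv x \<otimes> y) = y"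
  by (simp_all flip: m_assoc)

lemma wval_cons_red:
  assumes "fst ` set w \<subseteq> carrier G" "fst l \<in> carrier G"
  shows "wval G (cons_red l w) = letter_value G l \<otimes> wval G w"
  using assms by (cases w) (auto simp: cons_red_def cancel_left)

lemma ex_reduced_word:
  assumes "fst ` set w \<subseteq> B" "B \<subseteq> carrier G"
  shows "\<exists>v\<in>reduced_words B. wval G v = wval G w \<and> length v \<le> length w"
  using assms
proof (induction w)
  case (Cons l w)
  then obtain v where v: "v \<in> reduced_words B" "wval G v = wval G w" "length v \<le> length w"
    by auto
  have "wval G (cons_red l v) = wval G (l # w)"
    using v Cons.prems reduced_words_letters[OF v(1)] wval_cons_red[of v l] by auto
  moreover have "length (cons_red l v) \<le> length (l # w)"
    using v by (auto simp: cons_red_def)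
  ultimately show ?case
    using v Cons.prems by (intro bexI[of _ "cons_red l v"] cons_red_reduced) auto
qed auto

lemma ball_of_one: "\<one> \<in> ball_of G B k"
  by (auto simp: ball_of_def intro!: exI[of _ "[]"])

lemma ball_of_closed: "B \<subseteq> carrier G \<Longrightarrow> x \<in> ball_of G B k \<Longrightarrow> x \<in> carrier G"
  by (auto simp: ball_of_def intro!: wval_closed)

lemma ball_of_mult:
  assumes "B \<subseteq> carrier G" "x \<in> ball_of G B k" "y \<in> ball_of G B m"
  shows "x \<otimes> y \<in> ball_of G B (k + m)"
proof -
  obtain u v where *: "x = wval G u" "y = wval G v" "fst ` set u \<subseteq> B" "fst ` set v \<subseteq> B"
    "length u \<le> k" "length v \<le> m"
    using assms by (auto simp: ball_of_def)
  then have "x \<otimes> y = wval G (u @ v)"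
    using assms(1) wval_append[of u v] by auto
  then show ?thesis
    using * unfolding ball_of_def by (intro CollectI exI[of _ "u @ v"]) auto
qed

lemma ball_of_inv:
  assumes "B \<subseteq> carrier G" "x \<in> ball_of G B k"
  shows "inv x \<in> ball_of G B k"
proof -
  obtain u where *: "x = wval G u" "fst ` set u \<subseteq> B" "length u \<le> k"
    using assms by (auto simp: ball_of_def)
  then have "inv x = wval G (word_inv u)"
    using assms(1) wval_inv[of u] by auto
  then show ?thesis
    using * unfolding ball_of_def by (intro CollectI exI[of _ "word_inv u"]) auto
qed

lemma ball_of_incl: "B \<subseteq> carrier G \<Longrightarrow> x \<in> B \<Longrightarrow> 1 \<le> k \<Longrightarrow> x \<in> ball_of G B k"
  by (auto simp: ball_of_def letter_value_def subset_iff intro!: exI[of _ "[(x, True)]"])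

lemma ball_of_letter:
  assumes "B \<subseteq> carrier G" "C \<subseteq> ball_of G B k" "fst l \<in> C"
  shows "letter_value G l \<in> ball_of G B k"
  using assms ball_of_inv[of B] by (auto simp: letter_value_def)

lemma wval_subgroup:
  assumes "subgroup H G" "fst ` set w \<subseteq> H"
  shows "wval (G\<lparr>carrier := H\<rparr>) w = wval G w" "wval G w \<in> H"
proof -
  have "letter_value (G\<lparr>carrier := H\<rparr>) l = letter_value G l" "letter_value G l \<in> H" if "fst l \<in> H" for l
    using that assms(1) by (auto simp: letter_value_def m_inv_consistent subgroup.m_inv_closed)
  then have "wval (G\<lparr>carrier := H\<rparr>) w = wval G w \<and> wval G w \<in> H"
    using assms
    by (induction w) (auto simp: wval_def word_prod_def subgroup.one_closed subgroup.m_closed)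
  then show "wval (G\<lparr>carrier := H\<rparr>) w = wval G w" "wval G w \<in> H" by auto
qed

lemma nform:
  assumes "free_basis G B"
  shows "g \<in> carrier G \<Longrightarrow> nform G B g \<in> reduced_words B"
    and "g \<in> carrier G \<Longrightarrow> wval G (nform G B g) = g"
    and "w \<in> reduced_words B \<Longrightarrow> nform G B (wval G w) = w"
  using assms unfolding free_basis_iff bij_betw_def nform_def
  by (auto intro: the_inv_into_into f_the_inv_into_f the_inv_into_f_f)

lemma free_basis_subset: "free_basis G B \<Longrightarrow> B \<subseteq> carrier G"
  by (simp add: free_basis_def)

lemma nform_one: "free_basis G B \<Longrightarrow> nform G B \<one> = []"
  using nform(3)[of B "[]"] by simp

lemma nform_unique:
  "free_basis G B \<Longrightarrow> w \<in> reduced_words B \<Longrightarrow> wval G w = g \<Longrightarrow> nform G B g = w"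
  using nform(3) by blast

lemma nform_letters: "free_basis G B \<Longrightarrow> g \<in> carrier G \<Longrightarrow> fst ` set (nform G B g) \<subseteq> B"
  using nform(1) reduced_words_letters by blast

lemma nform_letter_mult:
  assumes B: "free_basis G B" and "fst l \<in> B" "g \<in> carrier G"
  shows "nform G B (letter_value G l \<otimes> g) = cons_red l (nform G B g)"
proof (rule nform_unique[OF B])
  show "cons_red l (nform G B g) \<in> reduced_words B"
    using assms nform(1)[OF B] by (intro cons_red_reduced) auto
  show "wval G (cons_red l (nform G B g)) = letter_value G l \<otimes> g"
    using assms nform_letters[OF B] free_basis_subset[OF B] nform(2)[OF B]
    by (subst wval_cons_red) auto
qed

lemma nform_letter: "free_basis G B \<Longrightarrow> b \<in> B \<Longrightarrow> nform G B b = [(b, True)]"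
  using free_basis_subset[of B]
  by (intro nform_unique) (auto simp: reduced_words_Cons letter_value_def)

lemma free_basis_induct [consumes 2, case_names one letter]:
  assumes B: "free_basis G B" and g: "g \<in> carrier G"
    and one: "P \<one>"
    and letter: "\<And>l g. fst l \<in> B \<Longrightarrow> g \<in> carrier G \<Longrightarrow> P g \<Longrightarrow> P (letter_value G l \<otimes> g)"
  shows "P g"
proof -
  have "P (wval G w)" if "fst ` set w \<subseteq> B" for w
    using that
  proof (induction w)
    case (Cons l w)
    moreover have "wval G w \<in> carrier G"
      using Cons.prems free_basis_subset[OF B] by (intro wval_closed) auto
    ultimately show ?case
      by (auto intro!: letter)
  qed (simp add: one)
  from this[OF nform_letters[OF B g]] show ?thesis
    by (simp add: nform(2)[OF B g])
qed

lemma free_basis_reduced_nontrivial: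
  assumes "free_basis G B" "w \<in> reduced_words B" "wval G w = \<one>" shows "w = []"
  using assms nform_one nform_unique by metis

lemma hom_wval:
  assumes "group K" "h \<in> hom G K" "fst ` set w \<subseteq> carrier G"
  shows "h (wval G w) = wval K (map (map_letter h) w)"
proof -
  interpret K: group K by fact
  interpret h: group_hom G K h by unfold_locales fact
  show ?thesis
    using assms(3)
  proof (induction w)
    case (Cons l w)
    then show ?case by (cases l) (auto simp: letter_value_def)
  qed simp
qed

lemma free_basis_hom_ext:
  assumes B: "free_basis G B" and K: "group K"
    and "h \<in> hom G K" "h' \<in> hom G K" "\<And>b. b \<in> B \<Longrightarrow> h b = h' b" "g \<in> carrier G"
  shows "h g = h' g"
proof -
  note red = nform_letters[OF B \<open>g \<in> carrier G\<close>]
  have "map (map_letter h) (nform G B g) = map (map_letter h') (nform G B g)"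
    using red assms(5) by (intro map_cong) (auto simp: subset_iff map_letter_def image_iff)
  moreover have "fst ` set (nform G B g) \<subseteq> carrier G"
    using red free_basis_subset[OF B] by auto
  ultimately show ?thesis
    using hom_wval[OF K assms(3), of "nform G B g"] hom_wval[OF K assms(4), of "nform G B g"]
    by (simp only: nform(2)[OF B assms(6)])
qed

text \<open>The extension evaluates normal forms in \<open>K\<close>. Multiplicativity is an
  induction over the letters of the left factor, so only \<open>cons_red\<close> has to be compared
  with multiplication in \<open>K\<close>.\<close>

lemma free_basis_extend:
  assumes B: "free_basis G B" and K: "group K" and \<phi>: "\<And>b. b \<in> B \<Longrightarrow> \<phi> b \<in> carrier K"
  shows "\<exists>h\<in>hom G K. \<forall>b\<in>B. h b = \<phi> b"
proof -
  interpret K: group K by fact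
  define h where "h g = wval K (map (map_letter \<phi>) (nform G B g))" for g
  have sub: "fst ` set (map (map_letter \<phi>) w) \<subseteq> carrier K" if "w \<in> reduced_words B" for w
    using reduced_words_letters[OF that] \<phi> by auto
  have closed: "h g \<in> carrier K" if "g \<in> carrier G" for g
    unfolding h_def using sub[OF nform(1)[OF B that]] by simp
  have h_one: "h \<one> = \<one>\<^bsub>K\<^esub>"
    by (simp add: h_def nform_one[OF B])
  have h_letter: "h (letter_value G l \<otimes> g) = letter_value K (map_letter \<phi> l) \<otimes>\<^bsub>K\<^esub> h g"
    if l: "fst l \<in> B" and g: "g \<in> carrier G" for l g
  proof -
    have \<section>: "fst (map_letter \<phi> l) \<in> carrier K" using \<phi> l by simp
    show ?thesis
    proof (cases "nform G B g \<noteq> [] \<and> hd (nform G B g) = flip l")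
      case False
      then show ?thesis
        using nform_letter_mult[OF B l g] by (auto simp: h_def cons_red_def)
    next
      case True
      then obtain w where w: "nform G B g = flip l # w"
        by (cases "nform G B g") auto
      then have "w \<in> reduced_words B"
        using nform(1)[OF B g] by (simp add: reduced_words_Cons)
      then have "wval K (map (map_letter \<phi>) w) \<in> carrier K"
        by (intro K.wval_closed sub)
      then show ?thesis
        using nform_letter_mult[OF B l g] w \<section> by (simp add: h_def cons_red_def K.cancel_left)
    qed
  qed
  have "h (g \<otimes> g') = h g \<otimes>\<^bsub>K\<^esub> h g'" if "g \<in> carrier G" "g' \<in> carrier G" for g g'
    using B that(1)
  proof (induction rule: free_basis_induct)
    case one
    then show ?case using that h_one closed by simp
  next
    case (letter l g)
    moreover have "letter_value G l \<in> carrier G" 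
      using letter free_basis_subset[OF B] by auto
    moreover have "letter_value K (map_letter \<phi> l) \<in> carrier K"
      using letter \<phi> by simp
    ultimately show ?case
      using \<open>g' \<in> carrier G\<close> by (simp add: m_assoc h_letter K.m_assoc closed)
  qed
  then have "h \<in> hom G K"
    by (simp add: hom_def closed)
  moreover have "h b = \<phi> b" if "b \<in> B" for b
    using h_letter[of "(b, True)" \<one>] that free_basis_subset[OF B] \<phi> h_one
    by (auto simp: letter_value_def subset_iff)
  ultimately show ?thesis by blast
qed

end

section \<open>Free bases of subgroups, of free splittings and automorphisms\<close>

definition group_Z2 :: "bool monoid"
  where "group_Z2 = \<lparr>carrier = UNIV, monoid.mult = (\<noteq>), one = False\<rparr>"

lemma group_Z2: "group group_Z2"
  by (rule groupI) (auto simp: group_Z2_def)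

text \<open>Counting homomorphisms to Z/2 makes the rank independent of the basis.
  \<open>extensional\<close> leaves one function for each homomorphism.\<close>

lemma bij_betw_hom_Z2:
  assumes "group G" "free_basis G B"
  shows "bij_betw (\<lambda>h. {b \<in> B. h b}) (hom G group_Z2 \<inter> extensional (carrier G)) (Pow B)"
proof -
  interpret group G by fact
  note B = assms(2)
  have sub: "B \<subseteq> carrier G" using free_basis_subset[OF B] .
  have "inj_on (\<lambda>h. {b \<in> B. h b}) (hom G group_Z2 \<inter> extensional (carrier G))"
  proof (rule inj_onI)
    fix h h' assume h: "h \<in> hom G group_Z2 \<inter> extensional (carrier G)"
      "h' \<in> hom G group_Z2 \<inter> extensional (carrier G)" and "{b \<in> B. h b} = {b \<in> B. h' b}"
    then have *: "h b = h' b" if "b \<in> B" for b using that by blast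
    show "h = h'"
    proof (rule extensionalityI[of h "carrier G"])
      show "h x = h' x" if "x \<in> carrier G" for x
        using h * that by (intro free_basis_hom_ext[OF B group_Z2, of h h' x]) auto
    qed (use h in auto)
  qed
  moreover have "S \<in> (\<lambda>h. {b \<in> B. h b}) ` (hom G group_Z2 \<inter> extensional (carrier G))" if "S \<subseteq> B" for S
  proof -
    obtain h where h: "h \<in> hom G group_Z2" "\<forall>b\<in>B. h b = (b \<in> S)"
      using free_basis_extend[OF B group_Z2, of "\<lambda>b. b \<in> S"] by (auto simp: group_Z2_def)
    have "restrict h (carrier G) \<in> hom G group_Z2"
      using h(1) by (auto simp: hom_def)
    moreover have "{b \<in> B. restrict h (carrier G) b} = S"
      using h(2) sub that by auto
    ultimately show ?thesis by (intro image_eqI[of _ _ "restrict h (carrier G)"]) auto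
  qed
  ultimately show ?thesis by (auto simp: bij_betw_def)
qed

lemma free_basis_card:
  assumes "group G" "free_basis G B" "finite B" "free_basis G C"
  shows "finite C" "card C = card B"
proof -
  have *: "bij_betw (\<lambda>h. {b \<in> X. h b}) (hom G group_Z2 \<inter> extensional (carrier G)) (Pow X)"
    if "X \<in> {B, C}" for X using that assms by (auto intro: bij_betw_hom_Z2)
  have "finite (hom G group_Z2 \<inter> extensional (carrier G))"
    using bij_betw_finite[OF *[of B]] assms(3) by simp
  then show "finite C" using bij_betw_finite[OF *[of C]] by simp
  then have "(2::nat) ^ card C = 2 ^ card B"
    using bij_betw_same_card[OF *[of B]] bij_betw_same_card[OF *[of C]] assms(3)
    by (simp add: card_Pow)
  then show "card C = card B" by simp
qed

lemma cons_red_Bij: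
  assumes "fst l \<in> B"
  shows "restrict (cons_red l) (reduced_words B) \<in> Bij (reduced_words B)"
proof -
  have "bij_betw (cons_red l) (reduced_words B) (reduced_words B)"
    using assms
    by (intro bij_betw_byWitness[where f' = "cons_red (flip l)"])
      (auto simp: cons_red_flip cons_red_flip' cons_red_reduced)
  then show ?thesis by (simp add: Bij_def)
qed

context group
begin

text \<open>Freeness of a subgroup can be tested in the ambient group, and generation with unreduced
  words, since reducing a word does not change its value.\<close>

lemma free_basis_iff_wval:
  assumes "subgroup H G"
  shows "free_basis (G\<lparr>carrier := H\<rparr>) Y \<longleftrightarrow>
    Y \<subseteq> H \<and> inj_on (wval G) (reduced_words Y) \<and> H \<subseteq> wval G ` {w. fst ` set w \<subseteq> Y}"
proof (cases "Y \<subseteq> H")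
  case True
  interpret H: group "G\<lparr>carrier := H\<rparr>" using assms by (rule subgroup.subgroup_is_group) (rule is_group)
  have val: "wval (G\<lparr>carrier := H\<rparr>) w = wval G w" "wval G w \<in> H" if "fst ` set w \<subseteq> Y" for w
    using wval_subgroup[OF assms, of w] that True by auto
  have red: "wval (G\<lparr>carrier := H\<rparr>) w = wval G w" if "w \<in> reduced_words Y" for w
    using val reduced_words_letters[OF that] by simp
  have "wval G ` reduced_words Y = wval G ` {w. fst ` set w \<subseteq> Y}"
  proof (intro equalityI subsetI)
    fix x assume "x \<in> wval G ` {w. fst ` set w \<subseteq> Y}"
    then obtain w where "fst ` set w \<subseteq> Y" "x = wval G w" by auto
    moreover from this obtain v where "v \<in> reduced_words Y" "wval G v = wval G w"
      using ex_reduced_word[of w Y] True subgroup.subset[OF assms] by (meson subset_trans)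
    ultimately show "x \<in> wval G ` reduced_words Y" by (metis imageI)
  qed (use reduced_words_letters in blast)
  moreover have "wval G ` {w. fst ` set w \<subseteq> Y} \<subseteq> H"
    using val by blast
  moreover have "bij_betw (wval (G\<lparr>carrier := H\<rparr>)) (reduced_words Y) H
      \<longleftrightarrow> bij_betw (wval G) (reduced_words Y) H"
    using red by (rule bij_betw_cong)
  ultimately show ?thesis
    using True by (auto simp: free_basis_iff bij_betw_def)
qed (auto simp: free_basis_iff)

text \<open>Van der Waerden's argument: letters act on reduced words by prepending, and the
  permutation belonging to the value of a reduced word sends the empty word to that word. Hence the
  value determines the word.\<close>

lemma free_basis_by_action:
  assumes "B \<subseteq> carrier G" and gen: "carrier G \<subseteq> wval G ` {w. fst ` set w \<subseteq> B}"
    and h: "h \<in> hom G (BijGroup (reduced_words B))"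
    and hb: "\<And>b. b \<in> B \<Longrightarrow> h b = restrict (cons_red (b, True)) (reduced_words B)"
  shows "free_basis G B"
proof -
  interpret K: group "BijGroup (reduced_words B)" by (rule group_BijGroup)
  interpret h: group_hom G "BijGroup (reduced_words B)" h
    by unfold_locales (rule h)
  have letter: "h (letter_value G l) = restrict (cons_red l) (reduced_words B)" if l: "fst l \<in> B" for l
  proof (cases "snd l")
    case True
    then show ?thesis using hb[OF l] by (cases l) (auto simp: letter_value_def)
  next
    case False
    then have l': "l = flip (fst l, True)" by (cases l) (auto simp: flip_def)
    have "inv\<^bsub>BijGroup (reduced_words B)\<^esub> (restrict (cons_red (fst l, True)) (reduced_words B))
        = restrict (cons_red l) (reduced_words B)"
    proof (rule K.inv_equality)
      show "restrict (cons_red l) (reduced_words B) \<otimes>\<^bsub>BijGroup (reduced_words B)\<^esub>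
        restrict (cons_red (fst l, True)) (reduced_words B) = \<one>\<^bsub>BijGroup (reduced_words B)\<^esub>"
        using l cons_red_flip[of _ B "(fst l, True)"] l' cons_red_Bij[of l B] cons_red_Bij[of "(fst l, True)" B]
        by (auto simp: BijGroup_def compose_def fun_eq_iff cons_red_reduced)
    qed (use l cons_red_Bij[of l B] cons_red_Bij[of "(fst l, True)" B] in \<open>auto simp: BijGroup_def\<close>)
    then show ?thesis
      using False hb[OF l] l \<open>B \<subseteq> carrier G\<close> by (auto simp: letter_value_def)
  qed
  have "h (wval G w) [] = w" if "w \<in> reduced_words B" for w
    using that
  proof (induction w)
    case Nil
    then show ?case by (simp add: BijGroup_def)
  next
    case (Cons l w)
    then have w: "w \<in> reduced_words B" "fst l \<in> B" by (auto simp: reduced_words_Cons)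
    then have [simp]: "wval G w \<in> carrier G" "letter_value G l \<in> carrier G"
      using reduced_words_letters[OF w(1)] \<open>B \<subseteq> carrier G\<close> by (auto intro!: wval_closed)
    have "h (wval G (l # w)) = compose (reduced_words B) (restrict (cons_red l) (reduced_words B)) (h (wval G w))"
      using h.hom_closed[of "wval G w"] h.hom_closed[of "letter_value G l"] w letter[OF w(2)]
      by (simp add: BijGroup_def)
    then show ?case
      using Cons.IH[OF w(1)] w Cons.prems by (simp add: compose_def cons_red_Cons)
  qed
  then have "inj_on (wval G) (reduced_words B)"
    by (metis inj_onI)
  then show ?thesis
    using free_basis_iff_wval[OF subgroup_self, of B] assms(1) gen by simp
qed

section \<open>Homomorphisms out of a free splitting and bases adapted to it\<close>

lemma free_splitting_extend:
  assumes "free_splitting G A B" and K: "group K"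
    and f: "f \<in> hom (G\<lparr>carrier := A\<rparr>) K" and g: "g \<in> hom (G\<lparr>carrier := B\<rparr>) K"
  shows "\<exists>h\<in>hom G K. (\<forall>a\<in>A. h a = f a) \<and> (\<forall>b\<in>B. h b = g b)"
proof -
  let ?A = "G\<lparr>carrier := A\<rparr>" and ?B = "G\<lparr>carrier := B\<rparr>"
  let ?i = "free_product_lift G (\<lambda>x. x) (\<lambda>x. x)" and ?P = "free_product ?A ?B"
  have sub: "subgroup A G" "subgroup B G" and iso: "?i \<in> iso ?P G"
    using assms(1) by (auto simp: free_splitting_def)
  have gA: "group ?A" and gB: "group ?B"
    using sub is_group by (auto intro: subgroup.subgroup_is_group)
  have incl: "(\<lambda>x. x) \<in> hom ?A G" "(\<lambda>x. x) \<in> hom ?B G"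
    using sub by (auto simp: hom_def dest: subgroup.subset)
  interpret K: group K by fact
  interpret P: group ?P by (rule group_free_product[OF gA gB])
  define h where "h = free_product_lift K f g \<circ> inv_into (carrier ?P) ?i"
  have "inv_into (carrier ?P) ?i \<in> hom G ?P"
    using P.iso_set_sym[OF iso] by (simp add: iso_def)
  then have hom: "h \<in> hom G K"
    unfolding h_def by (rule Group.hom_compose) (rule free_product_lift_hom[OF gA gB K f g])
  have h: "h (word_prod G (map (case_sum (\<lambda>x. x) (\<lambda>x. x)) w)) = word_prod K (map (case_sum f g) w)"
    if "w \<in> lists (A <+> B)" for w
  proof -
    let ?c = "free_product_rel ?A ?B `` {w}"
    have "?c \<in> carrier ?P"
      using that by (auto simp: free_product_def intro!: quotientI)
    then have "inv_into (carrier ?P) ?i (?i ?c) = ?c"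
      using iso by (intro inv_into_f_f) (auto simp: iso_def bij_betw_def)
    then show ?thesis
      using that free_product_lift_class[OF gA gB is_group incl, of w]
        free_product_lift_class[OF gA gB K f g, of w]
      by (simp add: h_def)
  qed
  have "h a = f a" if "a \<in> A" for a
    using h[of "[Inl a]"] that subgroup.mem_carrier[OF sub(1)] hom_in_carrier[OF f] by (simp add: InlI)
  moreover have "h b = g b" if "b \<in> B" for b
    using h[of "[Inr b]"] that subgroup.mem_carrier[OF sub(2)] hom_in_carrier[OF g] by (simp add: InrI)
  ultimately show ?thesis using hom by blast
qed

lemma free_splitting_generates:
  assumes "free_splitting G A B" "x \<in> carrier G"
  obtains w where "set w \<subseteq> A \<union> B" "x = word_prod G w"
proof -
  let ?A = "G\<lparr>carrier := A\<rparr>" and ?B = "G\<lparr>carrier := B\<rparr>"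
  let ?i = "free_product_lift G (\<lambda>x. x) (\<lambda>x. x)" and ?P = "free_product ?A ?B"
  have sub: "subgroup A G" "subgroup B G" and iso: "?i \<in> iso ?P G"
    using assms(1) by (auto simp: free_splitting_def)
  have gA: "group ?A" and gB: "group ?B"
    using sub is_group by (auto intro: subgroup.subgroup_is_group)
  have incl: "(\<lambda>x. x) \<in> hom ?A G" "(\<lambda>x. x) \<in> hom ?B G"
    using sub by (auto simp: hom_def dest: subgroup.subset)
  obtain c where "c \<in> carrier ?P" "x = ?i c"
    using iso assms(2) by (auto simp: iso_def bij_betw_def)
  then obtain w where w: "w \<in> lists (A <+> B)" "c = free_product_rel ?A ?B `` {w}"
    by (auto simp: free_product_def elim!: quotientE)
  then have "x = word_prod G (map (case_sum (\<lambda>x. x) (\<lambda>x. x)) w)"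
    using free_product_lift_class[OF gA gB is_group incl, of w] \<open>x = ?i c\<close> by simp
  moreover have "set (map (case_sum (\<lambda>x. x) (\<lambda>x. x)) w) \<subseteq> A \<union> B"
    using w(1) by (auto simp: lists_eq_set)
  ultimately show ?thesis using that by blast
qed

text \<open>A homomorphism that is the identity on \<open>A\<close> and trivial on \<open>B\<close>
  sends \<open>x\<close> both to \<open>x\<close> and to the identity.\<close>

lemma free_splitting_Int:
  assumes "free_splitting G A B" "x \<in> A" "x \<in> B"
  shows "x = \<one>"
proof -
  have sub: "subgroup A G" "subgroup B G"
    using assms(1) by (auto simp: free_splitting_def)
  have "(\<lambda>x. x) \<in> hom (G\<lparr>carrier := A\<rparr>) G" "(\<lambda>x. \<one>) \<in> hom (G\<lparr>carrier := B\<rparr>) G"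
    using sub by (auto simp: hom_def dest: subgroup.subset)
  from free_splitting_extend[OF assms(1) is_group this] assms(2,3) show ?thesis
    by metis
qed

text \<open>Each factor acts on the reduced words in \<open>Y \<union> Z\<close> because its own
  basis is free. The universal property of the free product combines the two actions into one of
  \<open>G\<close>, to which van der Waerden's argument applies.\<close>

lemma free_splitting_basis:
  assumes split: "free_splitting G A B"
    and Y: "free_basis (G\<lparr>carrier := A\<rparr>) Y" and Z: "free_basis (G\<lparr>carrier := B\<rparr>) Z"
  shows "free_basis G (Y \<union> Z)" "Y \<inter> Z = {}"
proof -
  let ?K = "BijGroup (reduced_words (Y \<union> Z))"
  have sub: "subgroup A G" "subgroup B G"
    using split by (auto simp: free_splitting_def)
  interpret A: group "G\<lparr>carrier := A\<rparr>" using sub(1) by (rule subgroup.subgroup_is_group) (rule is_group)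
  interpret B: group "G\<lparr>carrier := B\<rparr>" using sub(2) by (rule subgroup.subgroup_is_group) (rule is_group)
  let ?\<phi> = "\<lambda>y. restrict (cons_red (y, True)) (reduced_words (Y \<union> Z))"
  have \<phi>: "?\<phi> y \<in> carrier ?K" if "y \<in> Y \<union> Z" for y
    using that cons_red_Bij[of "(y, True)" "Y \<union> Z"] by (simp add: BijGroup_def)
  obtain f where f: "f \<in> hom (G\<lparr>carrier := A\<rparr>) ?K" "\<forall>y\<in>Y. f y = ?\<phi> y"
    using A.free_basis_extend[OF Y group_BijGroup, of ?\<phi>] \<phi> by blast
  obtain g where g: "g \<in> hom (G\<lparr>carrier := B\<rparr>) ?K" "\<forall>z\<in>Z. g z = ?\<phi> z"
    using B.free_basis_extend[OF Z group_BijGroup, of ?\<phi>] \<phi> by blast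
  obtain h where h: "h \<in> hom G ?K" "\<forall>a\<in>A. h a = f a" "\<forall>b\<in>B. h b = g b"
    using free_splitting_extend[OF split group_BijGroup f(1) g(1)] by blast
  have YA: "Y \<subseteq> A" "A \<subseteq> wval G ` {w. fst ` set w \<subseteq> Y}"
    and ZB: "Z \<subseteq> B" "B \<subseteq> wval G ` {w. fst ` set w \<subseteq> Z}"
    using Y Z by (simp_all add: free_basis_iff_wval sub)
  have YZ: "Y \<union> Z \<subseteq> carrier G"
    using YA ZB sub by (auto dest: subgroup.mem_carrier)
  have gen: "word_prod G w \<in> wval G ` {w. fst ` set w \<subseteq> Y \<union> Z}" if "set w \<subseteq> A \<union> B" for w
    using that
  proof (induction w)
    case Nil
    then show ?case by (auto intro!: image_eqI[of _ _ "[]"])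
  next
    case (Cons x w)
    obtain u where u: "x = wval G u" "fst ` set u \<subseteq> Y \<union> Z"
      using Cons.prems YA(2) ZB(2) by fastforce
    obtain v where v: "word_prod G w = wval G v" "fst ` set v \<subseteq> Y \<union> Z"
      using Cons by auto
    have "wval G (u @ v) = wval G u \<otimes> wval G v"
      using u v YZ by (intro wval_append) blast+
    then have "word_prod G (x # w) = wval G (u @ v)"
      using u v by simp
    then show ?case using u v by (intro image_eqI[of _ _ "u @ v"]) auto
  qed
  show "free_basis G (Y \<union> Z)"
  proof (rule free_basis_by_action[OF YZ _ h(1)])
    show "carrier G \<subseteq> wval G ` {w. fst ` set w \<subseteq> Y \<union> Z}"
      using gen free_splitting_generates[OF split] by (metis subsetI)
    show "h b = restrict (cons_red (b, True)) (reduced_words (Y \<union> Z))" if "b \<in> Y \<union> Z" for b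
      using that h f g YA ZB by auto
  qed
  have "\<one> \<notin> Y"
    using A.free_basis_reduced_nontrivial[OF Y, of "[(\<one>, True)]"]
    by (auto simp: reduced_words_Cons letter_value_def)
  then show "Y \<inter> Z = {}"
    using free_splitting_Int[OF split] YA(1) ZB(1) by blast
qed

lemma nform_subgroup:
  assumes H: "subgroup H G" and Y: "free_basis (G\<lparr>carrier := H\<rparr>) Y"
    and P: "free_basis G P" "Y \<subseteq> P" and "g \<in> H"
  shows "nform G P g = nform (G\<lparr>carrier := H\<rparr>) Y g" "nform G P g \<in> reduced_words Y"
proof -
  interpret H: group "G\<lparr>carrier := H\<rparr>" using H by (rule subgroup.subgroup_is_group) (rule is_group)
  let ?w = "nform (G\<lparr>carrier := H\<rparr>) Y g"
  have red: "?w \<in> reduced_words Y" and val: "wval (G\<lparr>carrier := H\<rparr>) ?w = g"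
    using H.nform[OF Y] \<open>g \<in> H\<close> by auto
  have "wval G ?w = g"
    using wval_subgroup[OF H, of ?w] reduced_words_letters[OF red] H.free_basis_subset[OF Y] val by auto
  then show "nform G P g = ?w"
    using reduced_words_mono[OF red P(2)] by (intro nform_unique[OF P(1)])
  then show "nform G P g \<in> reduced_words Y" using red by simp
qed

section \<open>Automorphisms and images of bases\<close>

lemma auto_of_homs:
  assumes P: "free_basis G P" "free_basis G Q" and f: "f \<in> hom G G" and g: "g \<in> hom G G"
    and "\<And>p. p \<in> P \<Longrightarrow> g (f p) = p" "\<And>q. q \<in> Q \<Longrightarrow> f (g q) = q"
  shows "restrict f (carrier G) \<in> auto G"
proof -
  have id: "id \<in> hom G G" by (auto simp: hom_def)
  have "(g \<circ> f) x = id x" if "x \<in> carrier G" for x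
    by (rule free_basis_hom_ext[OF P(1) is_group _ id, of "g \<circ> f"])
      (use that assms(5) Group.hom_compose[OF f g] in auto)
  moreover have "(f \<circ> g) x = id x" if "x \<in> carrier G" for x
    by (rule free_basis_hom_ext[OF P(2) is_group _ id, of "f \<circ> g"])
      (use that assms(6) Group.hom_compose[OF g f] in auto)
  ultimately have "bij_betw f (carrier G) (carrier G)"
    using f g by (intro bij_betw_byWitness[where f' = g]) (auto simp: hom_def)
  moreover have "restrict f (carrier G) \<in> hom G G"
    using f by (auto simp: hom_def)
  ultimately show ?thesis by (simp add: auto_def Bij_def)
qed

lemma auto_of_bases:
  assumes P: "free_basis G P" "free_basis G Q" and \<phi>: "bij_betw \<phi> P Q"
  shows "\<exists>f\<in>auto G. \<forall>p\<in>P. f p = \<phi> p"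
proof -
  have sub: "P \<subseteq> carrier G" "Q \<subseteq> carrier G" using P by (auto dest: free_basis_subset)
  obtain f where f: "f \<in> hom G G" "\<forall>p\<in>P. f p = \<phi> p"
    using free_basis_extend[OF P(1) is_group, of \<phi>] bij_betwE[OF \<phi>] sub by blast
  obtain g where g: "g \<in> hom G G" "\<forall>q\<in>Q. g q = inv_into P \<phi> q"
    using free_basis_extend[OF P(2) is_group, of "inv_into P \<phi>"]
      bij_betwE[OF bij_betw_inv_into[OF \<phi>]] sub by blast
  have "restrict f (carrier G) \<in> auto G"
    using f g bij_betwE[OF \<phi>] bij_betwE[OF bij_betw_inv_into[OF \<phi>]]
      bij_betw_inv_into_left[OF \<phi>] bij_betw_inv_into_right[OF \<phi>]
    by (intro auto_of_homs[OF P f(1) g(1)]) auto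
  then show ?thesis using f sub by (intro bexI[of _ "restrict f (carrier G)"]) auto
qed

lemma autoD:
  assumes "f \<in> auto G"
  shows "f \<in> hom G G" "bij_betw f (carrier G) (carrier G)" "f \<in> extensional (carrier G)"
    "group_hom G G f"
  using assms is_group by (auto simp: auto_def Bij_def group_hom_def group_hom_axioms_def)

lemma map_letters_reduced:
  assumes "inj_on f B"
  shows "(\<lambda>w. map (map_letter f) w) ` reduced_words B = reduced_words (f ` B)"
proof (intro equalityI subsetI)
  fix v assume "v \<in> (\<lambda>w. map (map_letter f) w) ` reduced_words B"
  then obtain w where "w \<in> reduced_words B" "v = map (map_letter f) w" by auto
  then show "v \<in> reduced_words (f ` B)"
  proof (induction w arbitrary: v)
    case (Cons l w)
    then show ?case
      by (cases w) (use assms in \<open>auto simp: reduced_words_Cons flip_def map_letter_def dest: inj_onD\<close>)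
  qed simp
next
  fix v assume "v \<in> reduced_words (f ` B)"
  then show "v \<in> (\<lambda>w. map (map_letter f) w) ` reduced_words B"
  proof (induction v)
    case (Cons l v)
    then obtain w where w: "w \<in> reduced_words B" "v = map (map_letter f) w"
      unfolding reduced_words_Cons by blast
    obtain b where b: "b \<in> B" "fst l = f b" using Cons.prems by (auto simp: reduced_words_Cons)
    have "(b, snd l) # w \<in> reduced_words B"
      using Cons.prems w b by (cases w) (auto simp: reduced_words_Cons flip_def map_letter_def)
    then show ?case using w b by (intro image_eqI[of _ _ "(b, snd l) # w"]) (auto simp: prod_eq_iff)
  qed (auto intro!: image_eqI[of _ _ "[]"])
qed

lemma free_basis_auto_image:
  assumes f: "f \<in> auto G" and B: "free_basis G B"
  shows "free_basis G (f ` B)"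
proof -
  interpret f: group_hom G G f by (rule autoD[OF f])
  note bij = autoD(2)[OF f] and sub = free_basis_subset[OF B]
  have inj: "inj_on f B" using bij sub by (meson bij_betw_imp_inj_on inj_on_subset)
  have val: "wval G (map (map_letter f) w) = f (wval G w)" if "fst ` set w \<subseteq> B" for w
    using that sub by (intro hom_wval[OF is_group autoD(1)[OF f], symmetric]) auto
  have "inj_on (wval G \<circ> map (map_letter f)) (reduced_words B)"
  proof (rule inj_onI)
    fix u v assume uv: "u \<in> reduced_words B" "v \<in> reduced_words B"
      "(wval G \<circ> map (map_letter f)) u = (wval G \<circ> map (map_letter f)) v"
    then have "f (wval G u) = f (wval G v)"
      using val[OF reduced_words_letters[OF uv(1)]] val[OF reduced_words_letters[OF uv(2)]] by simp
    moreover have "wval G u \<in> carrier G" "wval G v \<in> carrier G"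
      using uv(1,2)[THEN reduced_words_letters] sub by (auto intro!: wval_closed)
    ultimately have "wval G u = wval G v" using bij by (auto simp: bij_betw_def inj_on_def)
    then show "u = v" using nform(3)[OF B] uv by metis
  qed
  then have "inj_on (wval G) (reduced_words (f ` B))"
    using inj_on_imageI[of "wval G" "map (map_letter f)" "reduced_words B"] map_letters_reduced[OF inj] by simp
  moreover have "carrier G \<subseteq> wval G ` {w. fst ` set w \<subseteq> f ` B}"
  proof
    fix x assume "x \<in> carrier G"
    then obtain y where y: "y \<in> carrier G" "x = f y" using bij by (auto simp: bij_betw_def)
    then have "x = wval G (map (map_letter f) (nform G B y))"
      using val[OF nform_letters[OF B y(1)]] nform(2)[OF B y(1)] by simp
    moreover have "fst ` set (map (map_letter f) (nform G B y)) \<subseteq> f ` B"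
      using nform_letters[OF B y(1)] by (auto simp: image_subset_iff)
    ultimately show "x \<in> wval G ` {w. fst ` set w \<subseteq> f ` B}" by blast
  qed
  ultimately show ?thesis
    using free_basis_iff_wval[OF subgroup_self, of "f ` B"] sub by auto
qed

lemma hom_ball_of:
  assumes "group K" "h \<in> hom G K" "B \<subseteq> carrier G" "x \<in> ball_of G B k"
  shows "h x \<in> ball_of K (h ` B) k"
proof -
  obtain w where w: "x = wval G w" "fst ` set w \<subseteq> B" "length w \<le> k"
    using assms(4) by (auto simp: ball_of_def)
  then have "fst ` set w \<subseteq> carrier G"
    using assms(3) by (meson subset_trans)
  then have "h x = wval K (map (map_letter h) w)"
    unfolding w(1) by (rule hom_wval[OF assms(1,2)])
  moreover have "fst ` set (map (map_letter h) w) \<subseteq> h ` B"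
    using w(2) by (auto simp: image_subset_iff)
  moreover have "length (map (map_letter h) w) \<le> k"
    using w(3) by simp
  ultimately show ?thesis
    unfolding ball_of_def by blast
qed

end

section \<open>Tilings of the Cayley tree\<close>

text \<open>Vertices of the Cayley graph are group elements and \<open>u\<close> is joined to \<open>x \<otimes> u\<close> for \<open>x \<in> X\<close>,
  so a subgroup \<open>H\<close> acts by right translations. A fundamental domain of this action is encoded by
  the equivariant map \<open>\<tau>\<close> sending a vertex to the element of \<open>H\<close> that translates the
  domain onto the tile containing that vertex.\<close>

definition tile_step :: "('a, 'b) monoid_scheme \<Rightarrow> 'a set \<Rightarrow> ('a \<Rightarrow> 'a) \<Rightarrow> ('a \<times> 'a) set"
  where "tile_step G X \<tau> = {(u, letter_value G l \<otimes>\<^bsub>G\<^esub> u) |u l.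
    u \<in> carrier G \<and> fst l \<in> X \<and> \<tau> (letter_value G l \<otimes>\<^bsub>G\<^esub> u) = \<tau> u}"

lemma tile_stepI:
  "v = letter_value G l \<otimes>\<^bsub>G\<^esub> u \<Longrightarrow> u \<in> carrier G \<Longrightarrow> fst l \<in> X \<Longrightarrow> \<tau> v = \<tau> u \<Longrightarrow> (u, v) \<in> tile_step G X \<tau>"
  unfolding tile_step_def by blast

text \<open>The quotient is unchanged when \<open>u\<close> is translated by \<open>H\<close>, so it
  is the translation from the base tile to an adjacent one. Edges inside a tile give the identity,
  which is removed.\<close>

definition tile_labels :: "('a, 'b) monoid_scheme \<Rightarrow> 'a set \<Rightarrow> ('a \<Rightarrow> 'a) \<Rightarrow> 'a set"
  where "tile_labels G X \<tau> = {\<tau> (x \<otimes>\<^bsub>G\<^esub> u) \<otimes>\<^bsub>G\<^esub> inv\<^bsub>G\<^esub> (\<tau> u) |x u. x \<in> X \<and> u \<in> carrier G} - {\<one>\<^bsub>G\<^esub>}"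

locale tiling = group G for G (structure) +
  fixes H X \<tau>
  assumes H: "subgroup H G" and X: "X \<subseteq> carrier G"
    and tau_closed: "u \<in> carrier G \<Longrightarrow> \<tau> u \<in> H"
    and tau_right: "u \<in> carrier G \<Longrightarrow> a \<in> H \<Longrightarrow> \<tau> (u \<otimes> a) = \<tau> u \<otimes> a"
    and connected: "u \<in> carrier G \<Longrightarrow> v \<in> carrier G \<Longrightarrow> \<tau> u = \<tau> v \<Longrightarrow> (u, v) \<in> (tile_step G X \<tau>)\<^sup>*"
begin

abbreviation "labels \<equiv> tile_labels G X \<tau>"

definition "boundary = {d \<in> carrier G. \<tau> d = \<one> \<and> (\<exists>l. fst l \<in> X \<and> \<tau> (letter_value G l \<otimes> d) \<noteq> \<one>)}"

lemma boundaryI: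
  "d \<in> carrier G \<Longrightarrow> \<tau> d = \<one> \<Longrightarrow> fst l \<in> X \<Longrightarrow> \<tau> (letter_value G l \<otimes> d) \<noteq> \<one> \<Longrightarrow> d \<in> boundary"
  unfolding boundary_def by blast

text \<open>Positively oriented edges leaving the base tile. The Nielsen--Schreier argument works
  with these edges instead of their labels, since distinct edges turn out to have distinct labels
  only in its course.\<close>

definition "crossings = {(d, x). d \<in> carrier G \<and> \<tau> d = \<one> \<and> x \<in> X \<and> \<tau> (x \<otimes> d) \<noteq> \<one>}"

definition "crossing_label e = \<tau> (snd e \<otimes> fst e)"

lemma H_carrier [simp]: "a \<in> H \<Longrightarrow> a \<in> carrier G"
  using subgroup.mem_carrier[OF H] .

lemma H_mult [simp]: "a \<in> H \<Longrightarrow> b \<in> H \<Longrightarrow> a \<otimes> b \<in> H"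
  using subgroup.m_closed[OF H] .

lemma H_inv [simp]: "a \<in> H \<Longrightarrow> inv a \<in> H"
  using subgroup.m_inv_closed[OF H] .

lemma H_one [simp]: "\<one> \<in> H"
  using subgroup.one_closed[OF H] .

lemma tau_carrier [simp]: "u \<in> carrier G \<Longrightarrow> \<tau> u \<in> carrier G"
  using tau_closed H_carrier by blast

lemma X_carrier [simp]: "x \<in> X \<Longrightarrow> x \<in> carrier G"
  using X by blast

lemma tau_normalize: "u \<in> carrier G \<Longrightarrow> \<tau> (u \<otimes> inv (\<tau> u)) = \<one>"
  by (simp add: tau_right tau_closed)

lemma labels_closed: "labels \<subseteq> H"
  by (auto simp: tile_labels_def tau_closed)

lemma labels_carrier: "labels \<subseteq> carrier G"
  using labels_closed H_carrier by blast

lemma labels_eq: "labels = crossing_label ` crossings"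
proof (intro equalityI subsetI)
  fix y assume "y \<in> labels"
  then obtain x u where xu: "y = \<tau> (x \<otimes> u) \<otimes> inv (\<tau> u)" "x \<in> X" "u \<in> carrier G" "y \<noteq> \<one>"
    by (auto simp: tile_labels_def)
  let ?d = "u \<otimes> inv (\<tau> u)"
  have "\<tau> (x \<otimes> ?d) = y"
    using xu tau_right[of "x \<otimes> u" "inv (\<tau> u)"] by (simp add: m_assoc tau_closed)
  then show "y \<in> crossing_label ` crossings"
    using xu tau_normalize by (intro image_eqI[of _ _ "(?d, x)"]) (auto simp: crossings_def crossing_label_def)
qed (force simp: crossings_def crossing_label_def tile_labels_def)

lemma step_cases:
  assumes l: "fst l \<in> X" and u: "u \<in> carrier G"
  obtains "\<tau> (letter_value G l \<otimes> u) = \<tau> u"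
  | m where "fst m \<in> labels" "\<tau> (letter_value G l \<otimes> u) = letter_value G m \<otimes> \<tau> u"
proof (cases "\<tau> (letter_value G l \<otimes> u) = \<tau> u")
  case False
  let ?x = "fst l"
  have x: "?x \<in> carrier G" using l by simp
  show ?thesis
  proof (cases "snd l")
    case True
    let ?y = "\<tau> (?x \<otimes> u) \<otimes> inv (\<tau> u)"
    have "?y \<noteq> \<one>"
      using False True x u by (auto simp: letter_value_def dest: inv_equality simp: inv_solve_right')
    then have "?y \<in> labels" using l u by (auto simp: tile_labels_def)
    then show ?thesis
      using that(2)[of "(?y, True)"] True x u by (simp add: letter_value_def m_assoc)
  next
    case False': False
    let ?v = "inv ?x \<otimes> u"
    let ?y = "\<tau> (?x \<otimes> ?v) \<otimes> inv (\<tau> ?v)"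
    have v: "?v \<in> carrier G" "?x \<otimes> ?v = u" using x u by (auto simp: cancel_left)
    have "?y \<noteq> \<one>"
      using False False' x u v by (auto simp: letter_value_def inv_solve_right')
    then have "?y \<in> labels" using l v(1) by (auto simp: tile_labels_def simp del: v(2))
    moreover have "\<tau> ?v = inv ?y \<otimes> \<tau> u"
      using v u by (simp add: inv_mult_group m_assoc)
    ultimately show ?thesis
      using that(2)[of "(?y, False)"] False' by (simp add: letter_value_def)
  qed
qed (use that in blast)

lemma label_neq_one: "fst m \<in> labels \<Longrightarrow> letter_value G m \<noteq> \<one>"
  using labels_carrier by (auto simp: letter_value_def tile_labels_def inv_eq_1_iff)

text \<open>A crossing accounts for at most two boundary vertices: its start, and its far end
  translated back into the base tile.\<close>

lemma card_boundary:
  assumes "finite crossings"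
  shows "finite boundary" "card boundary \<le> 2 * card crossings"
proof -
  let ?g = "\<lambda>e. snd e \<otimes> fst e \<otimes> inv (crossing_label e)"
  have *: "boundary \<subseteq> fst ` crossings \<union> ?g ` crossings"
  proof
    fix d assume "d \<in> boundary"
    then obtain l where d: "d \<in> carrier G" "\<tau> d = \<one>" and l: "fst l \<in> X" "\<tau> (letter_value G l \<otimes> d) \<noteq> \<one>"
      by (auto simp: boundary_def)
    show "d \<in> fst ` crossings \<union> ?g ` crossings"
    proof (cases "snd l")
      case True
      then have "(d, fst l) \<in> crossings" using d l by (auto simp: crossings_def letter_value_def)
      then show ?thesis by (intro UnI1 image_eqI[of d fst]) simp_all
    next
      case False
      let ?x = "fst l" and ?u = "inv (fst l) \<otimes> d"
      let ?c = "\<tau> ?u"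
      have u: "?u \<in> carrier G" "?c \<noteq> \<one>" "?x \<otimes> ?u = d"
        using d l False by (auto simp: letter_value_def cancel_left)
      have c: "?c \<in> H" using u tau_closed by simp
      have xu: "?x \<otimes> (?u \<otimes> inv ?c) = d \<otimes> inv ?c"
        using u l c by (simp flip: m_assoc)
      have lab: "crossing_label (?u \<otimes> inv ?c, ?x) = inv ?c"
        using d c by (simp add: crossing_label_def xu tau_right)
      have "inv ?c \<noteq> \<one>" using u(2) c by (simp add: inv_eq_1_iff)
      then have "(?u \<otimes> inv ?c, ?x) \<in> crossings"
        using u l c lab tau_normalize[of ?u] by (auto simp: crossings_def crossing_label_def)
      moreover have "?g (?u \<otimes> inv ?c, ?x) = d"
        unfolding lab using d c by (simp add: xu m_assoc)
      ultimately show ?thesis by (intro UnI2 image_eqI[of d ?g]) simp_all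
    qed
  qed
  then show "finite boundary" by (rule finite_subset) (simp add: assms)
  have "card boundary \<le> card (fst ` crossings \<union> ?g ` crossings)"
    using * assms by (intro card_mono) auto
  also have "\<dots> \<le> card (fst ` crossings) + card (?g ` crossings)"
    by (rule card_Un_le)
  also have "\<dots> \<le> card crossings + card crossings"
    using assms by (intro add_mono card_image_le)
  finally show "card boundary \<le> 2 * card crossings" by simp
qed

text \<open>Another translate of the domain becomes the base tile. This is used to make the tile
  containing a given end the base tile.\<close>

lemma recentre:
  assumes c: "c \<in> H"
  shows "tiling G H X (\<lambda>u. c \<otimes> \<tau> u)"
proof
  fix u assume u: "u \<in> carrier G"
  show "c \<otimes> \<tau> u \<in> H" using u c by (simp add: tau_closed)
  show "c \<otimes> \<tau> (u \<otimes> a) = c \<otimes> \<tau> u \<otimes> a" if "a \<in> H" for a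
    using u c that by (simp add: tau_right m_assoc)
  fix v assume v: "v \<in> carrier G" "c \<otimes> \<tau> u = c \<otimes> \<tau> v"
  have "tile_step G X (\<lambda>u. c \<otimes> \<tau> u) = tile_step G X \<tau>"
  proof -
    have "c \<otimes> \<tau> (letter_value G l \<otimes> w) = c \<otimes> \<tau> w \<longleftrightarrow> \<tau> (letter_value G l \<otimes> w) = \<tau> w"
      if "fst l \<in> X" "w \<in> carrier G" for l w
      using c that by simp
    then show ?thesis unfolding tile_step_def by blast
  qed
  then show "(u, v) \<in> (tile_step G X (\<lambda>u. c \<otimes> \<tau> u))\<^sup>*"
    using connected u v c by simp
qed (use X subgroup.subset[OF H] in auto)

text \<open>Conjugating the basis is a left translation of the tree, which commutes with the right
  action of \<open>H\<close>. As the labels do not change, what is chosen for one automorphism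
  serves its whole outer class.\<close>

lemma translate:
  assumes g: "g \<in> carrier G"
  shows "tiling G H ((\<lambda>x. g \<otimes> x \<otimes> inv g) ` X) (\<lambda>u. \<tau> (inv g \<otimes> u))"
    and "tile_labels G ((\<lambda>x. g \<otimes> x \<otimes> inv g) ` X) (\<lambda>u. \<tau> (inv g \<otimes> u)) = labels"
proof -
  let ?X = "(\<lambda>x. g \<otimes> x \<otimes> inv g) ` X" and ?t = "\<lambda>u. \<tau> (inv g \<otimes> u)"
  have letter: "letter_value G (map_letter (\<lambda>x. g \<otimes> x \<otimes> inv g) l) = g \<otimes> letter_value G l \<otimes> inv g"
    if "fst l \<in> X" for l
    using that g by (auto simp: letter_value_def inv_mult_group m_assoc)
  have step: "(g \<otimes> u, g \<otimes> v) \<in> (tile_step G ?X ?t)\<^sup>*" if "(u, v) \<in> (tile_step G X \<tau>)\<^sup>*" for u v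
    using that
  proof induction
    case (step v w)
    then obtain l where l: "w = letter_value G l \<otimes> v" "v \<in> carrier G" "fst l \<in> X" "\<tau> w = \<tau> v"
      by (auto simp: tile_step_def)
    have "g \<otimes> w = letter_value G (map_letter (\<lambda>x. g \<otimes> x \<otimes> inv g) l) \<otimes> (g \<otimes> v)"
      using l g letter[of l] by (simp add: m_assoc cancel_left)
    moreover have "?t (g \<otimes> w) = ?t (g \<otimes> v)"
      using l g by (simp add: cancel_left)
    ultimately have "(g \<otimes> v, g \<otimes> w) \<in> tile_step G ?X ?t"
      using l g by (intro tile_stepI[of _ _ "map_letter (\<lambda>x. g \<otimes> x \<otimes> inv g) l"]) auto
    then show ?case using step.IH by (rule rtrancl_into_rtrancl[rotated])
  qed simp
  show "tiling G H ?X ?t"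
  proof
    fix u assume u: "u \<in> carrier G"
    show "?t u \<in> H" using u g by (simp add: tau_closed)
    show "?t (u \<otimes> a) = ?t u \<otimes> a" if "a \<in> H" for a
      using u g that tau_right[of "inv g \<otimes> u" a] by (simp add: m_assoc)
    fix v assume v: "v \<in> carrier G" "?t u = ?t v"
    show "(u, v) \<in> (tile_step G ?X ?t)\<^sup>*"
      using step[OF connected[of "inv g \<otimes> u" "inv g \<otimes> v"]] u v g by (simp add: cancel_left)
  qed (use H g X in auto)
  have "\<exists>x u. y = \<tau> (x \<otimes> u) \<otimes> inv \<tau> u \<and> x \<in> X \<and> u \<in> carrier G"
    if "y = ?t (x \<otimes> u) \<otimes> inv ?t u" "u \<in> carrier G" and x: "x \<in> ?X" for x u y
  proof -
    obtain x' where "x' \<in> X" "x = g \<otimes> x' \<otimes> inv g" using x by auto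
    then show ?thesis
      using that g by (intro exI[of _ x'] exI[of _ "inv g \<otimes> u"]) (simp add: m_assoc cancel_left)
  qed
  moreover have "\<exists>x u. y = ?t (x \<otimes> u) \<otimes> inv ?t u \<and> x \<in> ?X \<and> u \<in> carrier G"
    if "y = \<tau> (x \<otimes> u) \<otimes> inv \<tau> u" "x \<in> X" "u \<in> carrier G" for x u y
    using that g by (intro exI[of _ "g \<otimes> x \<otimes> inv g"] exI[of _ "g \<otimes> u"]) (simp add: m_assoc cancel_left)
  ultimately show "tile_labels G ?X ?t = labels"
    unfolding tile_labels_def by blast
qed

end

subsection \<open>Existence\<close>

text \<open>Every vertex descends to \<open>H\<close> by steps that decrease its distance to
  \<open>H\<close>, and \<open>\<tau>\<close> is the element of \<open>H\<close> where the descent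
  ends. A descent never leaves its tile, so tiles are connected; equivariance requires the descent
  to be chosen invariantly under \<open>H\<close>.\<close>

lemma (in group) tiling_exists:
  assumes B: "free_basis G X" and H: "subgroup H G"
  shows "\<exists>\<tau>. tiling G H X \<tau>"
proof -
  have X: "X \<subseteq> carrier G" using free_basis_subset[OF B] .
  note Hc [simp] = subgroup.mem_carrier[OF H]
  define P where "P u k \<longleftrightarrow> (\<exists>w. fst ` set w \<subseteq> X \<and> length w = k \<and> wval G w \<otimes> u \<in> H)" for u k
  define level where "level u = (LEAST k. P u k)" for u
  have ex: "P u (length (nform G X (inv u)))" if "u \<in> carrier G" for u
    unfolding P_def using nform_letters[OF B, of "inv u"] nform(2)[OF B, of "inv u"] that subgroup.one_closed[OF H]
    by (intro exI[of _ "nform G X (inv u)"]) simp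
  have lev: "P u (level u)" if "u \<in> carrier G" for u
    unfolding level_def using ex[OF that] by (rule LeastI)
  have le: "level u \<le> k" if "P u k" for u k
    unfolding level_def using that by (rule Least_le)
  have letX: "letter_value G l \<in> carrier G" if "fst l \<in> X" for l
    using that X by auto
  have P_right: "P (u \<otimes> a) k \<longleftrightarrow> P u k" if u: "u \<in> carrier G" and a: "a \<in> H" for u a k
  proof -
    have "wval G w \<otimes> (u \<otimes> a) \<in> H \<longleftrightarrow> wval G w \<otimes> u \<in> H" if "fst ` set w \<subseteq> X" for w
    proof -
      have w: "wval G w \<in> carrier G" using that X by (intro wval_closed) auto
      have "wval G w \<otimes> u = wval G w \<otimes> (u \<otimes> a) \<otimes> inv a"
        using w u a by (simp add: m_assoc)
      then show ?thesis
        using w u a subgroup.m_closed[OF H] subgroup.m_inv_closed[OF H a] by (metis Hc m_assoc)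
    qed
    then show ?thesis unfolding P_def by blast
  qed
  have level_right: "level (u \<otimes> a) = level u" if "u \<in> carrier G" "a \<in> H" for u a
    unfolding level_def P_right[OF that] ..
  define good where "good u l \<longleftrightarrow> fst l \<in> X \<and> Suc (level (letter_value G l \<otimes> u)) = level u" for u l
  define down where "down u = letter_value G (SOME l. good u l) \<otimes> u" for u
  define \<tau> where "\<tau> u = (down ^^ level u) u" for u
  have good: "\<exists>l. good u l" if u: "u \<in> carrier G" and k: "level u = Suc k" for u k
  proof -
    obtain w where w: "fst ` set w \<subseteq> X" "length w = Suc k" "wval G w \<otimes> u \<in> H"
      using lev[OF u] k unfolding P_def by metis
    obtain v l where vl: "w = v @ [l]" using w(2) by (cases w rule: rev_cases) auto
    have l: "fst l \<in> X" using w(1) vl by simp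
    have "wval G w = wval G v \<otimes> letter_value G l"
      using w(1) vl X letX[OF l] by (subst vl, subst wval_append) auto
    moreover have "wval G v \<in> carrier G" using w(1) vl X by (intro wval_closed) auto
    ultimately have "P (letter_value G l \<otimes> u) k"
      unfolding P_def using w vl letX[OF l] u by (intro exI[of _ v]) (simp add: m_assoc)
    then have "level (letter_value G l \<otimes> u) \<le> k" by (rule le)
    moreover have "level u \<le> Suc (level (letter_value G l \<otimes> u))"
    proof -
      have lu: "letter_value G l \<otimes> u \<in> carrier G" using letX[OF l] u by simp
      obtain w' where w': "fst ` set w' \<subseteq> X" "length w' = level (letter_value G l \<otimes> u)"
        "wval G w' \<otimes> (letter_value G l \<otimes> u) \<in> H"
        using lev[OF lu] unfolding P_def by auto
      have "wval G (w' @ [l]) = wval G w' \<otimes> letter_value G l"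
        using w'(1) X letX[OF l] l by (subst wval_append) auto
      moreover have "wval G w' \<in> carrier G" using w'(1) X by (intro wval_closed) auto
      ultimately have "P u (Suc (level (letter_value G l \<otimes> u)))"
        unfolding P_def using w' l letX[OF l] u by (intro exI[of _ "w' @ [l]"]) (simp add: m_assoc)
      then show ?thesis by (rule le)
    qed
    ultimately show ?thesis using k l unfolding good_def by (intro exI[of _ l]) simp
  qed
  have down: "down u \<in> carrier G" "level (down u) = k"
      "\<exists>l. fst l \<in> X \<and> down u = letter_value G l \<otimes> u" "\<tau> (down u) = \<tau> u"
    if u: "u \<in> carrier G" and k: "level u = Suc k" for u k
  proof -
    define l where "l = (SOME l. good u l)"
    have "good u l" unfolding l_def using someI_ex[OF good[OF u k]] .
    then have l: "fst l \<in> X" "level (letter_value G l \<otimes> u) = k" using k by (auto simp: good_def)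
    have d: "down u = letter_value G l \<otimes> u" by (simp add: down_def l_def)
    show "down u \<in> carrier G" using u l letX d by simp
    show *: "level (down u) = k" using l d by simp
    show "\<exists>l. fst l \<in> X \<and> down u = letter_value G l \<otimes> u" using l d by blast
    show "\<tau> (down u) = \<tau> u"
      unfolding \<tau>_def * k by (simp add: funpow_swap1)
  qed
  have down_right: "down (u \<otimes> a) = down u \<otimes> a" if u: "u \<in> carrier G" and a: "a \<in> H" and k: "level u = Suc k" for u a k
  proof -
    \<comment> \<open>\<open>good\<close> depends only on levels, which are invariant under
      \<open>H\<close>; hence \<open>SOME\<close> selects the same letter at \<open>u\<close> and at
      \<open>u \<otimes> a\<close>.\<close>
    have "good (u \<otimes> a) l \<longleftrightarrow> good u l" for l
    proof (cases "fst l \<in> X")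
      case True
      then show ?thesis
        using u a letX[OF True] level_right[of "letter_value G l \<otimes> u" a] level_right[OF u a]
        by (simp add: good_def m_assoc)
    qed (simp add: good_def)
    then have "(SOME l. good (u \<otimes> a) l) = (SOME l. good u l)" by simp
    moreover have "fst (SOME l. good u l) \<in> X" using someI_ex[OF good[OF u k]] unfolding good_def by simp
    ultimately show ?thesis using u a letX by (simp add: down_def m_assoc)
  qed
  have main: "\<tau> u \<in> H \<and> (\<forall>a\<in>H. \<tau> (u \<otimes> a) = \<tau> u \<otimes> a) \<and> \<tau> (\<tau> u) = \<tau> u
      \<and> (u, \<tau> u) \<in> (tile_step G X \<tau>)\<^sup>* \<and> (\<tau> u, u) \<in> (tile_step G X \<tau>)\<^sup>*" if "u \<in> carrier G" for u
    using that
  proof (induction "level u" arbitrary: u)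
    case 0
    then have u: "u \<in> H" using lev[OF 0(2)] unfolding P_def by auto
    have "level (u \<otimes> a) = 0" if "a \<in> H" for a using level_right[OF 0(2) that] 0 by simp
    then show ?case using u 0 by (simp add: \<tau>_def)
  next
    case (Suc k)
    note d = down[OF Suc.prems Suc.hyps(2)[symmetric]]
    note IH = Suc.hyps(1)[OF d(2)[symmetric] d(1)]
    obtain l where l: "fst l \<in> X" "down u = letter_value G l \<otimes> u" using d(3) by auto
    have 1: "(u, down u) \<in> tile_step G X \<tau>"
      using l Suc.prems d(4) by (intro tile_stepI[of _ _ l])
    have "u = letter_value G (flip l) \<otimes> down u"
      using l Suc.prems X by (auto simp: cancel_left)
    then have 2: "(down u, u) \<in> tile_step G X \<tau>"
      using l d(1,4) by (intro tile_stepI[of _ _ "flip l"]) simp_all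
    have "\<tau> (u \<otimes> a) = \<tau> u \<otimes> a" if a: "a \<in> H" for a
    proof -
      have "level (u \<otimes> a) = Suc k" "u \<otimes> a \<in> carrier G"
        using level_right[OF Suc.prems a] Suc.hyps Suc.prems a by simp_all
      then have "\<tau> (u \<otimes> a) = \<tau> (down (u \<otimes> a))" using down(4) by simp
      also have "\<dots> = \<tau> (down u) \<otimes> a"
        using down_right[OF Suc.prems a] Suc.hyps(2)[symmetric] IH a by auto
      finally show ?thesis using d(4) by simp
    qed
    then show ?case
      using IH d(4) 1 2 by (auto intro: converse_rtrancl_into_rtrancl rtrancl_into_rtrancl)
  qed
  have "tiling G H X \<tau>"
  proof
    fix u v assume "u \<in> carrier G" "v \<in> carrier G" "\<tau> u = \<tau> v"
    then show "(u, v) \<in> (tile_step G X \<tau>)\<^sup>*" using main by (metis rtrancl_trans)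
  qed (use main X subgroup.m_closed[OF H] subgroup.one_closed[OF H] subgroup.m_inv_closed[OF H] in auto)
  then show ?thesis by blast
qed

subsection \<open>The Nielsen--Schreier basis\<close>

locale free_tiling = tiling +
  assumes basis: "free_basis G X"
begin

text \<open>A vertex of the base tile lying in \<open>H\<close>; for \<open>a\<close> in
  \<open>H\<close>, the vertex \<open>base \<otimes> a\<close> then lies in the tile of
  \<open>a\<close>.\<close>

definition "base = inv (\<tau> \<one>)"

text \<open>An edge leaving a tile is recorded by its translate that leaves the tile of value \<open>\<one>\<close>.\<close>

definition crossed :: "'a \<times> bool \<Rightarrow> 'a \<Rightarrow> (('a \<times> 'a) \<times> bool) option"
  where "crossed l u =
    (if \<tau> (letter_value G l \<otimes> u) = \<tau> u then None
     else let v = (if snd l then u else letter_value G l \<otimes> u) in Some ((v \<otimes> inv (\<tau> v), fst l), snd l))"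

definition cross :: "(('a \<times> 'a) \<times> bool) option \<Rightarrow> (('a \<times> 'a) \<times> bool) list \<Rightarrow> (('a \<times> 'a) \<times> bool) list"
  where "cross e w = (case e of None \<Rightarrow> w | Some e \<Rightarrow> cons_red e w)"

text \<open>Words act from the left, so the last letter is the first edge of the path from
  \<open>base\<close>. Crossings are cancelled while they are recorded.\<close>

primrec trace_word :: "('a \<times> bool) list \<Rightarrow> (('a \<times> 'a) \<times> bool) list"
  where "trace_word [] = []"
  | "trace_word (l # w) = cross (crossed l (wval G w \<otimes> base)) (trace_word w)"

definition "trace u = trace_word (nform G X (u \<otimes> inv base))"

lemma base_closed: "base \<in> H"
  by (simp add: base_def tau_closed)

lemma base_carrier [simp]: "base \<in> carrier G"
  using base_closed by simp

lemma tau_base: "\<tau> base = \<one>"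
  using tau_right[of \<one> base] base_closed by (simp add: base_def)

lemma letter_carrier [simp]: "fst l \<in> X \<Longrightarrow> letter_value G l \<in> carrier G"
  by simp

lemma crossed_flip:
  assumes "fst l \<in> X" "u \<in> carrier G"
  shows "crossed (flip l) (letter_value G l \<otimes> u) = map_option flip (crossed l u)"
proof -
  have "letter_value G (flip l) \<otimes> (letter_value G l \<otimes> u) = u"
    using assms by (simp add: cancel_left)
  then show ?thesis
    by (cases "snd l") (auto simp: crossed_def Let_def flip_def[of "(_, _)"])
qed

lemma crossed_crossings:
  assumes l: "fst l \<in> X" and u: "u \<in> carrier G" and e: "crossed l u = Some e"
  shows "fst e \<in> crossings"
proof -
  define v where "v = (if snd l then u else letter_value G l \<otimes> u)"
  have v: "v \<in> carrier G" "\<tau> (fst l \<otimes> v) \<noteq> \<tau> v" "e = ((v \<otimes> inv (\<tau> v), fst l), snd l)"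
    using assms by (auto simp: crossed_def v_def Let_def letter_value_def cancel_left split: if_splits)
  have "fst l \<otimes> (v \<otimes> inv (\<tau> v)) = fst l \<otimes> v \<otimes> inv (\<tau> v)"
    using v l by (simp add: m_assoc)
  then have "\<tau> (fst l \<otimes> (v \<otimes> inv (\<tau> v))) = \<tau> (fst l \<otimes> v) \<otimes> inv (\<tau> v)"
    using v l by (simp add: tau_right tau_closed)
  moreover have "\<dots> \<noteq> \<one>"
    using v l by (auto simp: inv_solve_right')
  ultimately show ?thesis
    using v l tau_normalize by (auto simp: crossings_def)
qed

lemma cross_reduced:
  "w \<in> reduced_words crossings \<Longrightarrow> fst l \<in> X \<Longrightarrow> u \<in> carrier G \<Longrightarrow>
     cross (crossed l u) w \<in> reduced_words crossings"
  using crossed_crossings[of l u] by (auto simp: cross_def split: option.split intro: cons_red_reduced)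

lemma trace_word_reduced: "fst ` set w \<subseteq> X \<Longrightarrow> trace_word w \<in> reduced_words crossings"
proof (induction w)
  case (Cons l w)
  moreover have "wval G w \<in> carrier G" using Cons.prems X by (intro wval_closed) auto
  ultimately show ?case by (auto intro!: cross_reduced)
qed simp

lemma trace_reduced: "u \<in> carrier G \<Longrightarrow> trace u \<in> reduced_words crossings"
  unfolding trace_def by (intro trace_word_reduced nform_letters[OF basis]) simp

lemma trace_base: "trace base = []"
  by (simp add: trace_def nform_one[OF basis])

text \<open>This is where the Cayley graph being a tree enters: if the new edge backtracks on the
  reduced path to \<open>u\<close>, the crossing recorded for that edge, if there is one, cancels
  too.\<close>

lemma trace_step:
  assumes l: "fst l \<in> X" and u: "u \<in> carrier G"
  shows "trace (letter_value G l \<otimes> u) = cross (crossed l u) (trace u)"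
proof -
  let ?n = "nform G X (u \<otimes> inv base)"
  have n: "?n \<in> reduced_words X" "wval G ?n = u \<otimes> inv base"
    using nform[OF basis] u by auto
  have *: "trace (letter_value G l \<otimes> u) = trace_word (cons_red l ?n)"
    using nform_letter_mult[OF basis l, of "u \<otimes> inv base"] u l by (simp add: trace_def m_assoc)
  show ?thesis
  proof (cases "?n \<noteq> [] \<and> hd ?n = flip l")
    case False
    then show ?thesis
      using n(2) u unfolding * by (auto simp: cons_red_def trace_def m_assoc)
  next
    case True
    then obtain w where w: "?n = flip l # w" by (cases ?n) auto
    then have "w \<in> reduced_words X" using n by (simp add: reduced_words_Cons)
    then have red: "trace_word w \<in> reduced_words crossings" and wc: "wval G w \<in> carrier G"
      using trace_word_reduced reduced_words_letters X by (blast intro: wval_closed)+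
    have "inv (letter_value G l) \<otimes> wval G w = u \<otimes> inv base"
      using n(2) l w by simp
    then have "wval G w = letter_value G l \<otimes> (u \<otimes> inv base)"
      using l u wc by (metis base_carrier cancel_left(2) inv_closed letter_carrier)
    then have "wval G w \<otimes> base = letter_value G l \<otimes> u"
      using l u by (simp add: m_assoc)
    then have "trace u = cross (map_option flip (crossed l u)) (trace_word w)"
      using w crossed_flip[OF l u] by (simp add: trace_def)
    then have "cross (crossed l u) (trace u) = trace_word w"
      using red cons_red_flip'[OF red] by (cases "crossed l u") (auto simp: cross_def)
    then show ?thesis
      unfolding * using w by (simp add: cons_red_def)
  qed
qed

lemma trace_tile: "(u, v) \<in> (tile_step G X \<tau>)\<^sup>* \<Longrightarrow> trace u = trace v"
proof (induction rule: rtrancl_induct)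
  case (step v w)
  then obtain l where "v \<in> carrier G" "fst l \<in> X" "\<tau> (letter_value G l \<otimes> v) = \<tau> v" "w = letter_value G l \<otimes> v"
    by (auto simp: tile_step_def)
  then show ?case using step.IH by (simp add: trace_step crossed_def cross_def)
qed simp

lemma crossing_label_in: "e \<in> crossings \<Longrightarrow> crossing_label e \<in> labels"
  by (simp add: labels_eq)

lemma crossing_label_H: "e \<in> crossings \<Longrightarrow> crossing_label e \<in> H"
  using crossing_label_in labels_closed by blast

text \<open>A translate of the crossing \<open>e\<close> leads from the tile of \<open>a\<close> to
  the tile of \<open>crossing_label e \<otimes> a\<close>. The trace is constant on tiles, so it
  does not matter at which vertices a tile is entered and left.\<close>

lemma trace_label:
  assumes e: "e \<in> crossings" and a: "a \<in> H"
  shows "trace (base \<otimes> (crossing_label e \<otimes> a)) = cons_red (e, True) (trace (base \<otimes> a))"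
proof -
  obtain d x where ex: "e = (d, x)" "d \<in> carrier G" "\<tau> d = \<one>" "x \<in> X" "\<tau> (x \<otimes> d) \<noteq> \<one>"
    using e by (auto simp: crossings_def)
  let ?y = "crossing_label e"
  have y: "?y \<in> H" "?y = \<tau> (x \<otimes> d)" using crossing_label_H[OF e] ex by (auto simp: crossing_label_def)
  have t: "\<tau> (base \<otimes> b) = b" "\<tau> (d \<otimes> b) = b" if "b \<in> H" for b
    using that ex by (simp_all add: tau_right tau_base)
  have xd: "\<tau> (x \<otimes> (d \<otimes> a)) = ?y \<otimes> a"
    using tau_right[of "x \<otimes> d" a] ex a y by (simp add: m_assoc)
  have neq: "?y \<otimes> a \<noteq> a" using ex y a by (simp add: r_cancel_one)
  have "trace (base \<otimes> (?y \<otimes> a)) = trace (x \<otimes> (d \<otimes> a))"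
    using ex a y xd t by (intro trace_tile connected) auto
  also have "\<dots> = cross (crossed (x, True) (d \<otimes> a)) (trace (d \<otimes> a))"
    using trace_step[of "(x, True)" "d \<otimes> a"] ex a by (simp add: letter_value_def)
  also have "crossed (x, True) (d \<otimes> a) = Some (e, True)"
    using ex a xd neq t[OF a] by (simp add: crossed_def letter_value_def m_assoc)
  also have "trace (d \<otimes> a) = trace (base \<otimes> a)"
    using ex a t by (intro trace_tile connected) auto
  finally show ?thesis by (simp add: cross_def)
qed

lemma trace_letter:
  assumes l: "fst l \<in> crossings" and a: "a \<in> H"
  shows "trace (base \<otimes> (letter_value G (map_letter crossing_label l) \<otimes> a)) = cons_red l (trace (base \<otimes> a))"
proof (cases "snd l")
  case True
  then show ?thesis
    using trace_label[OF l a] by (cases l) (simp add: letter_value_def)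
next
  case False
  let ?y = "crossing_label (fst l)"
  have y: "?y \<in> H" by (rule crossing_label_H[OF l])
  have "trace (base \<otimes> a) = cons_red (fst l, True) (trace (base \<otimes> (inv ?y \<otimes> a)))"
    using trace_label[OF l, of "inv ?y \<otimes> a"] y a by (simp add: cancel_left)
  moreover have "l = flip (fst l, True)" using False by (cases l) (auto simp: flip_def)
  moreover have "trace (base \<otimes> (inv ?y \<otimes> a)) \<in> reduced_words crossings"
    using y a by (intro trace_reduced) simp
  ultimately show ?thesis
    using cons_red_flip[of _ crossings "(fst l, True)"] False by (simp add: letter_value_def)
qed

text \<open>The trace inverts evaluation; hence reduced words in the crossings have distinct values
  in \<open>H\<close>, which is the freeness half of Nielsen--Schreier.\<close>

lemma trace_labels_word:
  assumes "w \<in> reduced_words crossings"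
  shows "trace (base \<otimes> wval G (map (map_letter crossing_label) w)) = w"
  using assms
proof (induction w)
  case Nil
  then show ?case by (simp add: trace_base)
next
  case (Cons l w)
  then have w: "w \<in> reduced_words crossings" "fst l \<in> crossings" by (auto simp: reduced_words_Cons)
  have "fst ` set (map (map_letter crossing_label) w) \<subseteq> H"
    using reduced_words_letters[OF w(1)] crossing_label_H by auto
  then have "wval G (map (map_letter crossing_label) w) \<in> H"
    using wval_subgroup(2)[OF H] by blast
  from trace_letter[OF w(2) this] show ?case
    using Cons w by (simp add: cons_red_Cons)
qed

lemma inj_on_crossing_label: "inj_on crossing_label crossings"
proof (rule inj_onI)
  fix e e' assume *: "e \<in> crossings" "e' \<in> crossings" "crossing_label e = crossing_label e'"
  then have "[(e, True)] = [(e', True)]"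
    using trace_labels_word[of "[(e, True)]"] trace_labels_word[of "[(e', True)]"]
    by (simp add: reduced_words_Cons map_letter_def)
  then show "e = e'" by simp
qed

lemma card_labels: "card labels = card crossings"
  unfolding labels_eq by (rule card_image[OF inj_on_crossing_label])

lemma finite_labels: "finite labels \<longleftrightarrow> finite crossings"
  unfolding labels_eq by (rule finite_image_iff[OF inj_on_crossing_label])

text \<open>An edge changes the tile by one label or not at all, so a walk crosses no more borders
  than it has edges.\<close>

lemma tau_walk_labels:
  "fst ` set w \<subseteq> X \<Longrightarrow> \<exists>v. fst ` set v \<subseteq> labels \<and> length v \<le> length w \<and>
     \<tau> (wval G w \<otimes> p) = wval G v \<otimes> \<tau> p" if p: "p \<in> carrier G" for p
proof (induction w)
  case Nil
  then show ?case using p by (intro exI[of _ "[]"]) simp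
next
  case (Cons l w)
  then obtain v where v: "fst ` set v \<subseteq> labels" "length v \<le> length w" "\<tau> (wval G w \<otimes> p) = wval G v \<otimes> \<tau> p"
    by auto
  have l: "fst l \<in> X" using Cons.prems by simp
  have w: "wval G w \<in> carrier G" using Cons.prems X by (intro wval_closed) auto
  have vc: "wval G v \<in> carrier G" using v labels_carrier by (intro wval_closed) auto
  show ?case
  proof (rule step_cases[OF l, of "wval G w \<otimes> p"])
    show "wval G w \<otimes> p \<in> carrier G" using w p by simp
  next
    assume "\<tau> (letter_value G l \<otimes> (wval G w \<otimes> p)) = \<tau> (wval G w \<otimes> p)"
    then show ?thesis using v w l p by (intro exI[of _ v]) (simp add: m_assoc)
  next
    fix m assume m: "fst m \<in> labels"
      "\<tau> (letter_value G l \<otimes> (wval G w \<otimes> p)) = letter_value G m \<otimes> \<tau> (wval G w \<otimes> p)"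
    moreover have "letter_value G m \<in> carrier G" using m(1) labels_carrier by auto
    ultimately show ?thesis using v vc w l p by (intro exI[of _ "m # v"]) (simp add: m_assoc)
  qed
qed

text \<open>Generation comes from walking from \<open>base\<close> to
  \<open>base \<otimes> a\<close> and collecting the labels of the borders crossed.\<close>

theorem Nielsen_Schreier: "free_basis (G\<lparr>carrier := H\<rparr>) labels"
proof -
  have "inj_on (wval G \<circ> map (map_letter crossing_label)) (reduced_words crossings)"
    by (rule inj_on_inverseI[where g = "\<lambda>x. trace (base \<otimes> x)"]) (simp add: trace_labels_word)
  then have "inj_on (wval G) (reduced_words labels)"
    unfolding labels_eq map_letters_reduced[OF inj_on_crossing_label, symmetric]
    by (rule inj_on_imageI)
  moreover have "H \<subseteq> wval G ` {w. fst ` set w \<subseteq> labels}"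
  proof
    fix a assume a: "a \<in> H"
    let ?n = "nform G X (base \<otimes> a \<otimes> inv base)"
    have n: "fst ` set ?n \<subseteq> X" "wval G ?n = base \<otimes> a \<otimes> inv base"
      using nform_letters[OF basis] nform(2)[OF basis] a by auto
    have "\<tau> (wval G ?n \<otimes> base) = a"
      using a n by (simp add: m_assoc tau_right tau_base)
    then show "a \<in> wval G ` {w. fst ` set w \<subseteq> labels}"
      using tau_walk_labels[OF base_carrier n(1)] labels_carrier
      by (auto simp: tau_base intro!: image_eqI)
  qed
  ultimately show ?thesis
    using labels_closed by (simp add: free_basis_iff_wval[OF H])
qed

lemma tau_ball:
  assumes "h \<in> ball_of G X k" "p \<in> carrier G"
  shows "\<tau> (h \<otimes> p) \<otimes> inv (\<tau> p) \<in> ball_of G labels k"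
proof -
  obtain w where w: "h = wval G w" "fst ` set w \<subseteq> X" "length w \<le> k"
    using assms(1) by (auto simp: ball_of_def)
  obtain v where v: "fst ` set v \<subseteq> labels" "length v \<le> length w" "\<tau> (wval G w \<otimes> p) = wval G v \<otimes> \<tau> p"
    using tau_walk_labels[OF assms(2) w(2)] by auto
  have "wval G v \<in> carrier G" using v labels_carrier by (intro wval_closed) auto
  then have "\<tau> (h \<otimes> p) \<otimes> inv (\<tau> p) = wval G v"
    using v w assms(2) by (simp add: m_assoc)
  then show ?thesis using v w unfolding ball_of_def by (intro CollectI exI[of _ v]) auto
qed

subsection \<open>Comparison of tilings\<close>

abbreviation "hform \<equiv> nform (G\<lparr>carrier := H\<rparr>) labels"

text \<open>Since the tile graph is a tree, a walk leaves every tile on the geodesic between its end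
  points.\<close>

lemma walk_leaves:
  assumes "fst ` set w \<subseteq> X" "p \<in> carrier G"
    "s @ t = hform (\<tau> (wval G w \<otimes> p) \<otimes> inv (\<tau> p))" "s \<noteq> []"
  shows "\<exists>r v l. w = r @ l # v \<and> \<tau> (wval G v \<otimes> p) = wval G t \<otimes> \<tau> p \<and>
    \<tau> (letter_value G l \<otimes> (wval G v \<otimes> p)) \<noteq> \<tau> (wval G v \<otimes> p)"
  using assms(1,3,4)
\<comment> \<open>Fixing \<open>t\<close> and varying \<open>s\<close> follows one intermediate
  tile; \<open>s \<noteq> []\<close> says that the end of the walk lies beyond it.\<close>
proof (induction w arbitrary: s)
  case Nil
  interpret H: group "G\<lparr>carrier := H\<rparr>" using H by (rule subgroup.subgroup_is_group) (rule is_group)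
  show ?case
    using Nil assms(2) H.nform_one[OF Nielsen_Schreier] by simp
next
  case (Cons l w)
  interpret H: group "G\<lparr>carrier := H\<rparr>" using H by (rule subgroup.subgroup_is_group) (rule is_group)
  let ?u = "wval G w \<otimes> p" and ?p = "inv (\<tau> p)"
  let ?n = "hform (\<tau> ?u \<otimes> ?p)"
  have l: "fst l \<in> X" and w: "fst ` set w \<subseteq> X" using Cons.prems by auto
  have wc: "wval G w \<in> carrier G" using w X by (intro wval_closed) auto
  have u: "?u \<in> carrier G" using wc assms(2) by simp
  have eq: "wval G (l # w) \<otimes> p = letter_value G l \<otimes> ?u"
    using wc l assms(2) by (simp add: m_assoc)
  have tu: "\<tau> ?u \<in> H" "?p \<in> H" using u assms(2) tau_closed by auto
  have ext: ?case if "\<exists>r v l. w = r @ l # v \<and> \<tau> (wval G v \<otimes> p) = wval G t \<otimes> \<tau> p \<and>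
      \<tau> (letter_value G l \<otimes> (wval G v \<otimes> p)) \<noteq> \<tau> (wval G v \<otimes> p)"
    using that by (metis append_Cons)
  show ?case
  proof (rule step_cases[OF l u])
    assume "\<tau> (letter_value G l \<otimes> ?u) = \<tau> ?u"
    then have "s @ t = ?n" using Cons.prems(2) unfolding eq by simp
    then show ?thesis using Cons.IH[OF w _ Cons.prems(3)] ext by blast
  next
    fix m assume m: "fst m \<in> labels" "\<tau> (letter_value G l \<otimes> ?u) = letter_value G m \<otimes> \<tau> ?u"
    have mH: "letter_value G m \<in> H"
      using m labels_closed by (auto simp: letter_value_def)
    have lv: "letter_value (G\<lparr>carrier := H\<rparr>) m = letter_value G m"
      using m labels_closed m_inv_consistent[OF H] by (auto simp: letter_value_def)
    have red: "?n \<in> reduced_words labels" "wval (G\<lparr>carrier := H\<rparr>) ?n = \<tau> ?u \<otimes> ?p"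
      using H.nform(1,2)[OF Nielsen_Schreier, of "\<tau> ?u \<otimes> ?p"] tu by auto
    have val: "wval G ?n = \<tau> ?u \<otimes> ?p"
      using wval_subgroup(1)[OF H, of ?n] reduced_words_letters[OF red(1)] labels_closed red(2) by auto
    have st: "s @ t = cons_red m ?n"
      using Cons.prems(2) H.nform_letter_mult[OF Nielsen_Schreier m(1), of "\<tau> ?u \<otimes> ?p"] m(2) tu mH
      unfolding eq lv by (simp add: m_assoc)
    show ?thesis
    proof (cases "?n \<noteq> [] \<and> hd ?n = flip m")
      \<comment> \<open>The last edge shortens the geodesic between tiles, so the longer geodesic
        before it already passed through the tile of \<open>t\<close>.\<close>
      case True
      then have "(flip m # s) @ t = ?n"
        using st by (cases ?n) (auto simp: cons_red_def)
      then show ?thesis using Cons.IH[OF w, of "flip m # s"] ext by simp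
    next
      case False
      then have "s @ t = m # ?n" using st by (auto simp: cons_red_def)
      then obtain s' where s': "s = m # s'" "s' @ t = ?n"
        using Cons.prems(3) by (cases s) auto
      show ?thesis
      proof (cases "s' = []")
        \<comment> \<open>Here the last edge is itself an exit from the tile of
          \<open>t\<close>.\<close>
        case True
        then have "\<tau> ?u = wval G t \<otimes> \<tau> p" using s' val u assms(2) by (simp add: m_assoc)
        moreover have "\<tau> (letter_value G l \<otimes> ?u) \<noteq> \<tau> ?u"
          using m label_neq_one[OF m(1)] mH tu by (simp add: r_cancel_one)
        ultimately show ?thesis by (intro exI[of _ "[]"] exI[of _ w] exI[of _ l]) simp
      next
        case False
        then show ?thesis using Cons.IH[OF w s'(2)] ext by blast
      qed
    qed
  qed
qed

text \<open>Refine a walk in a tile of the second tiling to a walk along \<open>X\<close>; it stays close to that tile, and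
  each tile it leaves does so at one of boundedly many places.\<close>

lemma tile_distance:
  assumes T': "tiling G H X' \<tau>'" and X': "X' \<subseteq> ball_of G X k"
    and fin: "finite X" "finite labels"
    and p: "p \<in> carrier G" and q: "q \<in> carrier G" and pq: "\<tau>' p = \<tau>' q"
  shows "\<tau> q \<otimes> inv (\<tau> p) \<in> ball_of G labels (card boundary * card (ball_of G X k))"
proof -
  interpret T': tiling G H X' \<tau>' by fact
  interpret H: group "G\<lparr>carrier := H\<rparr>" using H by (rule subgroup.subgroup_is_group) (rule is_group)
  let ?B = "ball_of G X k"
  \<comment> \<open>Every edge of the second tree becomes a word of length at most \<open>k\<close>
    in \<open>X\<close>. Each intermediate vertex is therefore \<open>h \<otimes> u\<close> with
    \<open>u\<close> in the second tile and \<open>h\<close> in the ball.\<close>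
  have near: "\<exists>w. fst ` set w \<subseteq> X \<and> y = wval G w \<otimes> p \<and> y \<in> carrier G \<and> \<tau>' y = \<tau>' p \<and>
      (\<forall>r v. w = r @ v \<longrightarrow> (\<exists>h\<in>?B. \<exists>u\<in>carrier G. \<tau>' u = \<tau>' p \<and> wval G v \<otimes> p = h \<otimes> u))"
    if "(p, y) \<in> (tile_step G X' \<tau>')\<^sup>*" for y
    using that
  proof (induction rule: rtrancl_induct)
    case base
    then show ?case using p ball_of_one[of X k] by (intro exI[of _ "[]"]) force
  next
    case (step y z)
    then obtain w where w: "fst ` set w \<subseteq> X" "y = wval G w \<otimes> p" "y \<in> carrier G" "\<tau>' y = \<tau>' p"
      "\<And>r v. w = r @ v \<Longrightarrow> \<exists>h\<in>?B. \<exists>u\<in>carrier G. \<tau>' u = \<tau>' p \<and> wval G v \<otimes> p = h \<otimes> u"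
      by blast
    obtain l where l: "fst l \<in> X'" "z = letter_value G l \<otimes> y" "\<tau>' z = \<tau>' y"
      using step.hyps(2) by (auto simp: tile_step_def)
    obtain w' where w': "letter_value G l = wval G w'" "fst ` set w' \<subseteq> X" "length w' \<le> k"
      using ball_of_letter[OF X X' l(1)] by (auto simp: ball_of_def)
    have w'c: "fst ` set w' \<subseteq> carrier G" and wc: "fst ` set w \<subseteq> carrier G"
      using w' w X by (meson subset_trans)+
    have "\<exists>h\<in>?B. \<exists>u\<in>carrier G. \<tau>' u = \<tau>' p \<and> wval G v \<otimes> p = h \<otimes> u" if v: "w' @ w = r @ v" for r v
    proof -
      consider s where "w = s @ v" | s where "w' = r @ s" "v = s @ w"
        using v by (auto simp: append_eq_append_conv2)
      then show ?thesis
      proof cases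
        case 1
        then show ?thesis by (rule w(5))
      next
        case (2 s)
        have s: "fst ` set s \<subseteq> X" "length s \<le> k" using w' 2 by auto
        then have sB: "wval G s \<in> ?B" unfolding ball_of_def by blast
        have "wval G v = wval G s \<otimes> wval G w"
          unfolding 2(2) using s(1) X wc by (intro wval_append) (meson subset_trans)+
        then have "wval G v \<otimes> p = wval G s \<otimes> y"
          using w(2) wc p ball_of_closed[OF X sB] by (simp add: m_assoc)
        then show ?thesis using sB w(3,4) by blast
      qed
    qed
    moreover have "z = wval G (w' @ w) \<otimes> p"
      using l(2) w(2) w'(1) wval_append[OF w'c wc] w'c wc p by (simp add: m_assoc)
    moreover have "z \<in> carrier G" using l w by simp
    ultimately show ?case using w w' l by (intro exI[of _ "w' @ w"]) auto
  qed
  obtain w where w: "fst ` set w \<subseteq> X" "q = wval G w \<otimes> p"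
      "\<And>r v. w = r @ v \<Longrightarrow> \<exists>h\<in>?B. \<exists>u\<in>carrier G. \<tau>' u = \<tau>' p \<and> wval G v \<otimes> p = h \<otimes> u"
    using near[OF T'.connected[OF p q pq]] by blast
  let ?g = "\<tau> q \<otimes> inv (\<tau> p)"
  let ?N = "hform ?g"
  have g: "?g \<in> H" using p q tau_closed by simp
  have red: "?N \<in> reduced_words labels" and valH: "wval (G\<lparr>carrier := H\<rparr>) ?N = ?g"
    using H.nform(1,2)[OF Nielsen_Schreier, of ?g] g by auto
  have letters: "fst ` set ?N \<subseteq> labels" using reduced_words_letters[OF red] .
  have val: "wval G ?N = ?g"
    using wval_subgroup(1)[OF H, of ?N] letters labels_closed valH by auto
  \<comment> \<open>Suffixes, because words act from the left: \<open>c j\<close> is the tile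
    reached after \<open>j\<close> steps of the geodesic starting at the tile of
    \<open>p\<close>.\<close>
  define t where "t j = drop (length ?N - j) ?N" for j
  define c where "c j = wval G (t j) \<otimes> \<tau> p" for j
  have tred: "t j \<in> reduced_words labels" for j
    using red reduced_words_append[of "take (length ?N - j) ?N" "drop (length ?N - j) ?N"]
    by (simp add: t_def)
  have tH: "wval G (t j) \<in> H" for j
    using wval_subgroup(2)[OF H] reduced_words_letters[OF tred] labels_closed by blast
  have cH: "c j \<in> H" for j using tH p tau_closed by (simp add: c_def)
  have "\<exists>e\<in>boundary \<times> ?B. \<exists>u\<in>carrier G. \<tau>' u = \<tau>' p \<and> fst e \<otimes> c j = snd e \<otimes> u"
    if j: "j < length ?N" for j
  proof -
    have "take (length ?N - j) ?N @ t j = hform (\<tau> (wval G w \<otimes> p) \<otimes> inv (\<tau> p))"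
      using w(2) by (simp add: t_def)
    moreover have "take (length ?N - j) ?N \<noteq> []" using j by auto
    ultimately obtain r v l where v: "w = r @ l # v" "\<tau> (wval G v \<otimes> p) = c j"
      "\<tau> (letter_value G l \<otimes> (wval G v \<otimes> p)) \<noteq> \<tau> (wval G v \<otimes> p)"
      using walk_leaves[OF w(1) p] unfolding c_def by blast
    obtain h u where hu: "h \<in> ?B" "u \<in> carrier G" "\<tau>' u = \<tau>' p" "wval G v \<otimes> p = h \<otimes> u"
      using w(3)[of "r @ [l]" v] v(1) by auto
    let ?z = "wval G v \<otimes> p"
    let ?d = "?z \<otimes> inv (c j)"
    have l: "fst l \<in> X" using w(1) v(1) by auto
    have z: "?z \<in> carrier G" using hu ball_of_closed[OF X] by simp
    have "letter_value G l \<otimes> ?d = letter_value G l \<otimes> ?z \<otimes> inv (c j)"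
      using l z cH by (simp add: m_assoc)
    then have "\<tau> (letter_value G l \<otimes> ?d) = \<tau> (letter_value G l \<otimes> ?z) \<otimes> inv (c j)"
      using l z cH by (simp add: tau_right)
    moreover have "\<dots> \<noteq> \<one>"
      using v(2,3) l z cH by (auto simp: inv_solve_right')
    moreover have "\<tau> ?d = \<one>" using z cH v(2) by (simp add: tau_right)
    ultimately have "?d \<in> boundary"
      using z cH l by (intro boundaryI[of _ l]) simp_all
    moreover have "?d \<otimes> c j = h \<otimes> u" using z cH[of j] hu by (simp add: m_assoc)
    ultimately show ?thesis using hu by (intro bexI[of _ "(?d, h)"] bexI[of _ u]) auto
  qed
  then obtain e where e: "\<And>j. j < length ?N \<Longrightarrow> e j \<in> boundary \<times> ?B"
      "\<And>j. j < length ?N \<Longrightarrow> \<exists>u\<in>carrier G. \<tau>' u = \<tau>' p \<and> fst (e j) \<otimes> c j = snd (e j) \<otimes> u"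
    by metis
  \<comment> \<open>A boundary vertex \<open>d\<close> and a correction \<open>h\<close> determine
    the tile \<open>c j\<close>: the vertex \<open>inv h \<otimes> d \<otimes> c j\<close> lies in
    the second tile of \<open>p\<close>, and \<open>\<tau>'\<close> is equivariant. So the geodesic
    is no longer than the number of such pairs.\<close>
  have "inj_on e {..<length ?N}"
  proof (rule inj_onI)
    fix i j assume ij: "i \<in> {..<length ?N}" "j \<in> {..<length ?N}" "e i = e j"
    let ?f = "inv (snd (e i)) \<otimes> fst (e i)"
    have ec: "fst (e i) \<in> carrier G" "snd (e i) \<in> carrier G"
      using e(1)[of i] ij ball_of_closed[OF X] by (auto simp: boundary_def)
    have "\<tau>' ?f \<otimes> c m = \<tau>' p" if m: "m < length ?N" "e m = e i" for m
    proof -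
      obtain u where u: "u \<in> carrier G" "\<tau>' u = \<tau>' p" "fst (e i) \<otimes> c m = snd (e i) \<otimes> u"
        using e(2)[OF m(1)] m(2) by auto
      have "?f \<otimes> c m = u" using u ec cH[of m] by (simp add: m_assoc cancel_left)
      then show ?thesis using T'.tau_right[of ?f "c m"] ec cH[of m] u by simp
    qed
    then have "\<tau>' ?f \<otimes> c i = \<tau>' ?f \<otimes> c j" using ij by simp
    then have "c i = c j" using ec cH by simp
    then have "wval G (t i) = wval G (t j)" using tH p by (simp add: c_def)
    then have "t i = t j"
      using tred Nielsen_Schreier unfolding free_basis_iff_wval[OF H] inj_on_def by blast
    then have "length (t i) = length (t j)" by simp
    then show "i = j" using ij by (simp add: t_def)
  qed
  moreover have "e ` {..<length ?N} \<subseteq> boundary \<times> ?B"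
    using e(1) by blast
  moreover have "finite (boundary \<times> ?B)"
    using fin card_boundary(1) finite_labels finite_ball_of[OF fin(1), of G k] by simp
  ultimately have "card {..<length ?N} \<le> card (boundary \<times> ?B)"
    by (rule card_inj_on_le)
  then show ?thesis
    using val letters unfolding ball_of_def
    by (intro CollectI exI[of _ ?N]) (auto simp: card_cartesian_product)
qed

subsection \<open>Ends\<close>

text \<open>The vertices \<open>u \<otimes> a\<^sup>n \<otimes> g\<close> converge to an end of the tree, which does not depend on \<open>u\<close>.\<close>

lemma end_in_tile:
  assumes fin: "finite labels" and a: "a \<in> carrier G" and g: "g \<in> carrier G"
    and notin: "\<And>k. k \<ge> (1::nat) \<Longrightarrow> inv g \<otimes> (a [^] k \<otimes> g) \<notin> H"
  shows "\<exists>c\<in>H. \<forall>u\<in>carrier G. \<forall>\<^sub>F n in sequentially. \<tau> (u \<otimes> (a [^] (n::nat) \<otimes> g)) = c"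
proof -
  have bfin: "finite boundary" using card_boundary(1) finite_labels fin by blast
  let ?s = "\<lambda>u n. u \<otimes> (a [^] (n::nat) \<otimes> g)"
  have sc: "?s u n \<in> carrier G" if "u \<in> carrier G" for u n using that a g by simp
  \<comment> \<open>Members of the sequence at which some edge crosses a border become boundary
    vertices of the base tile after normalization. These are distinct and the boundary is finite, so
    there are finitely many.\<close>
  have step: "\<forall>\<^sub>F n in sequentially. \<forall>l. fst l \<in> X \<longrightarrow> \<tau> (letter_value G l \<otimes> ?s u n) = \<tau> (?s u n)"
    if u: "u \<in> carrier G" for u
  proof -
    let ?bad = "{n. \<exists>l. fst l \<in> X \<and> \<tau> (letter_value G l \<otimes> ?s u n) \<noteq> \<tau> (?s u n)}"
    let ?e = "\<lambda>n. ?s u n \<otimes> inv (\<tau> (?s u n))"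
    have tH: "\<tau> (?s u n) \<in> H" for n using sc[OF u] tau_closed by blast
    have "?e n \<in> boundary" if n: "n \<in> ?bad" for n
    proof -
      obtain l where l: "fst l \<in> X" "\<tau> (letter_value G l \<otimes> ?s u n) \<noteq> \<tau> (?s u n)" using n by auto
      have "letter_value G l \<otimes> ?e n = letter_value G l \<otimes> ?s u n \<otimes> inv (\<tau> (?s u n))"
        using l sc[OF u] by (simp add: m_assoc)
      then have "\<tau> (letter_value G l \<otimes> ?e n) = \<tau> (letter_value G l \<otimes> ?s u n) \<otimes> inv (\<tau> (?s u n))"
        using l sc[OF u] tH by (simp add: tau_right)
      moreover have "\<dots> \<noteq> \<one>"
        using l sc[OF u] by (auto simp: inv_solve_right')
      ultimately show ?thesis
        using l sc[OF u] tau_normalize by (intro boundaryI[of _ l]) simp_all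
    qed
    moreover have "inj ?e"
    proof (rule injI)
      \<comment> \<open>Two members with the same normalization would put a conjugate of a positive
        power of \<open>a\<close> into \<open>H\<close>.\<close>
      have *: False if "i < j" "?e i = ?e j" for i j
      proof -
        let ?x = "inv (\<tau> (?s u i))" and ?y = "inv (\<tau> (?s u j))"
        have xy: "?x \<in> H" "?y \<in> H" using tH by auto
        have j: "a [^] j = a [^] i \<otimes> a [^] (j - i)" using a that by (simp add: nat_pow_mult)
        have "u \<otimes> a [^] i \<otimes> (g \<otimes> ?x) = u \<otimes> a [^] i \<otimes> (a [^] (j - i) \<otimes> g \<otimes> ?y)"
          using that(2) u a g xy unfolding j by (simp add: m_assoc)
        then have "g \<otimes> ?x = a [^] (j - i) \<otimes> g \<otimes> ?y"
          using u a g xy by simp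
        then have "inv g \<otimes> (g \<otimes> ?x \<otimes> inv ?y) = inv g \<otimes> (a [^] (j - i) \<otimes> g \<otimes> ?y \<otimes> inv ?y)"
          by simp
        then have "inv g \<otimes> (a [^] (j - i) \<otimes> g) = ?x \<otimes> inv ?y"
          using H_carrier[OF xy(1)] H_carrier[OF xy(2)] H_carrier[OF H_inv[OF xy(2)]] a g
          by (simp only: m_assoc cancel_left r_inv r_one m_closed inv_closed nat_pow_closed)
        moreover have "\<dots> \<in> H" using xy by simp
        moreover have "1 \<le> j - i" using that(1) by simp
        ultimately show False using notin[of "j - i"] by argo
      qed
      fix i j assume "?e i = ?e j"
      then show "i = j" using *[of i j] *[of j i] by (metis linorder_neqE_nat)
    qed
    ultimately have "finite ?bad"
      using bfin by (intro inj_on_finite[of ?e ?bad boundary]) (auto intro: inj_on_subset)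
    then show ?thesis
      by (simp add: cofinite_eq_sequentially[symmetric] eventually_cofinite)
  qed
  have walk: "\<forall>\<^sub>F n in sequentially. \<tau> (wval G w \<otimes> ?s \<one> n) = \<tau> (?s \<one> n)" if "fst ` set w \<subseteq> X" for w
    using that
  proof (induction w)
    case Nil
    then show ?case using a g by simp
  next
    case (Cons l w)
    then have wc: "wval G w \<in> carrier G" and l: "fst l \<in> X"
      using X by (auto intro!: wval_closed)
    from Cons have "\<forall>\<^sub>F n in sequentially. \<tau> (wval G w \<otimes> ?s \<one> n) = \<tau> (?s \<one> n)" by simp
    then show ?case using step[OF wc]
    proof eventually_elim
      case (elim n)
      have eq: "wval G (l # w) \<otimes> ?s \<one> n = letter_value G l \<otimes> ?s (wval G w) n"
        "wval G w \<otimes> ?s \<one> n = ?s (wval G w) n"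
        using wc l a g by (simp_all add: m_assoc)
      have "\<tau> (letter_value G l \<otimes> ?s (wval G w) n) = \<tau> (?s (wval G w) n)"
        using elim(2) l by blast
      then show ?case using elim(1) unfolding eq by (rule HOL.trans)
    qed
  qed
  \<comment> \<open>Eventually the tile does not depend on \<open>u\<close>. For
    \<open>u = a\<close> this compares consecutive members and makes the tile eventually
    constant.\<close>
  have any: "\<forall>\<^sub>F n in sequentially. \<tau> (?s u n) = \<tau> (?s \<one> n)" if u: "u \<in> carrier G" for u
    using walk[OF nform_letters[OF basis u]] nform(2)[OF basis u] a g by simp
  have "\<forall>\<^sub>F n in sequentially. \<tau> (?s \<one> (Suc n)) = \<tau> (?s \<one> n)"
    using any[OF a]
  proof eventually_elim
    case (elim n)
    have "?s \<one> (Suc n) = ?s a n"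
      using a g nat_pow_mult[OF a, of 1 n] by (simp flip: m_assoc)
    then show ?case using elim by simp
  qed
  then obtain N where N: "\<And>n. n \<ge> N \<Longrightarrow> \<tau> (?s \<one> (Suc n)) = \<tau> (?s \<one> n)"
    by (auto simp: eventually_sequentially)
  have "\<tau> (?s \<one> n) = \<tau> (?s \<one> N)" if "n \<ge> N" for n
    using that by (induction n rule: dec_induct) (use N in auto)
  then have const: "\<forall>\<^sub>F n in sequentially. \<tau> (?s \<one> n) = \<tau> (?s \<one> N)"
    unfolding eventually_sequentially by blast
  have "\<forall>\<^sub>F n in sequentially. \<tau> (?s u n) = \<tau> (?s \<one> N)" if "u \<in> carrier G" for u
    using any[OF that] const by eventually_elim (rule HOL.trans)
  moreover have "\<tau> (?s \<one> N) \<in> H" using sc tau_closed by blast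
  ultimately show ?thesis by blast
qed

text \<open>The vertex \<open>v \<otimes> \<tau>' w\<close> lies in the same second tile as
  \<open>w\<close>, and \<open>\<tau>\<close> takes the value \<open>\<tau>' w\<close> there; so its
  distance from \<open>w\<close> compares both tilings at \<open>w\<close>. In
  \<open>M + k + M\<close> the middle term comes from an edge of the second tree and the outer ones
  from the comparison at its two ends.\<close>

lemma tiling_compare:
  assumes T': "tiling G H X' \<tau>'" and X': "X' \<subseteq> ball_of G X k"
    and fin: "finite X" "finite labels"
    and v: "v \<in> carrier G" "\<tau> v = \<one>" "\<tau>' v = \<one>"
    and M: "card boundary * card (ball_of G X k) \<le> M"
  shows "w \<in> carrier G \<Longrightarrow> \<tau> w \<otimes> inv (\<tau>' w) \<in> ball_of G labels M"
    and "tile_labels G X' \<tau>' \<subseteq> ball_of G labels (M + k + M)"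
proof -
  interpret T': tiling G H X' \<tau>' by fact
  show *: "\<tau> w \<otimes> inv (\<tau>' w) \<in> ball_of G labels M" if w: "w \<in> carrier G" for w
  proof -
    have c: "\<tau>' w \<in> H" using w T'.tau_closed by simp
    have "\<tau> w \<otimes> inv (\<tau> (v \<otimes> \<tau>' w)) \<in> ball_of G labels (card boundary * card (ball_of G X k))"
      using v w c by (intro tile_distance[OF T' X' fin]) (simp_all add: T'.tau_right)
    moreover have "\<tau> (v \<otimes> \<tau>' w) = \<tau>' w" using v c by (simp add: tau_right)
    ultimately show ?thesis using subsetD[OF ball_of_mono[OF M order_refl]] by metis
  qed
  show "tile_labels G X' \<tau>' \<subseteq> ball_of G labels (M + k + M)"
  proof
    fix y assume "y \<in> tile_labels G X' \<tau>'"
    then obtain x u where xu: "x \<in> X'" "u \<in> carrier G" "y = \<tau>' (x \<otimes> u) \<otimes> inv (\<tau>' u)"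
      by (auto simp: tile_labels_def)
    let ?z = "x \<otimes> u"
    have z: "?z \<in> carrier G" using xu by simp
    let ?p = "\<tau> ?z \<otimes> inv (\<tau>' ?z)" and ?q = "\<tau> u \<otimes> inv (\<tau>' u)"
    have "inv ?p \<otimes> (\<tau> ?z \<otimes> inv (\<tau> u)) \<otimes> ?q \<in> ball_of G labels (M + k + M)"
      using xu z X' by (intro ball_of_mult[OF labels_carrier] ball_of_inv[OF labels_carrier] * tau_ball) auto
    moreover have "inv ?p \<otimes> (\<tau> ?z \<otimes> inv (\<tau> u)) \<otimes> ?q = y"
      using xu z by (simp add: m_assoc inv_mult_group cancel_left)
    ultimately show "y \<in> ball_of G labels (M + k + M)" by simp
  qed
qed

end

subsection \<open>The tiling given by a subset of a basis\<close>

lemma (in group) free_basis_one_notin: "free_basis G B \<Longrightarrow> \<one> \<notin> B"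
  using free_basis_reduced_nontrivial[of B "[(\<one>, True)]"]
  by (auto simp: reduced_words_Cons letter_value_def)

lemma (in group) sym_tile_step:
  assumes "X \<subseteq> carrier G"
  shows "sym (tile_step G X \<tau>)"
proof (rule symI)
  fix u v assume "(u, v) \<in> tile_step G X \<tau>"
  then obtain l where l: "u \<in> carrier G" "fst l \<in> X" "v = letter_value G l \<otimes> u" "\<tau> v = \<tau> u"
    by (auto simp: tile_step_def)
  moreover have "letter_value G l \<in> carrier G" using l assms by auto
  moreover have "fst l \<in> carrier G" using l assms by auto
  ultimately show "(v, u) \<in> tile_step G X \<tau>"
    by (intro tile_stepI[of _ _ "flip l"]) (simp_all add: cancel_left)
qed

text \<open>\<open>H\<close> acts on the right, so translation by \<open>H\<close> alters only the
  final block of letters from \<open>Y\<close>; what precedes this block represents the orbit in the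
  domain.\<close>

definition suffix_tiling :: "('a, 'b) monoid_scheme \<Rightarrow> 'a set \<Rightarrow> 'a set \<Rightarrow> 'a \<Rightarrow> 'a"
  where "suffix_tiling G P Y u = wval G (rev (takeWhile (\<lambda>l. fst l \<in> Y) (rev (nform G P u))))"

context group
begin

context
  fixes P Y H
  assumes P: "free_basis G P" and YP: "Y \<subseteq> P" and H: "subgroup H G"
    and Y: "free_basis (G\<lparr>carrier := H\<rparr>) Y"
begin

lemma suffix_tiling_eq:
  assumes "v @ t \<in> reduced_words P" "fst ` set t \<subseteq> Y" "v = [] \<or> fst (last v) \<notin> Y"
  shows "suffix_tiling G P Y (wval G (v @ t)) = wval G t"
proof -
  have *: "takeWhile (\<lambda>l. fst l \<in> Y) (rev t @ rev v) = rev t"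
  proof (cases v rule: rev_cases)
    case Nil
    then show ?thesis using assms(2) by (auto simp: takeWhile_eq_all_conv)
  next
    case (snoc v' l)
    then show ?thesis using assms(2,3) by (subst takeWhile_append2) auto
  qed
  show ?thesis
    using nform(3)[OF P assms(1)] * by (simp add: suffix_tiling_def)
qed

lemma suffix_split:
  assumes "u \<in> carrier G"
  obtains v t where "u = wval G (v @ t)" "v @ t \<in> reduced_words P" "fst ` set t \<subseteq> Y" "v = [] \<or> fst (last v) \<notin> Y"
proof -
  let ?n = "nform G P u" and ?Q = "\<lambda>l. fst l \<in> Y"
  define v t where "v = rev (dropWhile ?Q (rev ?n))" and "t = rev (takeWhile ?Q (rev ?n))"
  have vt: "v @ t = ?n"
    unfolding v_def t_def rev_append[symmetric] takeWhile_dropWhile_id by simp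
  have "fst ` set t \<subseteq> Y" unfolding t_def by (auto dest: set_takeWhileD)
  moreover have "v = [] \<or> fst (last v) \<notin> Y"
    unfolding v_def using hd_dropWhile[of ?Q "rev ?n"] by (auto simp: last_rev)
  ultimately show ?thesis
    using that vt nform(1,2)[OF P assms] by metis
qed

lemma suffix_word_in: "fst ` set t \<subseteq> Y \<Longrightarrow> wval G t \<in> H"
  using wval_subgroup(2)[OF H] Y by (auto simp: free_basis_iff)

lemma nform_in_subgroup: "a \<in> H \<Longrightarrow> nform G P a \<in> reduced_words Y"
  by (rule nform_subgroup(2)[OF H Y P YP])

lemma P_carrier: "P \<subseteq> carrier G"
  using free_basis_subset[OF P] .

lemma suffix_tiling_subgroup: "a \<in> H \<Longrightarrow> suffix_tiling G P Y a = a"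
  using suffix_tiling_eq[of "[]" "nform G P a"] nform(1,2)[OF P, of a]
    reduced_words_letters[OF nform_in_subgroup] subgroup.mem_carrier[OF H] by simp

lemma reduced_split_append:
  assumes "v \<in> reduced_words P" "v = [] \<or> fst (last v) \<notin> Y" "t \<in> reduced_words Y"
  shows "v @ t \<in> reduced_words P"
proof -
  have "hd t \<noteq> flip (last v)" if "v \<noteq> []" "t \<noteq> []"
    using that assms(2) reduced_words_letters[OF assms(3)] by (cases t) auto
  then show ?thesis
    using assms reduced_words_mono[OF _ YP] by (simp add: reduced_words_append)
qed

lemma tiling_suffix_tiling: "tiling G H P (suffix_tiling G P Y)"
proof
  let ?t = "suffix_tiling G P Y"
  have closed: "wval G w \<in> carrier G" if "w \<in> reduced_words P" for w
    using reduced_words_letters[OF that] P_carrier by (intro wval_closed) auto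
  \<comment> \<open>Removing the letters in front of the final block one by one is a path inside the
    tile.\<close>
  have conn: "(wval G t, wval G (v @ t)) \<in> (tile_step G P ?t)\<^sup>*"
    if "v @ t \<in> reduced_words P" "fst ` set t \<subseteq> Y" "v = [] \<or> fst (last v) \<notin> Y" for v t
    using that
  proof (induction v)
    case (Cons l v)
    have red: "v @ t \<in> reduced_words P" and l: "fst l \<in> P"
      using Cons.prems(1) by (auto simp: reduced_words_Cons)
    have v: "v = [] \<or> fst (last v) \<notin> Y" using Cons.prems(3) by (auto split: if_splits)
    have "?t (wval G ((l # v) @ t)) = ?t (wval G (v @ t))"
      unfolding suffix_tiling_eq[OF red Cons.prems(2) v] suffix_tiling_eq[OF Cons.prems] ..
    then have "(wval G (v @ t), wval G ((l # v) @ t)) \<in> tile_step G P ?t"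
      using l closed[OF red] by (intro tile_stepI[of _ _ l]) auto
    then show ?case using Cons.IH[OF red Cons.prems(2) v] by (rule rtrancl_into_rtrancl[rotated])
  qed simp
  fix u assume u: "u \<in> carrier G"
  obtain v t where vt: "u = wval G (v @ t)" "v @ t \<in> reduced_words P" "fst ` set t \<subseteq> Y"
    "v = [] \<or> fst (last v) \<notin> Y" using suffix_split[OF u] .
  have tu: "?t u = wval G t" using suffix_tiling_eq[OF vt(2-4)] vt(1) by simp
  show "?t u \<in> H" using tu suffix_word_in[OF vt(3)] by simp
  show "?t (u \<otimes> a) = ?t u \<otimes> a" if a: "a \<in> H" for a
  proof -
    let ?s = "nform G P (wval G t \<otimes> a)"
    have ta: "wval G t \<otimes> a \<in> H"
      using suffix_word_in[OF vt(3)] a subgroup.m_closed[OF H] by blast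
    have vred: "v \<in> reduced_words P" "t \<in> reduced_words P" using vt(2) by (auto simp: reduced_words_append)
    have s: "wval G ?s = wval G t \<otimes> a" "?s \<in> reduced_words Y"
      using nform(2)[OF P] nform_in_subgroup[OF ta] subgroup.mem_carrier[OF H ta] by auto
    \<comment> \<open>\<open>v\<close> does not end in a letter of \<open>Y\<close>, so nothing
      cancels when the final block is replaced.\<close>
    have vs: "v @ ?s \<in> reduced_words P"
      using reduced_split_append[OF vred(1) vt(4) s(2)] .
    have fs: "fst ` set v \<subseteq> carrier G" "fst ` set t \<subseteq> carrier G" "fst ` set ?s \<subseteq> carrier G"
      using reduced_words_letters[OF vred(1)] reduced_words_letters[OF vred(2)]
        reduced_words_letters[OF s(2)] P_carrier YP by auto
    have "u \<otimes> a = wval G (v @ ?s)"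
      using vt(1) s(1) a closed[OF vred(1)] closed[OF vred(2)] subgroup.mem_carrier[OF H a]
        wval_append[OF fs(1,2)] wval_append[OF fs(1,3)] by (simp add: m_assoc)
    then show ?thesis
      using suffix_tiling_eq[OF vs reduced_words_letters[OF s(2)] vt(4)] tu s(1) by simp
  qed
  fix u' assume u': "u' \<in> carrier G" "?t u = ?t u'"
  obtain v' t' where vt': "u' = wval G (v' @ t')" "v' @ t' \<in> reduced_words P" "fst ` set t' \<subseteq> Y"
    "v' = [] \<or> fst (last v') \<notin> Y" using suffix_split[OF u'(1)] .
  have "(wval G t', u') \<in> (tile_step G P ?t)\<^sup>*" "wval G t' = wval G t"
    using conn[OF vt'(2-4)] suffix_tiling_eq[OF vt'(2-4)] vt'(1) tu u'(2) by simp_all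
  moreover have "(u, wval G t) \<in> (tile_step G P ?t)\<^sup>*"
    using conn[OF vt(2-4)] vt(1) symD[OF sym_rtrancl[OF sym_tile_step[OF P_carrier]]] by simp
  ultimately show "(u, u') \<in> (tile_step G P ?t)\<^sup>*" by (simp add: rtrancl_trans)
qed (use subgroup.subset[OF H] subgroup.m_closed[OF H] subgroup.one_closed[OF H]
    subgroup.m_inv_closed[OF H] P_carrier in auto)

text \<open>An edge changes the final block only if the whole word and the new letter belong to
  \<open>Y\<close>. So if the basis already contains a basis of \<open>H\<close>, the
  Nielsen--Schreier construction returns the latter.\<close>

lemma labels_suffix_tiling: "tile_labels G P (suffix_tiling G P Y) = Y"
proof -
  let ?t = "suffix_tiling G P Y"
  have YH: "Y \<subseteq> H" using Y by (simp add: free_basis_iff)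
  have "?t (x \<otimes> u) \<otimes> inv (?t u) \<in> Y \<union> {\<one>}" if x: "x \<in> P" and u: "u \<in> carrier G" for x u
  proof -
    obtain v t where vt: "u = wval G (v @ t)" "v @ t \<in> reduced_words P" "fst ` set t \<subseteq> Y"
      "v = [] \<or> fst (last v) \<notin> Y" using suffix_split[OF u] .
    have tu: "?t u = wval G t" using suffix_tiling_eq[OF vt(2-4)] vt(1) by simp
    have tH: "wval G t \<in> H" using suffix_word_in[OF vt(3)] .
    then have tc: "wval G t \<in> carrier G" using subgroup.mem_carrier[OF H] by blast
    show ?thesis
    proof (cases "v = [] \<and> x \<in> Y")
      case True
      then have "x \<in> H" using YH by blast
      moreover have "x \<otimes> u \<in> H" using True vt(1) tH \<open>x \<in> H\<close> subgroup.m_closed[OF H] by simp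
      ultimately have "?t (x \<otimes> u) \<otimes> inv (?t u) = x"
        using True vt(1) tu tc suffix_tiling_subgroup[of "x \<otimes> u"] subgroup.mem_carrier[OF H]
        by (simp add: m_assoc)
      then show ?thesis using True by simp
    next
      case False
      let ?l = "(x, True)"
      have n: "nform G P u = v @ t" using nform(3)[OF P vt(2)] vt(1) by simp
      have xu: "x \<otimes> u \<in> carrier G" using x u P_carrier by auto
      have nx: "nform G P (x \<otimes> u) = cons_red ?l (v @ t)"
        using nform_letter_mult[OF P, of ?l u] x u n by (simp add: letter_value_def)
      have "\<exists>v'. cons_red ?l (v @ t) = v' @ t \<and> (v' = [] \<or> fst (last v') \<notin> Y)"
      proof (cases v)
        case Nil
        have "hd t \<noteq> flip ?l" if "t \<noteq> []"
          using that vt(3) False Nil by (cases t) auto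
        then show ?thesis using Nil False by (intro exI[of _ "[?l]"]) (auto simp: cons_red_def)
      next
        case (Cons m v'')
        show ?thesis
        proof (cases "m = flip ?l")
          case True
          then show ?thesis using Cons vt(4)
            by (intro exI[of _ v'']) (auto simp: cons_red_def split: if_splits)
        next
          case False
          then show ?thesis using Cons vt(4)
            by (intro exI[of _ "?l # v"]) (auto simp: cons_red_def split: if_splits)
        qed
      qed
      then obtain v' where v': "nform G P (x \<otimes> u) = v' @ t" "v' = [] \<or> fst (last v') \<notin> Y"
        using nx by auto
      then have "?t (x \<otimes> u) = wval G t"
        using suffix_tiling_eq[of v' t] nform(1,2)[OF P xu] vt(3) by simp
      then show ?thesis using tu tc by simp
    qed
  qed
  moreover have "\<exists>x u. y = ?t (x \<otimes> u) \<otimes> inv (?t u) \<and> x \<in> P \<and> u \<in> carrier G" if y: "y \<in> Y" for y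
  proof -
    have "?t y = y" "?t \<one> = \<one>"
      using y YH suffix_tiling_subgroup subgroup.one_closed[OF H] by auto
    then show ?thesis using y YP P_carrier by (intro exI[of _ y] exI[of _ \<one>]) auto
  qed
  moreover have "\<one> \<notin> Y" using free_basis_one_notin[OF P] YP by blast
  ultimately show ?thesis unfolding tile_labels_def by blast
qed

end

subsection \<open>Automorphisms preserving a corank one free factor\<close>

lemma conj_nat_pow:
  "x \<in> carrier G \<Longrightarrow> g \<in> carrier G \<Longrightarrow> (g \<otimes> x \<otimes> inv g) [^] (n::nat) = g \<otimes> x [^] n \<otimes> inv g"
  by (induction n) (simp_all add: m_assoc cancel_left)

text \<open>Cyclic reduction: a word whose ends cancel is conjugate to a shorter one by a letter,
  and conjugation commutes with powers. The outermost letters survive, which is what later rules out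
  cancellation with neighbours.\<close>

lemma reduced_power:
  assumes "w \<in> reduced_words P" "w \<noteq> []" "P \<subseteq> carrier G" "n \<ge> 1"
  shows "\<exists>v\<in>reduced_words P. wval G v = wval G w [^] (n::nat) \<and> v \<noteq> [] \<and> hd v = hd w \<and> last v = last w"
  using assms(1,2,4)
proof (induction "length w" arbitrary: w n rule: less_induct)
  case less
  have wc: "fst ` set w \<subseteq> carrier G" "wval G w \<in> carrier G"
    using reduced_words_letters[OF less.prems(1)] assms(3) by (auto intro!: wval_closed)
  show ?case
  proof (cases "hd w = flip (last w)")
    case False
    from less.prems(3) show ?thesis
    proof (induction n rule: dec_induct)
      case base
      then show ?case using less.prems wc by (intro bexI[of _ w]) auto
    next
      case (step n)
      then obtain v where v: "v \<in> reduced_words P" "wval G v = wval G w [^] n" "v \<noteq> []" "hd v = hd w" "last v = last w"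
        by auto
      have "v @ w \<in> reduced_words P"
        using v less.prems False by (simp add: reduced_words_append)
      moreover have "wval G (v @ w) = wval G w [^] Suc n"
        using v wc reduced_words_letters[OF v(1)] assms(3) by (subst wval_append) auto
      ultimately show ?case using v less.prems by (intro bexI[of _ "v @ w"]) auto
    qed
  next
    case True
    then obtain l w' where w': "w = l # w'" using less.prems by (cases w) auto
    have "w' \<noteq> []" using True w' by auto
    then obtain u m where um: "w' = u @ [m]" by (cases w' rule: rev_cases) auto
    have m: "m = flip l" using True w' um by simp
    have w: "w = l # u @ [flip l]" using w' um m by simp
    have u0: "u \<noteq> []" using less.prems(1) w by (auto simp: reduced_words_Cons)
    have red: "fst l \<in> P" "u \<in> reduced_words P" "hd u \<noteq> flip l" "last u \<noteq> l"
      using less.prems(1) u0 unfolding w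
      by (auto simp: reduced_words_Cons reduced_words_append hd_append)
    obtain v where v: "v \<in> reduced_words P" "wval G v = wval G u [^] n" "v \<noteq> []" "hd v = hd u" "last v = last u"
      using less.hyps[OF _ red(2) u0 less.prems(3)] w by auto
    have lc: "fst l \<in> carrier G" using red(1) assms(3) by auto
    then have lv: "letter_value G l \<in> carrier G" by simp
    have uc: "fst ` set u \<subseteq> carrier G" "wval G u \<in> carrier G"
      and vc: "fst ` set v \<subseteq> carrier G" "wval G v \<in> carrier G"
      using reduced_words_letters[OF red(2)] reduced_words_letters[OF v(1)] assms(3)
      by (auto intro!: wval_closed)
    have "wval G w = letter_value G l \<otimes> wval G u \<otimes> inv (letter_value G l)"
      unfolding w using uc lc lv by (simp add: wval_append m_assoc)
    then have "wval G w [^] n = letter_value G l \<otimes> wval G v \<otimes> inv (letter_value G l)"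
      using uc lv v(2) by (simp add: conj_nat_pow)
    also have "\<dots> = wval G (l # v @ [flip l])"
      using vc lc lv by (simp add: wval_append m_assoc)
    finally have "wval G (l # v @ [flip l]) = wval G w [^] n" ..
    moreover have "l # v @ [flip l] \<in> reduced_words P"
      using v red by (auto simp: reduced_words_Cons reduced_words_append hd_append)
    ultimately show ?thesis
      using w by (intro bexI[of _ "l # v @ [flip l]"]) auto
  qed
qed

lemma reduced_int_power:
  assumes w: "w \<in> reduced_words P" "w \<noteq> []" and P: "P \<subseteq> carrier G" and "k \<noteq> 0"
    and ends: "fst (hd w) = z" "fst (last w) = z"
  shows "\<exists>v\<in>reduced_words P. wval G v = wval G w [^] (k::int) \<and> v \<noteq> [] \<and> fst (hd v) = z \<and> fst (last v) = z"
proof (cases "k > 0")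
  case True
  then obtain n where "k = int n" "n \<ge> 1" by (metis One_nat_def Suc_leI nat_0_less_mult_iff pos_int_cases)
  then show ?thesis
    using reduced_power[OF w P, of n] ends by (auto simp: int_pow_int)
next
  case False
  then obtain n where n: "k = - int n" "n \<ge> 1"
    using \<open>k \<noteq> 0\<close> by (metis One_nat_def Suc_leI linorder_neqE_linordered_idom neg_int_cases)
  have wc: "fst ` set w \<subseteq> carrier G" "wval G w \<in> carrier G"
    using reduced_words_letters[OF w(1)] P by (auto intro!: wval_closed)
  obtain v where v: "v \<in> reduced_words P" "wval G v = wval G (word_inv w) [^] n" "v \<noteq> []"
    "hd v = hd (word_inv w)" "last v = last (word_inv w)"
    using reduced_power[OF word_inv_reduced[OF w(1)] _ P n(2)] w(2) by auto
  have "wval G (word_inv w) [^] n = wval G w [^] k"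
    using wc n(1) by (simp add: wval_inv int_pow_neg int_pow_int nat_pow_inv)
  then show ?thesis
    using v w(2) ends by (intro bexI[of _ v]) (auto simp: hd_word_inv last_word_inv)
qed

text \<open>\<open>S\<close> will say that the normal form of the tail does not start with the
  letter \<open>z\<close> or its inverse, so that the tail can follow a power of \<open>w\<close>
  without cancellation.\<close>

inductive_set alternating for H w S where
  base: "a \<in> H \<Longrightarrow> a \<in> alternating H w S"
| step: "a \<in> H \<Longrightarrow> k \<noteq> 0 \<Longrightarrow> y \<in> alternating H w S \<Longrightarrow> S y \<Longrightarrow>
    a \<otimes> (w [^] (k::int) \<otimes> y) \<in> alternating H w S"

text \<open>With \<open>w\<close> trimmed by elements of \<open>H\<close> to begin and end with \<open>z\<^sup>\<plusminus>\<^sup>1\<close>, products alternating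
  between \<open>H\<close> and powers of \<open>w\<close> are reduced as written, so \<open>z\<close> can only be such a product if it is a power
  of \<open>w\<close>.\<close>

lemma auto_preserving_corank1:
  assumes P: "free_basis G (insert z Y)" and z: "z \<notin> Y" and H: "subgroup H G"
    and Y: "free_basis (G\<lparr>carrier := H\<rparr>) Y" and f: "f \<in> auto G" and fH: "f ` H = H"
  shows "\<exists>g\<in>H. \<exists>g'\<in>H. f z = g \<otimes> (z \<otimes> g') \<or> f z = g \<otimes> (inv z \<otimes> g')"
proof -
  let ?P = "insert z Y" and ?Q = "\<lambda>l. fst l \<in> Y"
  note Pc = free_basis_subset[OF P] and Hc = subgroup.mem_carrier[OF H]
  interpret f: group_hom G G f by (rule autoD[OF f])
  have zc: "z \<in> carrier G" using Pc by simp
  have nH: "nform G ?P a \<in> reduced_words Y" if "a \<in> H" for a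
    using nform_in_subgroup[OF P _ H Y that] by blast
  have wH: "wval G t \<in> H" if "fst ` set t \<subseteq> Y" for t
    using suffix_word_in[OF P _ H Y that] by blast
  have zH: "z \<notin> H"
    using nH[of z] nform_letter[OF P, of z] z by (auto simp: reduced_words_Cons)
  have fz: "f z \<in> carrier G" using zc by simp
  have fzH: "f z \<notin> H"
  proof
    assume "f z \<in> H"
    then obtain a where "a \<in> H" "f z = f a" using fH by blast
    then show False
      using autoD(2)[OF f] zc zH Hc by (auto simp: bij_betw_def inj_on_def)
  qed
  let ?n = "nform G ?P (f z)"
  \<comment> \<open>\<open>\<omega>\<close> is what remains of the normal form of \<open>f z\<close>
    after removing letters of \<open>Y\<close> at both ends; it is nonempty because
    \<open>f z\<close> is not in \<open>H\<close>.\<close>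
  define \<alpha> r where "\<alpha> = takeWhile ?Q ?n" and "r = dropWhile ?Q ?n"
  define \<omega> \<beta> where "\<omega> = rev (dropWhile ?Q (rev r))" and "\<beta> = rev (takeWhile ?Q (rev r))"
  have r: "r = \<omega> @ \<beta>" unfolding \<omega>_def \<beta>_def rev_append[symmetric] takeWhile_dropWhile_id by simp
  have n: "?n = \<alpha> @ \<omega> @ \<beta>" unfolding r[symmetric] \<alpha>_def r_def by simp
  have ab: "fst ` set \<alpha> \<subseteq> Y" "fst ` set \<beta> \<subseteq> Y"
    unfolding \<alpha>_def \<beta>_def by (auto dest: set_takeWhileD)
  have red: "\<omega> \<in> reduced_words ?P"
    using nform(1)[OF P fz] unfolding n by (simp add: reduced_words_append)
  have \<omega>_letters: "fst ` set \<omega> \<subseteq> ?P" using reduced_words_letters[OF red] .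
  have \<omega>_ne: "\<omega> \<noteq> []"
  proof
    assume "\<omega> = []"
    then have "fst ` set ?n \<subseteq> Y" unfolding n using ab by auto
    then show False using wH[of ?n] nform(2)[OF P fz] fzH by simp
  qed
  have last: "fst (last \<omega>) = z"
  proof -
    have "\<not> ?Q (last \<omega>)"
      using \<omega>_ne hd_dropWhile[of ?Q "rev r"] unfolding \<omega>_def by (simp add: last_rev)
    moreover have "fst (last \<omega>) \<in> ?P" by (rule subsetD[OF \<omega>_letters imageI[OF last_in_set[OF \<omega>_ne]]])
    ultimately show ?thesis by simp
  qed
  have hd: "fst (hd \<omega>) = z"
  proof -
    have "r \<noteq> []" using \<omega>_ne r by simp
    then have "\<not> ?Q (hd r)" using hd_dropWhile[of ?Q ?n] unfolding r_def by simp
    moreover have "hd r = hd \<omega>" using \<omega>_ne r by simp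
    moreover have "fst (hd \<omega>) \<in> ?P" by (rule subsetD[OF \<omega>_letters imageI[OF hd_in_set[OF \<omega>_ne]]])
    ultimately show ?thesis by simp
  qed
  define w where "w = wval G \<omega>"
  have wc: "w \<in> carrier G" unfolding w_def using \<omega>_letters Pc by (intro wval_closed) (rule subset_trans)
  define a b where "a = wval G \<alpha>" and "b = wval G \<beta>"
  have abH: "a \<in> H" "b \<in> H" unfolding a_def b_def using wH ab by auto
  have fz_eq: "f z = a \<otimes> (w \<otimes> b)"
  proof -
    have "fst ` set \<alpha> \<subseteq> carrier G" "fst ` set \<beta> \<subseteq> carrier G" "fst ` set \<omega> \<subseteq> carrier G"
      using ab \<omega>_letters Pc by auto
    then show ?thesis
      using nform(2)[OF P fz] unfolding n w_def a_def b_def by (simp add: wval_append image_Un)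
  qed
  have pow: "nform G ?P (w [^] k) \<noteq> []" "fst (hd (nform G ?P (w [^] k))) = z"
    "fst (last (nform G ?P (w [^] k))) = z" if "k \<noteq> 0" for k :: int
    using reduced_int_power[OF red \<omega>_ne Pc that hd last] nform_unique[OF P] unfolding w_def by auto
  define starts where "starts x \<longleftrightarrow> nform G ?P x = [] \<or> fst (hd (nform G ?P x)) \<noteq> z" for x
  have startsH: "starts x" if "x \<in> H" for x
    using reduced_words_letters[OF nH[OF that]] z hd_in_set[of "nform G ?P x"] unfolding starts_def
    by (metis image_eqI subsetD)
  have concat: "nform G ?P (a \<otimes> (w [^] k \<otimes> x)) = nform G ?P a @ nform G ?P (w [^] k) @ nform G ?P x"
    if a: "a \<in> H" and x: "x \<in> carrier G" and sx: "starts x" and k: "k \<noteq> 0" for a x and k :: int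
  proof (rule nform_unique[OF P])
    let ?a = "nform G ?P a" and ?w = "nform G ?P (w [^] k)" and ?x = "nform G ?P x"
    have wk: "w [^] k \<in> carrier G" using wc by simp
    have "?a \<noteq> [] \<Longrightarrow> fst (last ?a) \<noteq> z"
      using reduced_words_letters[OF nH[OF a]] z last_in_set[of ?a] by (metis image_eqI subsetD)
    moreover have "?a \<in> reduced_words ?P" "?w \<in> reduced_words ?P" "?x \<in> reduced_words ?P"
      using nform(1)[OF P] a x wk Hc by auto
    ultimately show "?a @ ?w @ ?x \<in> reduced_words ?P"
      using pow[OF k] sx unfolding starts_def reduced_words_append
      by (auto simp: hd_append)
    have "fst ` set ?a \<subseteq> carrier G" "fst ` set ?w \<subseteq> carrier G" "fst ` set ?x \<subseteq> carrier G"
      using nform_letters[OF P] a x wk Hc Pc by (meson subset_trans)+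
    then show "wval G (?a @ ?w @ ?x) = a \<otimes> (w [^] k \<otimes> x)"
      using nform(2)[OF P] a x wk Hc by (simp add: wval_append image_Un)
  qed
  let ?N = "alternating H w starts"
  have Nc: "x \<in> carrier G" if "x \<in> ?N" for x
    using that by induction (use Hc wc in auto)
  have N_left: "c \<otimes> x \<in> ?N" if "x \<in> ?N" "c \<in> H" for c x
    using that(1)
  proof cases
    case base
    then show ?thesis using that(2) subgroup.m_closed[OF H] by (auto intro: alternating.base)
  next
    case (step a k y)
    then have "c \<otimes> x = c \<otimes> a \<otimes> (w [^] k \<otimes> y)"
      using that(2) Hc wc Nc by (simp add: m_assoc)
    then show ?thesis
      using step that(2) subgroup.m_closed[OF H] by (auto intro: alternating.step)
  qed
  \<comment> \<open>Two adjacent powers of \<open>w\<close> merge, and their exponents may cancel;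
    otherwise a nontrivial element of \<open>H\<close> separates them.\<close>
  have N_pow: "w [^] j \<otimes> x \<in> ?N" if x: "x \<in> ?N" and j: "j \<noteq> 0" for x and j :: int
    using x
  proof cases
    case base
    then have "\<one> \<otimes> (w [^] j \<otimes> x) \<in> ?N"
      using subgroup.one_closed[OF H] j x startsH by (intro alternating.step)
    then show ?thesis using wc Nc[OF x] by simp
  next
    case (step a k y)
    show ?thesis
    proof (cases "a = \<one>")
      case True
      then have eq: "w [^] j \<otimes> x = \<one> \<otimes> (w [^] (j + k) \<otimes> y)"
        using step wc Nc[OF step(4)] by (simp add: int_pow_mult m_assoc)
      show ?thesis
      proof (cases "j + k = 0")
        case True
        then show ?thesis using eq step(4) Nc[OF step(4)] by simp
      next
        case False
        then show ?thesis
          unfolding eq using step subgroup.one_closed[OF H] by (intro alternating.step)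
      qed
    next
      case False
      have "nform G ?P a \<noteq> []"
        using False nform(2)[OF P Hc[OF step(2)]] by auto
      then have "starts x"
        using concat[OF step(2) Nc[OF step(4)] step(5) step(3)] startsH[OF step(2)] step(1)
        unfolding starts_def by auto
      then have "\<one> \<otimes> (w [^] j \<otimes> x) \<in> ?N"
        using subgroup.one_closed[OF H] j x by (intro alternating.step)
      then show ?thesis using wc Nc[OF x] by simp
    qed
  qed
  \<comment> \<open>All values of \<open>f\<close> are alternating products; \<open>f\<close> is
    onto, so \<open>z\<close> is one too.\<close>
  have "f x \<in> ?N" if "x \<in> carrier G" for x
    using P that
  proof (induction rule: free_basis_induct)
    case one
    then show ?case using subgroup.one_closed[OF H] by (simp add: alternating.base)
  next
    case (letter l x)
    have lc: "fst l \<in> carrier G" using letter(1) Pc by blast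
    show ?case
    proof (cases "fst l = z")
      case False
      then have "f (fst l) \<in> H"
        using letter(1) fH Y by (auto simp: free_basis_iff)
      then have "f (letter_value G l) \<in> H"
        using subgroup.m_inv_closed[OF H] lc by (auto simp: letter_value_def)
      then show ?thesis using letter lc N_left by simp
    next
      case True
      have fx: "f x \<in> carrier G" using letter by simp
      have 1: "w [^] (1::int) = w" "w [^] (- 1 :: int) = inv w"
        using wc by (simp_all add: int_pow_neg)
      show ?thesis
      proof (cases "snd l")
        case True
        then have "f (letter_value G l \<otimes> x) = a \<otimes> (w [^] (1::int) \<otimes> (b \<otimes> f x))"
          using \<open>fst l = z\<close> letter zc fz_eq abH Hc wc fx 1 by (simp add: letter_value_def m_assoc)
        then show ?thesis using N_left N_pow letter.IH abH by simp
      next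
        case False
        then have "f (letter_value G l \<otimes> x) = inv b \<otimes> (w [^] (- 1::int) \<otimes> (inv a \<otimes> f x))"
          using \<open>fst l = z\<close> letter zc fz_eq abH Hc wc fx 1
          by (simp add: letter_value_def m_assoc inv_mult_group)
        then show ?thesis using N_left N_pow letter.IH abH subgroup.m_inv_closed[OF H] by simp
      qed
    qed
  qed
  moreover obtain z' where "z' \<in> carrier G" "f z' = z"
    using autoD(2)[OF f] zc by (metis bij_betw_def imageE)
  ultimately have "z \<in> ?N" by blast
  then obtain k :: int where k: "z = w [^] k"
  proof cases
    case base
    then show ?thesis using zH by simp
  next
    case (step a k y)
    \<comment> \<open>The normal form of \<open>z\<close> is a single letter, and the power of
      \<open>w\<close> already contributes a nonempty word.\<close>
    have "nform G ?P a @ nform G ?P (w [^] k) @ nform G ?P y = [(z, True)]"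
      using concat[OF step(2) Nc[OF step(4)] step(5) step(3)] step(1) nform_letter[OF P, of z] by simp
    then have "nform G ?P a = []" "nform G ?P y = []"
      using pow(1)[OF step(3)] by (auto simp: append_eq_Cons_conv)
    then have "a = \<one>" "y = \<one>"
      using nform(2)[OF P Hc[OF step(2)]] nform(2)[OF P Nc[OF step(4)]] by auto
    then show ?thesis using step(1) wc that[of k] by simp
  qed
  \<comment> \<open>The exponent sum of \<open>z\<close> turns \<open>z = w [^] k\<close> into
    \<open>1 = k * h w\<close>, which forces \<open>k\<close> to be 1 or -1.\<close>
  obtain h where h: "h \<in> hom G integer_group" "\<forall>x\<in>?P. h x = (if x = z then 1 else 0)"
    using free_basis_extend[OF P group_integer_group, of "\<lambda>x. if x = z then 1 else 0"]
    by (auto simp: integer_group_def)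
  interpret h: group_hom G integer_group h
    by (intro group_hom.intro group_hom_axioms.intro is_group group_integer_group h(1))
  have "1 = h w [^]\<^bsub>integer_group\<^esub> k"
    using h.hom_int_pow[OF wc, of k] h(2) k by simp
  then have "1 = k * h w" by simp
  then have "k = 1 \<or> k = -1" using zmult_eq_1_iff by metis
  then have "w = z \<or> w = inv z"
    using k wc by (auto simp: int_pow_neg)
  then show ?thesis using fz_eq abH by blast
qed

end

section \<open>A criterion for coarse Lipschitz retracts of the outer automorphism group\<close>

lemma coarse_lipschitz_retract_self:
  assumes "Metric_space M d"
  shows "coarse_lipschitz_retract M d M"
proof -
  have "d x y \<le> 1 * d x y + 1" for x y by simp
  then show ?thesis
    unfolding coarse_lipschitz_retract_def coarse_lipschitz_retraction_def
    by (intro exI[of _ "\<lambda>x. x"]) auto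
qed

context group
begin

section \<open>Outer automorphisms as classes of automorphisms\<close>

definition outer_class :: "('a \<Rightarrow> 'a) \<Rightarrow> ('a \<Rightarrow> 'a) set"
  where "outer_class f = Inn G #>\<^bsub>AutoGroup G\<^esub> f"

lemma outer_class_hom: "group_hom (AutoGroup G) (Out G) outer_class"
proof (intro group_hom.intro group_hom_axioms.intro AutoGroup group_Out)
  show "outer_class \<in> hom (AutoGroup G) (Out G)"
    unfolding Out_def outer_class_def by (rule normal.r_coset_hom_Mod[OF Inn_normal])
qed

lemma outer_class_iff:
  assumes "f \<in> auto G"
  shows "h \<in> outer_class f \<longleftrightarrow> (\<exists>g\<in>carrier G. h = compose (carrier G) (inner_auto G g) f)"
  using assms by (auto simp: outer_class_def r_coset_def Inn_def AutoGroup_simps inner_auto_in_auto)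

lemma outer_class_self: "f \<in> auto G \<Longrightarrow> f \<in> outer_class f"
  unfolding outer_class_def
  by (rule group.rcos_self[OF AutoGroup _ normal_imp_subgroup[OF Inn_normal]]) (simp add: AutoGroup_simps)

lemma Out_carrier: "\<phi> \<in> carrier (Out G) \<longleftrightarrow> (\<exists>f\<in>auto G. \<phi> = outer_class f)"
  by (auto simp: Out_def FactGroup_def RCOSETS_def outer_class_def AutoGroup_simps)

lemma outer_class_mem:
  assumes "\<phi> \<in> carrier (Out G)" "f \<in> \<phi>"
  shows "f \<in> auto G" "\<phi> = outer_class f"
proof -
  interpret A: group "AutoGroup G" by (rule AutoGroup)
  obtain h where h: "h \<in> auto G" "\<phi> = outer_class h" using assms by (auto simp: Out_carrier)
  then obtain g where g: "g \<in> carrier G" "f = inner_auto G g \<otimes>\<^bsub>AutoGroup G\<^esub> h"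
    using assms(2) outer_class_iff[OF h(1)] by (auto simp: AutoGroup_simps inner_auto_in_auto)
  then show "f \<in> auto G"
    using h A.m_closed[of "inner_auto G g" h] by (simp add: AutoGroup_simps(1) inner_auto_in_auto)
  show "\<phi> = outer_class f"
    using A.repr_independence[OF _ _ normal_imp_subgroup[OF Inn_normal], of f h] assms(2) h
    unfolding outer_class_def by (simp add: AutoGroup_simps(1))
qed

lemma auto_inverse:
  assumes f: "f \<in> auto G"
  shows "inv\<^bsub>AutoGroup G\<^esub> f \<in> auto G"
    and "x \<in> carrier G \<Longrightarrow> (inv\<^bsub>AutoGroup G\<^esub> f) (f x) = x"
    and "x \<in> carrier G \<Longrightarrow> f ((inv\<^bsub>AutoGroup G\<^esub> f) x) = x"
proof -
  interpret A: group "AutoGroup G" by (rule AutoGroup)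
  let ?g = "inv\<^bsub>AutoGroup G\<^esub> f"
  show g: "?g \<in> auto G" using A.inv_closed[of f] f by (simp add: AutoGroup_simps(1))
  have "compose (carrier G) ?g f = (\<lambda>x\<in>carrier G. x)" "compose (carrier G) f ?g = (\<lambda>x\<in>carrier G. x)"
    using A.l_inv[of f] A.r_inv[of f] f g by (simp_all add: AutoGroup_simps)
  then show "x \<in> carrier G \<Longrightarrow> ?g (f x) = x" "x \<in> carrier G \<Longrightarrow> f (?g x) = x"
    by (metis compose_eq restrict_apply')+
qed

lemma compose_auto: "f \<in> auto G \<Longrightarrow> h \<in> auto G \<Longrightarrow> compose (carrier G) f h \<in> auto G"
proof -
  interpret A: group "AutoGroup G" by (rule AutoGroup)
  show "f \<in> auto G \<Longrightarrow> h \<in> auto G \<Longrightarrow> compose (carrier G) f h \<in> auto G"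
    using A.m_closed[of f h] by (simp add: AutoGroup_simps)
qed

lemma auto_closed: "f \<in> auto G \<Longrightarrow> x \<in> carrier G \<Longrightarrow> f x \<in> carrier G"
  using autoD(2) by (auto simp: bij_betw_def)

lemma auto_ball_of:
  "f \<in> auto G \<Longrightarrow> B \<subseteq> carrier G \<Longrightarrow> x \<in> ball_of G B k \<Longrightarrow> f x \<in> ball_of G (f ` B) k"
  using hom_ball_of[OF is_group autoD(1)] by blast

lemma auto_inverse_image:
  "f \<in> auto G \<Longrightarrow> B \<subseteq> carrier G \<Longrightarrow> (inv\<^bsub>AutoGroup G\<^esub> f) ` f ` B = B"
  using auto_inverse(2) by (force simp: image_image subset_iff)

section \<open>From bounded bases to bounded distance in the word metric\<close>

lemma in_some_ball:
  assumes "free_basis G P" "x \<in> carrier G"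
  shows "x \<in> ball_of G P (length (nform G P x))"
  using nform(2)[OF assms] nform_letters[OF assms] unfolding ball_of_def
  by (intro CollectI exI[of _ "nform G P x"]) simp

lemma finite_bounded_autos:
  assumes P: "free_basis G P" "finite P"
  shows "finite {\<theta> \<in> auto G. \<theta> ` P \<subseteq> ball_of G P k}"
proof (rule inj_on_finite[of "\<lambda>\<theta>. restrict \<theta> P" _ "P \<rightarrow>\<^sub>E ball_of G P k"])
  show "inj_on (\<lambda>\<theta>. restrict \<theta> P) {\<theta> \<in> auto G. \<theta> ` P \<subseteq> ball_of G P k}"
  proof (rule inj_onI)
    fix \<theta> \<theta>' assume *: "\<theta> \<in> {\<theta> \<in> auto G. \<theta> ` P \<subseteq> ball_of G P k}" "\<theta>' \<in> {\<theta> \<in> auto G. \<theta> ` P \<subseteq> ball_of G P k}"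
      "restrict \<theta> P = restrict \<theta>' P"
    have eq: "\<theta> p = \<theta>' p" if "p \<in> P" for p using *(3) that by (metis restrict_apply')
    show "\<theta> = \<theta>'"
    proof (rule extensionalityI[of \<theta> "carrier G"])
      show "\<theta> x = \<theta>' x" if "x \<in> carrier G" for x
        using * that by (intro free_basis_hom_ext[OF P(1) is_group _ _ eq that] autoD(1)) auto
    qed (use * autoD(3) in auto)
  qed
  show "finite (P \<rightarrow>\<^sub>E ball_of G P k)"
    using P(2) by (intro finite_PiE finite_ball_of) auto
qed auto

text \<open>The quotient of \<open>\<psi>\<close> and \<open>\<psi>'\<close> is one of the finitely
  many automorphisms moving \<open>P\<close> into its ball of radius \<open>k\<close>, and
  \<open>D\<close> is the largest word length among their classes. The inserted 0 makes
  \<open>D\<close> nonnegative at once.\<close>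

lemma outer_class_dist_bound:
  assumes P: "free_basis G P" "finite P"
  obtains D where "D \<ge> 0" "\<And>\<psi> \<psi>'. \<psi> \<in> auto G \<Longrightarrow> \<psi>' \<in> auto G \<Longrightarrow> \<psi>' ` P \<subseteq> ball_of G (\<psi> ` P) k \<Longrightarrow>
    word_dist (Out G) S (outer_class \<psi>) (outer_class \<psi>') \<le> D"
proof -
  interpret cls: group_hom "AutoGroup G" "Out G" outer_class by (rule outer_class_hom)
  note Pc = free_basis_subset[OF P(1)]
  let ?T = "{\<theta> \<in> auto G. \<theta> ` P \<subseteq> ball_of G P k}"
  define D where "D = Max (insert 0 ((\<lambda>\<theta>. real (word_length (Out G) S (outer_class \<theta>))) ` ?T))"
  have fin: "finite (insert 0 ((\<lambda>\<theta>. real (word_length (Out G) S (outer_class \<theta>))) ` ?T))"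
    using finite_bounded_autos[OF P] by simp
  have "D \<ge> 0" unfolding D_def using fin by (intro Max_ge) auto
  moreover have "word_dist (Out G) S (outer_class \<psi>) (outer_class \<psi>') \<le> D"
    if \<psi>: "\<psi> \<in> auto G" "\<psi>' \<in> auto G" and sub: "\<psi>' ` P \<subseteq> ball_of G (\<psi> ` P) k" for \<psi> \<psi>'
  proof -
    let ?i = "inv\<^bsub>AutoGroup G\<^esub> \<psi>"
    let ?\<theta> = "?i \<otimes>\<^bsub>AutoGroup G\<^esub> \<psi>'"
    have i: "?i \<in> auto G" using auto_inverse[OF \<psi>(1)] by simp
    have \<theta>: "?\<theta> = compose (carrier G) ?i \<psi>'" using i \<psi> by (simp add: AutoGroup_simps)
    have "?\<theta> p \<in> ball_of G P k" if p: "p \<in> P" for p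
    proof -
      have "\<psi> ` P \<subseteq> carrier G" using Pc auto_closed[OF \<psi>(1)] by blast
      then have "?i (\<psi>' p) \<in> ball_of G (?i ` \<psi> ` P) k"
        using sub p by (intro auto_ball_of[OF i]) auto
      then show ?thesis
        using p Pc auto_inverse_image[OF \<psi>(1) Pc] unfolding \<theta> by (auto simp: compose_eq)
    qed
    then have "?\<theta> \<in> ?T" using compose_auto[OF i \<psi>(2)] \<theta> by auto
    then have "real (word_length (Out G) S (outer_class ?\<theta>)) \<le> D"
      unfolding D_def using fin by (intro Max_ge) auto
    moreover have "outer_class ?\<theta> = inv\<^bsub>Out G\<^esub> (outer_class \<psi>) \<otimes>\<^bsub>Out G\<^esub> outer_class \<psi>'"
      using \<psi> i cls.hom_mult[of ?i \<psi>'] cls.hom_inv[of \<psi>] by (simp add: AutoGroup_simps(1))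
    ultimately show ?thesis using \<psi> \<open>D \<ge> 0\<close> by (simp add: word_dist_def)
  qed
  ultimately show ?thesis by (rule that)
qed

lemma generating_word:
  assumes S: "finite_generating_set G S" and x: "x \<in> carrier G"
  shows "\<exists>w\<in>lists (S \<union> m_inv G ` S). length w = word_length G S x \<and> word_prod G w = x"
proof -
  have sub: "S \<subseteq> carrier G" "generate G S = carrier G" using S by (auto simp: finite_generating_set_def)
  have "\<exists>w\<in>lists (S \<union> m_inv G ` S). word_prod G w = y" if "y \<in> generate G S" for y
    using that
  proof induction
    case one
    then show ?case by (intro bexI[of _ "[]"]) auto
  next
    case (incl h)
    then show ?case using sub by (intro bexI[of _ "[h]"]) auto
  next
    case (inv h)
    then show ?case using sub by (intro bexI[of _ "[inv h]"]) auto
  next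
    case (eng h1 h2)
    then obtain u v where uv: "u \<in> lists (S \<union> m_inv G ` S)" "word_prod G u = h1"
      "v \<in> lists (S \<union> m_inv G ` S)" "word_prod G v = h2" by blast
    have "set u \<subseteq> carrier G" "set v \<subseteq> carrier G" using uv sub by (auto simp: lists_eq_set)
    then show ?case using uv word_prod_append[of u v] by (intro bexI[of _ "u @ v"]) auto
  qed
  then have "\<exists>k. \<exists>w\<in>lists (S \<union> m_inv G ` S). length w = k \<and> word_prod G w = x"
    using x sub by blast
  then show ?thesis unfolding word_length_def by (rule LeastI_ex)
qed

lemma lipschitz_on_generators:
  assumes S: "finite_generating_set G S" and p: "p \<in> carrier G \<rightarrow> carrier G" and D: "D \<ge> 0"
    and step: "\<And>x s. x \<in> carrier G \<Longrightarrow> s \<in> S \<union> m_inv G ` S \<Longrightarrow> word_dist G S (p x) (p (x \<otimes> s)) \<le> D"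
    and x: "x \<in> carrier G" "y \<in> carrier G"
  shows "word_dist G S (p x) (p y) \<le> D * word_dist G S x y"
proof -
  have sub: "S \<subseteq> carrier G" "generate G S = carrier G" using S by (auto simp: finite_generating_set_def)
  interpret M: Metric_space "carrier G" "word_dist G S" by (rule Metric_space_word_dist[OF sub])
  have "word_dist G S (p x) (p (x \<otimes> word_prod G w)) \<le> D * length w"
    if "w \<in> lists (S \<union> m_inv G ` S)" "x \<in> carrier G" for w x
    using that
  proof (induction w arbitrary: x)
    case Nil
    then have "p x \<in> carrier G" using p by auto
    then show ?case using Nil M.mdist_zero[of "p x"] by simp
  next
    case (Cons s w)
    have s: "s \<in> carrier G" and w: "word_prod G w \<in> carrier G"
      using Cons.hyps sub by (auto simp: lists_eq_set)
    have c: "x \<otimes> s \<in> carrier G" "x \<otimes> s \<otimes> word_prod G w \<in> carrier G" using s w Cons.prems by auto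
    have "word_dist G S (p x) (p (x \<otimes> s \<otimes> word_prod G w))
        \<le> word_dist G S (p x) (p (x \<otimes> s)) + word_dist G S (p (x \<otimes> s)) (p (x \<otimes> s \<otimes> word_prod G w))"
      using c Cons.prems p by (intro M.triangle) auto
    also have "\<dots> \<le> D + D * length w"
      using step[OF Cons.prems Cons.hyps(1)] Cons.IH[OF c(1)] by simp
    finally show ?case using s w Cons.prems by (simp add: m_assoc algebra_simps)
  qed
  note * = this
  obtain w where w: "w \<in> lists (S \<union> m_inv G ` S)" "length w = word_length G S (inv x \<otimes> y)"
    "word_prod G w = inv x \<otimes> y"
    using generating_word[OF S, of "inv x \<otimes> y"] x by auto
  show ?thesis
    using *[OF w(1) x(1)] w x by (simp add: word_dist_def cancel_left)
qed

text \<open>\<open>R f \<psi>\<close> says that \<open>\<psi>\<close> is an admissible choice for the retraction at the class of \<open>f\<close>.\<close>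

lemma coarse_retract_criterion:
  fixes R :: "('a \<Rightarrow> 'a) \<Rightarrow> ('a \<Rightarrow> 'a) \<Rightarrow> bool"
  assumes P: "free_basis G P" "finite P" and S: "finite_generating_set (Out G) S"
    and Y: "Y \<subseteq> carrier (Out G)"
    and ex: "\<And>f. f \<in> auto G \<Longrightarrow> \<exists>\<psi>. R f \<psi>"
    and target: "\<And>f \<psi>. f \<in> auto G \<Longrightarrow> R f \<psi> \<Longrightarrow> \<psi> \<in> auto G \<and> outer_class \<psi> \<in> Y"
    and inner: "\<And>f \<psi> g. f \<in> auto G \<Longrightarrow> R f \<psi> \<Longrightarrow> g \<in> carrier G \<Longrightarrow>
      R (compose (carrier G) (inner_auto G g) f) \<psi>"
    and close: "\<And>k. \<exists>M. \<forall>f\<in>auto G. \<forall>\<sigma>\<in>auto G. \<forall>\<psi> \<psi>'. \<sigma> ` P \<subseteq> ball_of G P k \<longrightarrow> R f \<psi> \<longrightarrow>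
      R (compose (carrier G) f \<sigma>) \<psi>' \<longrightarrow> \<psi>' ` P \<subseteq> ball_of G (\<psi> ` P) M"
    and fixed: "\<exists>M. \<forall>\<phi>\<in>Y. \<exists>f\<in>\<phi>. \<exists>\<psi>. R f \<psi> \<and> f ` P \<subseteq> ball_of G (\<psi> ` P) M"
  shows "coarse_lipschitz_retract (carrier (Out G)) (word_dist (Out G) S) Y"
proof -
  interpret cls: group_hom "AutoGroup G" "Out G" outer_class by (rule outer_class_hom)
  interpret O: group "Out G" by (rule group_Out)
  have S': "S \<subseteq> carrier (Out G)" "generate (Out G) S = carrier (Out G)" "finite S"
    using S by (auto simp: finite_generating_set_def)
  interpret M: Metric_space "carrier (Out G)" "word_dist (Out G) S"
    by (rule group.Metric_space_word_dist[OF group_Out S'(1,2)])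
  note Pc = free_basis_subset[OF P(1)]
  let ?d = "word_dist (Out G) S"
  define rep where "rep \<phi> = (SOME f. f \<in> \<phi>)" for \<phi> :: "('a \<Rightarrow> 'a) set"
  have rep: "rep \<phi> \<in> auto G" "\<phi> = outer_class (rep \<phi>)" "rep \<phi> \<in> \<phi>" if "\<phi> \<in> carrier (Out G)" for \<phi>
  proof -
    have "\<exists>f. f \<in> \<phi>" using that Out_carrier outer_class_self by blast
    then show "rep \<phi> \<in> \<phi>" unfolding rep_def by (rule someI_ex)
    then show "rep \<phi> \<in> auto G" "\<phi> = outer_class (rep \<phi>)" using outer_class_mem that by auto
  qed
  define \<Psi> where "\<Psi> \<phi> = (SOME \<psi>. R (rep \<phi>) \<psi>)" for \<phi>
  have \<Psi>: "R (rep \<phi>) (\<Psi> \<phi>)" if "\<phi> \<in> carrier (Out G)" for \<phi>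
    unfolding \<Psi>_def using ex[OF rep(1)[OF that]] by (rule someI_ex)
  have \<Psi>a: "\<Psi> \<phi> \<in> auto G" "outer_class (\<Psi> \<phi>) \<in> Y" if "\<phi> \<in> carrier (Out G)" for \<phi>
    using target[OF rep(1)[OF that] \<Psi>[OF that]] by auto
  \<comment> \<open>The selected representative of a product need not be the composition of the
    selected representatives, so \<open>R\<close> is required for all representatives.\<close>
  have any_rep: "R f (\<Psi> \<phi>)" if \<phi>: "\<phi> \<in> carrier (Out G)" and f: "f \<in> \<phi>" for \<phi> f
  proof -
    have "f \<in> outer_class (rep \<phi>)" using rep(2)[OF \<phi>] f by simp
    then obtain g where "g \<in> carrier G" "f = compose (carrier G) (inner_auto G g) (rep \<phi>)"
      using outer_class_iff[OF rep(1)[OF \<phi>]] by auto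
    then show ?thesis using inner[OF rep(1)[OF \<phi>] \<Psi>[OF \<phi>]] by simp
  qed
  let ?p = "\<lambda>\<phi>. outer_class (\<Psi> \<phi>)"
  have pc: "?p \<phi> \<in> carrier (Out G)" if "\<phi> \<in> carrier (Out G)" for \<phi> using \<Psi>a[OF that] Y by auto
  let ?L = "S \<union> m_inv (Out G) ` S"
  have Lc: "?L \<subseteq> carrier (Out G)" using S' by auto
  \<comment> \<open>One radius for the representatives of the finitely many generators and their
    inverses.\<close>
  obtain k where k: "\<And>s. s \<in> ?L \<Longrightarrow> rep s ` P \<subseteq> ball_of G P k"
  proof -
    let ?K = "(\<lambda>(s, p). length (nform G P (rep s p))) ` (?L \<times> P)"
    have fin: "finite ?K" using S' P by simp
    have "rep s p \<in> ball_of G P (Max ?K)" if "s \<in> ?L" "p \<in> P" for s p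
    proof -
      have "rep s p \<in> carrier G" using that Lc Pc rep(1)[of s] auto_closed[of "rep s" p] by blast
      moreover have "length (nform G P (rep s p)) \<le> Max ?K"
        using fin that by (intro Max_ge image_eqI[of _ _ "(s, p)"]) simp_all
      ultimately show ?thesis
        by (intro subsetD[OF ball_of_mono[OF _ order_refl] in_some_ball[OF P(1)]])
    qed
    then show ?thesis using that[of "Max ?K"] by blast
  qed
  obtain M1 where "\<forall>f\<in>auto G. \<forall>\<sigma>\<in>auto G. \<forall>\<psi> \<psi>'. \<sigma> ` P \<subseteq> ball_of G P k \<longrightarrow> R f \<psi> \<longrightarrow>
    R (compose (carrier G) f \<sigma>) \<psi>' \<longrightarrow> \<psi>' ` P \<subseteq> ball_of G (\<psi> ` P) M1"
    using close[of k] ..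
  note M1 = this[rule_format]
  obtain D1 where D1: "D1 \<ge> 0" "\<And>\<psi> \<psi>'. \<psi> \<in> auto G \<Longrightarrow> \<psi>' \<in> auto G \<Longrightarrow> \<psi>' ` P \<subseteq> ball_of G (\<psi> ` P) M1 \<Longrightarrow>
      ?d (outer_class \<psi>) (outer_class \<psi>') \<le> D1"
    by (rule outer_class_dist_bound[OF P, of M1 S]) (rule that)
  have step: "?d (?p \<phi>) (?p (\<phi> \<otimes>\<^bsub>Out G\<^esub> s)) \<le> D1" if \<phi>: "\<phi> \<in> carrier (Out G)" and s: "s \<in> ?L" for \<phi> s
  proof -
    have sc: "s \<in> carrier (Out G)" using s Lc by blast
    let ?f = "rep \<phi>" and ?\<sigma> = "rep s"
    let ?h = "compose (carrier G) ?f ?\<sigma>"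
    have "outer_class ?h = \<phi> \<otimes>\<^bsub>Out G\<^esub> s"
      using cls.hom_mult[of ?f ?\<sigma>] rep[OF \<phi>] rep[OF sc] by (simp add: AutoGroup_simps)
    then have "?h \<in> \<phi> \<otimes>\<^bsub>Out G\<^esub> s"
      using outer_class_self[OF compose_auto[OF rep(1)[OF \<phi>] rep(1)[OF sc]]] by simp
    then have "R ?h (\<Psi> (\<phi> \<otimes>\<^bsub>Out G\<^esub> s))" using \<phi> sc by (intro any_rep) auto
    then show ?thesis
      using \<phi> sc by (intro D1(2) M1[OF rep(1)[OF \<phi>] rep(1)[OF sc] k[OF s] \<Psi>[OF \<phi>]] \<Psi>a) auto
  qed
  have lip: "?d (?p x) (?p y) \<le> D1 * ?d x y" if "x \<in> carrier (Out G)" "y \<in> carrier (Out G)" for x y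
    using that pc by (intro group.lipschitz_on_generators[OF group_Out S _ D1(1) step]) auto
  \<comment> \<open>On \<open>Y\<close> the selected value may differ from the one provided by
    \<open>fixed\<close>. Taking the identity for \<open>\<sigma>\<close> in \<open>close\<close>
    shows that two admissible choices for the same automorphism are boundedly close; the identity
    moves \<open>P\<close> into the ball of radius 1.\<close>
  obtain D2 where D2: "D2 \<ge> 0" "\<And>y. y \<in> Y \<Longrightarrow> ?d (?p y) y \<le> D2"
  proof -
    obtain M2 where M2: "\<And>\<phi>. \<phi> \<in> Y \<Longrightarrow> \<exists>f\<in>\<phi>. \<exists>\<psi>. R f \<psi> \<and> f ` P \<subseteq> ball_of G (\<psi> ` P) M2"
      using fixed by blast
    obtain M3 where "\<forall>f\<in>auto G. \<forall>\<sigma>\<in>auto G. \<forall>\<psi> \<psi>'. \<sigma> ` P \<subseteq> ball_of G P 1 \<longrightarrow> R f \<psi> \<longrightarrow>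
      R (compose (carrier G) f \<sigma>) \<psi>' \<longrightarrow> \<psi>' ` P \<subseteq> ball_of G (\<psi> ` P) M3"
      using close[of 1] ..
    note M3 = this[rule_format]
    obtain D3 where D3: "D3 \<ge> 0" "\<And>\<psi> \<psi>'. \<psi> \<in> auto G \<Longrightarrow> \<psi>' \<in> auto G \<Longrightarrow> \<psi>' ` P \<subseteq> ball_of G (\<psi> ` P) M2 \<Longrightarrow>
        ?d (outer_class \<psi>) (outer_class \<psi>') \<le> D3"
      by (rule outer_class_dist_bound[OF P, of M2 S]) (rule that)
    obtain D4 where D4: "D4 \<ge> 0" "\<And>\<psi> \<psi>'. \<psi> \<in> auto G \<Longrightarrow> \<psi>' \<in> auto G \<Longrightarrow> \<psi>' ` P \<subseteq> ball_of G (\<psi> ` P) M3 \<Longrightarrow>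
        ?d (outer_class \<psi>) (outer_class \<psi>') \<le> D4"
      by (rule outer_class_dist_bound[OF P, of M3 S]) (rule that)
    have "?d (?p y) y \<le> D4 + D3" if y: "y \<in> Y" for y
    proof -
      have yc: "y \<in> carrier (Out G)" using y Y by blast
      obtain f \<psi> where f: "f \<in> y" "R f \<psi>" "f ` P \<subseteq> ball_of G (\<psi> ` P) M2" using M2[OF y] by blast
      have fa: "f \<in> auto G" "y = outer_class f" using outer_class_mem[OF yc f(1)] by auto
      have \<psi>a: "\<psi> \<in> auto G" using target[OF fa(1) f(2)] by simp
      let ?id = "\<lambda>x\<in>carrier G. x"
      have id: "?id \<in> auto G" using inner_auto_in_auto[of \<one>] by (simp add: inner_auto_one)
      have idP: "?id ` P \<subseteq> ball_of G P 1"
      proof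
        fix q assume "q \<in> ?id ` P"
        then have "q \<in> P" using Pc by auto
        then show "q \<in> ball_of G P 1" using Pc by (intro ball_of_incl) auto
      qed
      have "compose (carrier G) f ?id = f"
        using autoD(3)[OF fa(1)] by (auto simp: compose_def extensional_def fun_eq_iff)
      then have "\<psi> ` P \<subseteq> ball_of G (\<Psi> y ` P) M3"
        using M3[OF fa(1) id idP any_rep[OF yc f(1)], of \<psi>] f(2) by simp
      then have "?d (?p y) (outer_class \<psi>) \<le> D4" using D4(2) \<Psi>a[OF yc] \<psi>a by blast
      moreover have "?d (outer_class \<psi>) y \<le> D3" using D3(2)[OF \<psi>a fa(1) f(3)] fa(2) by simp
      moreover have "outer_class \<psi> \<in> carrier (Out G)" using \<psi>a Out_carrier by blast
      ultimately show ?thesis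
        using M.triangle[OF pc[OF yc] _ yc, of "outer_class \<psi>"] by simp
    qed
    then show ?thesis using that[of "D4 + D3"] D3(1) D4(1) by simp
  qed
  \<comment> \<open>The map so far is only boundedly close to the identity on \<open>Y\<close>;
    correcting it there costs at most \<open>2 * D2\<close>.\<close>
  define q where "q \<phi> = (if \<phi> \<in> Y then \<phi> else ?p \<phi>)" for \<phi>
  have qc: "q \<phi> \<in> Y" "q \<phi> \<in> carrier (Out G)" if "\<phi> \<in> carrier (Out G)" for \<phi>
    using \<Psi>a[OF that] Y by (auto simp: q_def)
  have near: "?d (?p \<phi>) (q \<phi>) \<le> D2" if "\<phi> \<in> carrier (Out G)" for \<phi>
    using D2 pc[OF that] by (auto simp: q_def)
  let ?C = "max 1 (D1 + 2 * D2)"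
  have "?d (q x) (q y) \<le> ?C * ?d x y + ?C" if xy: "x \<in> carrier (Out G)" "y \<in> carrier (Out G)" for x y
  proof -
    have "?d (q x) (q y) \<le> ?d (q x) (?p x) + ?d (?p x) (q y)"
      using xy qc pc by (intro M.triangle) auto
    moreover have "?d (?p x) (q y) \<le> ?d (?p x) (?p y) + ?d (?p y) (q y)"
      using xy qc pc by (intro M.triangle) auto
    moreover have "?d (q x) (?p x) = ?d (?p x) (q x)" by (rule M.commute)
    ultimately have "?d (q x) (q y) \<le> D1 * ?d x y + 2 * D2"
      using near[OF xy(1)] near[OF xy(2)] lip[OF xy] by simp
    also have "\<dots> \<le> ?C * ?d x y + ?C"
      using D1(1) D2(1) M.nonneg[of x y] by (intro add_mono mult_right_mono) auto
    finally show ?thesis .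
  qed
  then have "coarse_lipschitz_retraction (carrier (Out G)) ?d Y q"
    unfolding coarse_lipschitz_retraction_def using Y qc
    by (intro conjI exI[of _ ?C]) (auto simp: q_def)
  then show ?thesis unfolding coarse_lipschitz_retract_def by blast
qed

end

section \<open>Stabilizers of free splittings and of corank one free factors\<close>

text \<open>The factor \<open>u\<close> displaces the vertices by a bounded amount and so leaves the
  end unchanged; quantifying over it makes the condition invariant under left translations of the
  tree.\<close>

definition ends_at :: "('a, 'b) monoid_scheme \<Rightarrow> ('a \<Rightarrow> 'a) \<Rightarrow> 'a \<Rightarrow> 'a \<Rightarrow> 'a \<Rightarrow> bool"
  where "ends_at G \<tau> a g c \<longleftrightarrow> (\<forall>u\<in>carrier G. \<forall>\<^sub>F n in sequentially.
    \<tau> (u \<otimes>\<^bsub>G\<^esub> (a [^]\<^bsub>G\<^esub> (n::nat) \<otimes>\<^bsub>G\<^esub> g)) = c)"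

text \<open>The tree of the basis \<open>f ` P\<close> is tiled by a fundamental domain for \<open>H\<close> containing a prescribed end;
  \<open>\<psi>\<close> maps the fixed basis \<open>Y\<close> of \<open>H\<close> to the Nielsen--Schreier basis of that domain.\<close>

definition marking ::
    "('a, 'b) monoid_scheme \<Rightarrow> 'a set \<Rightarrow> 'a set \<Rightarrow> 'a set \<Rightarrow> 'a \<Rightarrow> 'a \<Rightarrow> ('a \<Rightarrow> 'a) \<Rightarrow> ('a \<Rightarrow> 'a) \<Rightarrow> ('a \<Rightarrow> 'a) \<Rightarrow> bool"
  where "marking G P H Y a g f \<psi> \<tau> \<longleftrightarrow>
    tiling G H (f ` P) \<tau> \<and> \<psi> ` Y = tile_labels G (f ` P) \<tau> \<and> ends_at G \<tau> a g \<one>\<^bsub>G\<^esub>"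

context group
begin

section \<open>Ends and markings\<close>

lemma ends_at_translate:
  assumes "ends_at G \<tau> a g c" "x \<in> carrier G" "a \<in> carrier G" "g \<in> carrier G"
  shows "ends_at G (\<lambda>u. \<tau> (inv x \<otimes> u)) a g c"
  unfolding ends_at_def
proof
  fix u assume u: "u \<in> carrier G"
  then have "\<forall>\<^sub>F n in sequentially. \<tau> (inv x \<otimes> u \<otimes> (a [^] (n::nat) \<otimes> g)) = c"
    using assms(1,2) unfolding ends_at_def by (meson inv_closed m_closed)
  moreover have "inv x \<otimes> u \<otimes> (a [^] n \<otimes> g) = inv x \<otimes> (u \<otimes> (a [^] n \<otimes> g))" for n :: nat
    using u assms by (intro m_assoc) auto
  ultimately show "\<forall>\<^sub>F n in sequentially. \<tau> (inv x \<otimes> (u \<otimes> (a [^] (n::nat) \<otimes> g))) = c" by simp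
qed

lemma ends_at_unique:
  assumes "ends_at G \<tau> a g c" "\<And>n. \<tau> (a [^] (n::nat) \<otimes> g) = d" "a \<in> carrier G" "g \<in> carrier G"
  shows "c = d"
proof -
  have "\<forall>\<^sub>F n in sequentially. \<tau> (\<one> \<otimes> (a [^] (n::nat) \<otimes> g)) = c"
    using assms(1) unfolding ends_at_def by blast
  then obtain n :: nat where "\<tau> (\<one> \<otimes> (a [^] n \<otimes> g)) = c"
    by (auto simp: eventually_sequentially)
  then show ?thesis using assms by simp
qed

lemma free_tilingI: "tiling G H X \<tau> \<Longrightarrow> free_basis G X \<Longrightarrow> free_tiling G H X \<tau>"
  by (simp add: free_tiling_def free_tiling_axioms_def)

lemma ends_at_exists:
  assumes T: "tiling G H X \<tau>" and X: "free_basis G X" and fin: "finite (tile_labels G X \<tau>)"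
    and "a \<in> carrier G" "g \<in> carrier G" "\<And>k. k \<ge> (1::nat) \<Longrightarrow> inv g \<otimes> (a [^] k \<otimes> g) \<notin> H"
  shows "\<exists>c\<in>H. ends_at G \<tau> a g c"
  using free_tiling.end_in_tile[OF free_tilingI[OF T X] fin assms(4-6)] unfolding ends_at_def .

lemma Nielsen_Schreier_card:
  assumes H: "subgroup H G" and Y: "free_basis (G\<lparr>carrier := H\<rparr>) Y" "finite Y"
    and T: "tiling G H X \<tau>" and X: "free_basis G X"
  shows "free_basis (G\<lparr>carrier := H\<rparr>) (tile_labels G X \<tau>)" "finite (tile_labels G X \<tau>)"
    "card (tile_labels G X \<tau>) = card Y"
proof -
  show *: "free_basis (G\<lparr>carrier := H\<rparr>) (tile_labels G X \<tau>)"
    by (rule free_tiling.Nielsen_Schreier[OF free_tilingI[OF T X]])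
  have "group (G\<lparr>carrier := H\<rparr>)" by (rule subgroup.subgroup_is_group[OF H is_group])
  from free_basis_card[OF this Y *] show "finite (tile_labels G X \<tau>)" "card (tile_labels G X \<tau>) = card Y" .
qed

lemma tiling_at_end_exists:
  assumes H: "subgroup H G" and Y: "free_basis (G\<lparr>carrier := H\<rparr>) Y" "finite Y"
    and X: "free_basis G X" and a: "a \<in> carrier G" and g: "g \<in> carrier G"
    and notin: "\<And>k. k \<ge> (1::nat) \<Longrightarrow> inv g \<otimes> (a [^] k \<otimes> g) \<notin> H"
  shows "\<exists>\<tau>. tiling G H X \<tau> \<and> ends_at G \<tau> a g \<one>"
proof -
  obtain \<tau> where T: "tiling G H X \<tau>" using tiling_exists[OF X H] by blast
  interpret T: tiling G H X \<tau> by (rule T)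
  obtain c where c: "c \<in> H" "ends_at G \<tau> a g c"
    using ends_at_exists[OF T X Nielsen_Schreier_card(2)[OF H Y T X] a g notin] by blast
  have "ends_at G (\<lambda>u. inv c \<otimes> \<tau> u) a g \<one>"
    unfolding ends_at_def
  proof
    fix u assume "u \<in> carrier G"
    then have "\<forall>\<^sub>F n in sequentially. \<tau> (u \<otimes> (a [^] (n::nat) \<otimes> g)) = c"
      using c(2) unfolding ends_at_def by blast
    then show "\<forall>\<^sub>F n in sequentially. inv c \<otimes> \<tau> (u \<otimes> (a [^] (n::nat) \<otimes> g)) = \<one>"
      by eventually_elim (use c(1) in simp)
  qed
  moreover have "tiling G H X (\<lambda>u. inv c \<otimes> \<tau> u)"
    using T.recentre[of "inv c"] c(1) by simp
  ultimately show ?thesis by (intro exI conjI)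
qed

lemma marking_inner:
  assumes P: "P \<subseteq> carrier G" and f: "f \<in> auto G" and m: "marking G P H Y a g f \<psi> \<tau>"
    and x: "x \<in> carrier G" and "a \<in> carrier G" "g \<in> carrier G"
  shows "marking G P H Y a g (compose (carrier G) (inner_auto G x) f) \<psi> (\<lambda>u. \<tau> (inv x \<otimes> u))"
proof -
  interpret T: tiling G H "f ` P" \<tau> using m by (simp add: marking_def)
  have "compose (carrier G) (inner_auto G x) f ` P = (\<lambda>y. x \<otimes> y \<otimes> inv x) ` f ` P"
    unfolding image_image using P auto_closed[OF f]
    by (intro image_cong) (auto simp: compose_def inner_auto_def subset_iff)
  then show ?thesis
    using m T.translate[OF x] ends_at_translate[of \<tau> a g \<one> x] assms by (simp add: marking_def)
qed

text \<open>The bound is independent of \<open>f\<close>: there are at most two boundary vertices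
  for each element of \<open>Y\<close>, and the inverse of \<open>f\<close> carries balls of the
  image basis into balls of \<open>P\<close>. The common vertex needed for the comparison is found
  far out towards the end at which both tilings are based.\<close>

lemma marking_close:
  assumes P: "free_basis G P" "finite P" and f: "f \<in> auto G" and \<sigma>: "\<sigma> \<in> auto G" "\<sigma> ` P \<subseteq> ball_of G P k"
    and H: "subgroup H G" and Y: "free_basis (G\<lparr>carrier := H\<rparr>) Y" "finite Y"
    and m: "marking G P H Y a g f \<psi> \<tau>" and m': "marking G P H Y a g (compose (carrier G) f \<sigma>) \<psi>' \<tau>'"
    and ag: "a \<in> carrier G" "g \<in> carrier G" and M: "2 * card Y * card (ball_of G P k) \<le> M"
  shows "w \<in> carrier G \<Longrightarrow> \<tau> w \<otimes> inv (\<tau>' w) \<in> ball_of G (\<psi> ` Y) M"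
    and "\<psi>' ` Y \<subseteq> ball_of G (\<psi> ` Y) (M + k + M)"
proof -
  note Pc = free_basis_subset[OF P(1)]
  have X: "free_basis G (f ` P)" by (rule free_basis_auto_image[OF f P(1)])
  have T: "tiling G H (f ` P) \<tau>" using m by (simp add: marking_def)
  interpret T: free_tiling G H "f ` P" \<tau> by (rule free_tilingI[OF T X])
  let ?X' = "compose (carrier G) f \<sigma> ` P"
  have T': "tiling G H ?X' \<tau>'" using m' by (simp add: marking_def)
  have lab: "\<psi> ` Y = T.labels" "\<psi>' ` Y = tile_labels G ?X' \<tau>'" using m m' by (simp_all add: marking_def)
  have fin: "finite (f ` P)" "finite T.labels"
    using P(2) Nielsen_Schreier_card(2)[OF H Y T X] by auto
  have X': "?X' \<subseteq> ball_of G (f ` P) k"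
    using auto_ball_of[OF f Pc] \<sigma>(2) Pc by (auto simp: compose_eq subset_iff)
  have "card (ball_of G (f ` P) k) \<le> card (ball_of G P k)"
  proof (rule card_inj_on_le[where f = "inv\<^bsub>AutoGroup G\<^esub> f"])
    let ?i = "inv\<^bsub>AutoGroup G\<^esub> f"
    have fP: "f ` P \<subseteq> carrier G" using Pc auto_closed[OF f] by blast
    have "inj_on ?i (carrier G)" using autoD(2)[OF auto_inverse(1)[OF f]] by (simp add: bij_betw_def)
    then show "inj_on ?i (ball_of G (f ` P) k)"
      by (rule inj_on_subset) (use ball_of_closed[OF fP] in blast)
    show "?i ` ball_of G (f ` P) k \<subseteq> ball_of G P k"
      using auto_ball_of[OF auto_inverse(1)[OF f] fP] auto_inverse_image[OF f Pc] by auto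
  qed (rule finite_ball_of[OF P(2)])
  moreover have "card T.boundary \<le> 2 * card Y"
    using T.card_boundary(2) T.card_labels T.finite_labels fin(2) Nielsen_Schreier_card(3)[OF H Y T X] by simp
  ultimately have "card T.boundary * card (ball_of G (f ` P) k) \<le> 2 * card Y * card (ball_of G P k)"
    by (intro mult_le_mono)
  then have M': "card T.boundary * card (ball_of G (f ` P) k) \<le> M" using M by linarith
  have "\<forall>\<^sub>F n in sequentially. \<tau> (\<one> \<otimes> (a [^] (n::nat) \<otimes> g)) = \<one>"
    "\<forall>\<^sub>F n in sequentially. \<tau>' (\<one> \<otimes> (a [^] (n::nat) \<otimes> g)) = \<one>"
    using m m' unfolding marking_def ends_at_def by blast+
  then have "\<forall>\<^sub>F n in sequentially. \<tau> (\<one> \<otimes> (a [^] (n::nat) \<otimes> g)) = \<one> \<and> \<tau>' (\<one> \<otimes> (a [^] (n::nat) \<otimes> g)) = \<one>"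
    by (rule eventually_conj)
  then obtain n :: nat where n: "\<tau> (a [^] n \<otimes> g) = \<one>" "\<tau>' (a [^] n \<otimes> g) = \<one>"
    using ag by (auto simp: eventually_sequentially)
  have v: "a [^] n \<otimes> g \<in> carrier G" using ag by simp
  note cmp = T.tiling_compare[OF T' X' fin v n M']
  show "w \<in> carrier G \<Longrightarrow> \<tau> w \<otimes> inv (\<tau>' w) \<in> ball_of G (\<psi> ` Y) M"
    unfolding lab using cmp(1) .
  show "\<psi>' ` Y \<subseteq> ball_of G (\<psi> ` Y) (M + k + M)"
    unfolding lab using cmp(2) .
qed

lemma marking_image_basis:
  assumes P: "free_basis G P" and f: "f \<in> auto G" and H: "subgroup H G"
    and Y: "free_basis (G\<lparr>carrier := H\<rparr>) Y" "finite Y" and m: "marking G P H Y a g f \<psi> \<tau>"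
  shows "free_basis (G\<lparr>carrier := H\<rparr>) (\<psi> ` Y)"
  using Nielsen_Schreier_card(1)[OF H Y _ free_basis_auto_image[OF f P]] m by (simp add: marking_def)

lemma free_basis_ball:
  assumes H: "subgroup H G" and Y: "free_basis (G\<lparr>carrier := H\<rparr>) Y" and x: "x \<in> H"
  obtains k where "x \<in> ball_of G Y k"
  using Y x unfolding free_basis_iff_wval[OF H] ball_of_def by blast

lemma ball_of_subgroup: "subgroup H G \<Longrightarrow> Y \<subseteq> H \<Longrightarrow> x \<in> ball_of G Y k \<Longrightarrow> x \<in> H"
  using wval_subgroup(2)[of H, OF _ subset_trans, of _ Y] by (auto simp: ball_of_def)

lemma auto_maps_onto:
  assumes \<psi>: "\<psi> \<in> auto G" and H: "subgroup H G" and Y: "free_basis (G\<lparr>carrier := H\<rparr>) Y"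
    and H': "free_basis (G\<lparr>carrier := H\<rparr>) (\<psi> ` Y)"
  shows "\<psi> ` H = H"
proof -
  have sub: "f ` H \<subseteq> H"
    if f: "f \<in> auto G" and Z: "free_basis (G\<lparr>carrier := H\<rparr>) Z" and fZ: "f ` Z \<subseteq> H" for f Z
  proof
    fix y assume "y \<in> f ` H"
    then obtain x where x: "x \<in> H" "y = f x" by auto
    obtain k where "x \<in> ball_of G Z k" using free_basis_ball[OF H Z x(1)] .
    moreover have "Z \<subseteq> carrier G"
      using Z subgroup.subset[OF H] by (auto simp: free_basis_iff)
    ultimately show "y \<in> H" using ball_of_subgroup[OF H fZ auto_ball_of[OF f]] x(2) by blast
  qed
  let ?i = "inv\<^bsub>AutoGroup G\<^esub> \<psi>"
  have YH: "Y \<subseteq> H" "\<psi> ` Y \<subseteq> H" using Y H' by (auto simp: free_basis_iff)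
  have "?i ` \<psi> ` Y = Y"
    using YH(1) subgroup.subset[OF H] by (intro auto_inverse_image[OF \<psi>]) auto
  then have "?i ` H \<subseteq> H" using sub[OF auto_inverse(1)[OF \<psi>] H'] YH by simp
  then have "y \<in> \<psi> ` H" if "y \<in> H" for y
    using that auto_inverse(3)[OF \<psi> subgroup.mem_carrier[OF H that]] by (intro image_eqI[of y \<psi> "?i y"]) auto
  then show ?thesis using sub[OF \<psi> Y YH(2)] by blast
qed

lemma auto_subbasis:
  assumes f: "f \<in> auto G" and P: "free_basis G P" and H: "subgroup H G"
    and Y: "free_basis (G\<lparr>carrier := H\<rparr>) Y" "Y \<subseteq> P" and fH: "f ` H = H"
  shows "free_basis (G\<lparr>carrier := H\<rparr>) (f ` Y)"
proof -
  have YH: "Y \<subseteq> H" using Y by (simp add: free_basis_iff)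
  have fP: "free_basis G (f ` P)" by (rule free_basis_auto_image[OF f P])
  have "inj_on (wval G) (reduced_words (f ` P))" using fP by (simp add: free_basis_iff bij_betw_def)
  then have "inj_on (wval G) (reduced_words (f ` Y))"
    by (rule inj_on_subset) (use reduced_words_mono Y(2) in blast)
  moreover have "H \<subseteq> wval G ` {w. fst ` set w \<subseteq> f ` Y}"
  proof
    fix y assume "y \<in> H"
    then obtain x where x: "x \<in> H" "y = f x" using fH by blast
    obtain k where "x \<in> ball_of G Y k" using free_basis_ball[OF H Y(1) x(1)] .
    then have "y \<in> ball_of G (f ` Y) k"
      unfolding x(2) using YH subgroup.subset[OF H] by (intro auto_ball_of[OF f]) auto
    then show "y \<in> wval G ` {w. fst ` set w \<subseteq> f ` Y}" by (auto simp: ball_of_def)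
  qed
  moreover have "f ` Y \<subseteq> H" using YH fH by blast
  ultimately show ?thesis by (simp add: free_basis_iff_wval[OF H])
qed

text \<open>It is known in general that some tile finally contains all these sequences, so the tile
  can be identified along the one with trivial \<open>u\<close>.\<close>

lemma ends_at_suffix_tiling:
  assumes X: "free_basis G X" and YX: "Y \<subseteq> X" "finite Y" and H: "subgroup H G"
    and Y: "free_basis (G\<lparr>carrier := H\<rparr>) Y" and ag: "a \<in> carrier G" "g \<in> carrier G"
    and notin: "\<And>k. k \<ge> (1::nat) \<Longrightarrow> inv g \<otimes> (a [^] k \<otimes> g) \<notin> H"
    and eq: "\<And>n. suffix_tiling G X Y (a [^] (n::nat) \<otimes> g) = c"
  shows "ends_at G (suffix_tiling G X Y) a g c"
proof -
  have fin: "finite (tile_labels G X (suffix_tiling G X Y))"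
    using labels_suffix_tiling[OF X YX(1) H Y] YX(2) by simp
  obtain d where "ends_at G (suffix_tiling G X Y) a g d"
    using ends_at_exists[OF tiling_suffix_tiling[OF X YX(1) H Y] X fin ag notin] by blast
  moreover from this have "d = c" using eq ag by (rule ends_at_unique)
  ultimately show ?thesis by simp
qed

lemma basis_power_word:
  assumes "free_basis G P" "b \<in> P" "n \<ge> (1::nat)"
  obtains v where "v \<in> reduced_words P" "wval G v = b [^] n" "v \<noteq> []" "hd v = (b, True)" "last v = (b, True)"
  using reduced_power[of "[(b, True)]" P n] assms free_basis_subset[OF assms(1)]
  by (auto simp: reduced_words_Cons letter_value_def)

lemma basis_power_nontrivial:
  assumes "free_basis G P" "b \<in> P" "n \<ge> (1::nat)"
  shows "b [^] n \<noteq> \<one>"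
  using basis_power_word[OF assms] free_basis_reduced_nontrivial[OF assms(1)] by metis

lemma subgroup_free_basis_exists:
  assumes "free_basis G P" "subgroup H G"
  shows "\<exists>Y. free_basis (G\<lparr>carrier := H\<rparr>) Y"
  using tiling_exists[OF assms] free_tiling.Nielsen_Schreier[OF free_tilingI[OF _ assms(1)]] by blast

section \<open>The stabilizer of a free splitting\<close>

lemma free_splitting_subgroups:
  assumes "free_splitting G A B" shows "subgroup A G" "subgroup B G"
  using assms by (auto simp: free_splitting_def)

lemma coarse_retract_all:
  assumes "finite_generating_set (Out G) S"
  shows "coarse_lipschitz_retract (carrier (Out G)) (word_dist (Out G) S) (carrier (Out G))"
  using assms group.Metric_space_word_dist[OF group_Out, of S]
  by (intro coarse_lipschitz_retract_self) (simp add: finite_generating_set_def)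

lemma free_splitting_top:
  assumes split: "free_splitting G A B" and C: "subgroup C G" and "A \<union> B \<subseteq> C"
  shows "C = carrier G"
proof
  show "C \<subseteq> carrier G" using subgroup.subset[OF C] .
  show "carrier G \<subseteq> C"
  proof
    fix x assume "x \<in> carrier G"
    then obtain w where w: "set w \<subseteq> A \<union> B" "x = word_prod G w"
      using free_splitting_generates[OF split] by blast
    then have "set w \<subseteq> C" using assms(3) by blast
    then show "x \<in> C"
      unfolding w(2) by (induction w) (auto intro: subgroup.one_closed[OF C] subgroup.m_closed[OF C])
  qed
qed

lemma auto_of_basis_pairs:
  assumes "free_basis G (Y \<union> Z)" "Y \<inter> Z = {}" "free_basis G (L \<union> M)" "L \<inter> M = {}"
    and "finite Y" "finite Z" "finite L" "finite M" "card Y = card L" "card Z = card M"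
  shows "\<exists>\<psi>\<in>auto G. \<psi> ` Y = L \<and> \<psi> ` Z = M"
proof -
  obtain h1 where h1: "bij_betw h1 Y L" using finite_same_card_bij[OF assms(5,7,9)] by blast
  obtain h2 where h2: "bij_betw h2 Z M" using finite_same_card_bij[OF assms(6,8,10)] by blast
  let ?h = "\<lambda>x. if x \<in> Y then h1 x else h2 x"
  have "bij_betw ?h Y L" by (rule iffD1[OF bij_betw_cong h1]) simp
  moreover have "bij_betw ?h Z M" by (rule iffD1[OF bij_betw_cong h2]) (use assms(2) in auto)
  ultimately have "bij_betw ?h (Y \<union> Z) (L \<union> M)" using assms(4) by (rule bij_betw_combine)
  then obtain \<psi> where \<psi>: "\<psi> \<in> auto G" "\<forall>p\<in>Y \<union> Z. \<psi> p = ?h p"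
    using auto_of_bases[OF assms(1,3)] by blast
  have "\<psi> ` Y = h1 ` Y" using \<psi>(2) by (intro image_cong) auto
  moreover have "\<psi> ` Z = h2 ` Z" using \<psi>(2) assms(2) by (intro image_cong) auto
  ultimately show ?thesis using \<psi>(1) h1 h2 by (auto simp: bij_betw_def)
qed

lemma suffix_tiling_other:
  assumes X: "free_basis G X" and Y: "Y \<subseteq> X" "subgroup A G" "free_basis (G\<lparr>carrier := A\<rparr>) Y"
    and Z: "Z \<subseteq> X" "subgroup B G" "free_basis (G\<lparr>carrier := B\<rparr>) Z"
    and disj: "Y \<inter> Z = {}" and x: "x \<in> B"
  shows "suffix_tiling G X Y x = \<one>"
proof -
  let ?n = "nform G X x"
  have n: "?n \<in> reduced_words Z" using nform_subgroup(2)[OF Z(2,3) X Z(1) x] .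
  have "?n = [] \<or> fst (last ?n) \<notin> Y"
    using reduced_words_letters[OF n] last_in_set[of ?n] disj by blast
  then have "suffix_tiling G X Y (wval G (?n @ [])) = wval G []"
    using n reduced_words_mono[OF n Z(1)] by (intro suffix_tiling_eq[OF X Y]) auto
  then show ?thesis
    using nform(2)[OF X subgroup.mem_carrier[OF Z(2) x]] by simp
qed

lemma empty_basis_trivial: "subgroup H G \<Longrightarrow> free_basis (G\<lparr>carrier := H\<rparr>) {} \<Longrightarrow> H = {\<one>}"
  using subgroup.one_closed[of H G] by (auto simp: free_basis_iff_wval)

theorem stab_splitting_coarse_retract:
  assumes P0: "free_basis G P0" "finite P0" and S: "finite_generating_set (Out G) S"
    and split: "free_splitting G A B"
  shows "coarse_lipschitz_retract (carrier (Out G)) (word_dist (Out G) S) (stab_splitting G A B)"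
proof -
  note A = free_splitting_subgroups(1)[OF split] and B = free_splitting_subgroups(2)[OF split]
  obtain Y Z where Y: "free_basis (G\<lparr>carrier := A\<rparr>) Y" and Z: "free_basis (G\<lparr>carrier := B\<rparr>) Z"
    using subgroup_free_basis_exists[OF P0(1)] A B by blast
  define P where "P = Y \<union> Z"
  have P: "free_basis G P" and disj: "Y \<inter> Z = {}"
    using free_splitting_basis[OF split Y Z] by (simp_all add: P_def)
  have fin: "finite P" using free_basis_card(1)[OF is_group P0 P] .
  have finY: "finite Y" "finite Z" and sub: "Y \<subseteq> P" "Z \<subseteq> P" using fin by (simp_all add: P_def)
  have YA: "Y \<subseteq> A" and ZB: "Z \<subseteq> B" using Y Z by (simp_all add: free_basis_iff)
  note Pc = free_basis_subset[OF P]
  have stab_sub: "stab_splitting G A B \<subseteq> carrier (Out G)" by (auto simp: stab_splitting_def)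
  \<comment> \<open>If one factor is trivial, it offers no element to define an end, but then the
    stabilizer is the whole group.\<close>
  have whole: "coarse_lipschitz_retract (carrier (Out G)) (word_dist (Out G) S) (stab_splitting G A B)"
    if "\<And>f. f \<in> auto G \<Longrightarrow> f ` A = A \<and> f ` B = B"
  proof -
    have "\<exists>f\<in>\<phi>. f ` A = A \<and> f ` B = B" if "\<phi> \<in> carrier (Out G)" for \<phi>
      using that \<open>\<And>f. f \<in> auto G \<Longrightarrow> f ` A = A \<and> f ` B = B\<close> outer_class_self Out_carrier by metis
    then have "stab_splitting G A B = carrier (Out G)"
      unfolding stab_splitting_def by blast
    then show ?thesis using coarse_retract_all[OF S] by simp
  qed
  have auto_trivial: "f ` {\<one>} = {\<one>}" "f ` carrier G = carrier G" if "f \<in> auto G" for f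
    using group_hom.hom_one[OF autoD(4)[OF that]] autoD(2)[OF that] by (simp_all add: bij_betw_def)
  show ?thesis
  proof (cases "Y = {} \<or> Z = {}")
    case True
    then show ?thesis
    proof
      assume "Y = {}"
      then have "A = {\<one>}" using empty_basis_trivial[OF A] Y by simp
      moreover from this have "B = carrier G"
        using subgroup.one_closed[OF B] by (intro free_splitting_top[OF split B]) simp
      ultimately show ?thesis using auto_trivial by (intro whole) simp
    next
      assume "Z = {}"
      then have "B = {\<one>}" using empty_basis_trivial[OF B] Z by simp
      moreover from this have "A = carrier G"
        using subgroup.one_closed[OF A] by (intro free_splitting_top[OF split A]) simp
      ultimately show ?thesis using auto_trivial by (intro whole) simp
    qed
  next
    case False
    then obtain a b where a: "a \<in> Y" and b: "b \<in> Z" by blast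
    have abc: "a \<in> carrier G" "b \<in> carrier G" using a b Pc sub by auto
    have pow: "a [^] n \<in> A" "b [^] n \<in> B" for n :: nat
      using a b YA ZB subgroup.one_closed[OF A] subgroup.m_closed[OF A]
        subgroup.one_closed[OF B] subgroup.m_closed[OF B] by (induction n) auto
    \<comment> \<open>Powers of \<open>b\<close> stay in \<open>B\<close>, which meets
      \<open>A\<close> trivially, so the end of \<open>b\<close> is admissible for \<open>A\<close>;
      likewise with the roles exchanged.\<close>
    have notin: "inv \<one> \<otimes> (b [^] k \<otimes> \<one>) \<notin> A" "inv \<one> \<otimes> (a [^] k \<otimes> \<one>) \<notin> B" if k: "k \<ge> 1" for k :: nat
      using free_splitting_Int[OF split] pow[of k] basis_power_nontrivial[OF P _ k] a b sub abc
      by auto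
    \<comment> \<open>The tilings for the two factors are chosen independently: any bases of the
      factors together form a basis of the group, so a single \<open>\<psi>\<close> realizes
      both.\<close>
    define R where "R f \<psi> \<longleftrightarrow> \<psi> \<in> auto G \<and>
      (\<exists>\<tau>. marking G P A Y b \<one> f \<psi> \<tau>) \<and> (\<exists>\<tau>. marking G P B Z a \<one> f \<psi> \<tau>)" for f \<psi>
    show ?thesis
    proof (rule coarse_retract_criterion[OF P fin S stab_sub, of R])
      fix f assume f: "f \<in> auto G"
      have X: "free_basis G (f ` P)" by (rule free_basis_auto_image[OF f P])
      obtain \<tau>A where \<tau>A: "tiling G A (f ` P) \<tau>A" "ends_at G \<tau>A b \<one> \<one>"
        using tiling_at_end_exists[OF A Y finY(1) X abc(2) one_closed notin(1)] by blast
      obtain \<tau>B where \<tau>B: "tiling G B (f ` P) \<tau>B" "ends_at G \<tau>B a \<one> \<one>"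
        using tiling_at_end_exists[OF B Z finY(2) X abc(1) one_closed notin(2)] by blast
      let ?L = "tile_labels G (f ` P) \<tau>A" and ?M = "tile_labels G (f ` P) \<tau>B"
      note L = Nielsen_Schreier_card[OF A Y finY(1) \<tau>A(1) X]
      note M = Nielsen_Schreier_card[OF B Z finY(2) \<tau>B(1) X]
      note LM = free_splitting_basis[OF split L(1) M(1)]
      obtain \<psi> where \<psi>: "\<psi> \<in> auto G" "\<psi> ` Y = ?L" "\<psi> ` Z = ?M"
        using auto_of_basis_pairs[OF P[unfolded P_def] disj LM finY L(2) M(2) L(3)[symmetric] M(3)[symmetric]]
        by blast
      show "\<exists>\<psi>. R f \<psi>"
        unfolding R_def marking_def using \<psi> \<tau>A \<tau>B by blast
    next
      fix f \<psi> assume f: "f \<in> auto G" and R: "R f \<psi>"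
      have X: "free_basis G (f ` P)" by (rule free_basis_auto_image[OF f P])
      have \<psi>: "\<psi> \<in> auto G" using R by (simp add: R_def)
      have "free_basis (G\<lparr>carrier := A\<rparr>) (\<psi> ` Y)" "free_basis (G\<lparr>carrier := B\<rparr>) (\<psi> ` Z)"
        using marking_image_basis[OF P f A Y finY(1)] marking_image_basis[OF P f B Z finY(2)] R
        unfolding R_def by blast+
      then have "\<psi> ` A = A" "\<psi> ` B = B"
        using auto_maps_onto[OF \<psi> A Y] auto_maps_onto[OF \<psi> B Z] by auto
      then show "\<psi> \<in> auto G \<and> outer_class \<psi> \<in> stab_splitting G A B"
        using \<psi> outer_class_self[OF \<psi>] Out_carrier unfolding stab_splitting_def by blast
    next
      fix f \<psi> x assume "f \<in> auto G" "R f \<psi>" "x \<in> carrier G"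
      then show "R (compose (carrier G) (inner_auto G x) f) \<psi>"
        unfolding R_def using marking_inner[OF Pc] abc one_closed by blast
    next
      fix k
      let ?N = "card (ball_of G P k)"
      let ?M = "2 * card P * ?N"
      have MY: "2 * card Y * ?N \<le> ?M" "2 * card Z * ?N \<le> ?M"
        using sub fin by (auto intro!: mult_le_mono card_mono)
      have "\<psi>' ` P \<subseteq> ball_of G (\<psi> ` P) (?M + k + ?M)"
        if f: "f \<in> auto G" and \<sigma>: "\<sigma> \<in> auto G" "\<sigma> ` P \<subseteq> ball_of G P k"
          and R: "R f \<psi>" "R (compose (carrier G) f \<sigma>) \<psi>'" for f \<sigma> \<psi> \<psi>'
      proof -
        obtain t1 t2 t1' t2' where
          "marking G P A Y b \<one> f \<psi> t1" "marking G P A Y b \<one> (compose (carrier G) f \<sigma>) \<psi>' t1'"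
          "marking G P B Z a \<one> f \<psi> t2" "marking G P B Z a \<one> (compose (carrier G) f \<sigma>) \<psi>' t2'"
          using R unfolding R_def by blast
        then have "\<psi>' ` Y \<subseteq> ball_of G (\<psi> ` Y) (?M + k + ?M)" "\<psi>' ` Z \<subseteq> ball_of G (\<psi> ` Z) (?M + k + ?M)"
          using marking_close(2)[OF P fin f \<sigma> A Y finY(1) _ _ abc(2) one_closed MY(1)]
            marking_close(2)[OF P fin f \<sigma> B Z finY(2) _ _ abc(1) one_closed MY(2)] by blast+
        moreover have "ball_of G (\<psi> ` Y) (?M + k + ?M) \<subseteq> ball_of G (\<psi> ` P) (?M + k + ?M)"
          "ball_of G (\<psi> ` Z) (?M + k + ?M) \<subseteq> ball_of G (\<psi> ` P) (?M + k + ?M)"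
          using sub by (intro ball_of_mono image_mono order_refl; simp)+
        ultimately show ?thesis unfolding P_def image_Un by blast
      qed
      then show "\<exists>M. \<forall>f\<in>auto G. \<forall>\<sigma>\<in>auto G. \<forall>\<psi> \<psi>'. \<sigma> ` P \<subseteq> ball_of G P k \<longrightarrow> R f \<psi> \<longrightarrow>
        R (compose (carrier G) f \<sigma>) \<psi>' \<longrightarrow> \<psi>' ` P \<subseteq> ball_of G (\<psi> ` P) M" by blast
    next
      \<comment> \<open>An automorphism preserving both factors is its own admissible choice: its
        image basis splits, and powers of \<open>b\<close> have no final block in the part for
        \<open>A\<close>.\<close>
      have "\<exists>f\<in>\<phi>. R f f \<and> f ` P \<subseteq> ball_of G (f ` P) 1" if \<phi>: "\<phi> \<in> stab_splitting G A B" for \<phi>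
      proof -
        obtain f where f: "f \<in> \<phi>" "f ` A = A" "f ` B = B" and c: "\<phi> \<in> carrier (Out G)"
          using \<phi> by (auto simp: stab_splitting_def)
        have fa: "f \<in> auto G" using outer_class_mem[OF c f(1)] by simp
        have X: "free_basis G (f ` P)" by (rule free_basis_auto_image[OF fa P])
        have fY: "free_basis (G\<lparr>carrier := A\<rparr>) (f ` Y)" by (rule auto_subbasis[OF fa P A Y sub(1) f(2)])
        have fZ: "free_basis (G\<lparr>carrier := B\<rparr>) (f ` Z)" by (rule auto_subbasis[OF fa P B Z sub(2) f(3)])
        have fsub: "f ` Y \<subseteq> f ` P" "f ` Z \<subseteq> f ` P" using sub by auto
        have fdisj: "f ` Y \<inter> f ` Z = {}" "f ` Z \<inter> f ` Y = {}"
          using free_splitting_basis(2)[OF split fY fZ] by blast+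
        have "marking G P A Y b \<one> f f (suffix_tiling G (f ` P) (f ` Y))"
          unfolding marking_def labels_suffix_tiling[OF X fsub(1) A fY]
          using tiling_suffix_tiling[OF X fsub(1) A fY] finY fdisj
            suffix_tiling_other[OF X fsub(1) A fY fsub(2) B fZ] pow(2) abc
          by (intro conjI ends_at_suffix_tiling[OF X fsub(1) _ A fY abc(2) one_closed notin(1)]) auto
        moreover have "marking G P B Z a \<one> f f (suffix_tiling G (f ` P) (f ` Z))"
          unfolding marking_def labels_suffix_tiling[OF X fsub(2) B fZ]
          using tiling_suffix_tiling[OF X fsub(2) B fZ] finY fdisj
            suffix_tiling_other[OF X fsub(2) B fZ fsub(1) A fY] pow(1) abc
          by (intro conjI ends_at_suffix_tiling[OF X fsub(2) _ B fZ abc(1) one_closed notin(2)]) auto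
        moreover have "f ` P \<subseteq> ball_of G (f ` P) 1"
          using free_basis_subset[OF X] by (auto intro: ball_of_incl)
        ultimately show ?thesis using f(1) fa unfolding R_def by blast
      qed
      then show "\<exists>M. \<forall>\<phi>\<in>stab_splitting G A B. \<exists>f\<in>\<phi>. \<exists>\<psi>. R f \<psi> \<and> f ` P \<subseteq> ball_of G (\<psi> ` P) M"
        by blast
    qed
  qed
qed

section \<open>The stabilizer of a free factor of corank one\<close>

lemma conj_basis_power_notin:
  assumes P: "free_basis G P" and YP: "Y \<subseteq> P" and A: "subgroup A G" and Y: "free_basis (G\<lparr>carrier := A\<rparr>) Y"
    and a: "a \<in> Y" and l: "fst l \<in> P" "fst l \<notin> Y" and k: "k \<ge> (1::nat)"
  shows "letter_value G l \<otimes> (a [^] k \<otimes> letter_value G (flip l)) \<notin> A"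
proof
  assume *: "letter_value G l \<otimes> (a [^] k \<otimes> letter_value G (flip l)) \<in> A"
  have aP: "a \<in> P" and la: "fst l \<noteq> a" using a YP l by auto
  obtain v where v: "v \<in> reduced_words P" "wval G v = a [^] k" "v \<noteq> []" "hd v = (a, True)" "last v = (a, True)"
    using basis_power_word[OF P aP k] .
  have lc: "fst l \<in> carrier G" and vc: "fst ` set v \<subseteq> carrier G"
    using l reduced_words_letters[OF v(1)] free_basis_subset[OF P] by auto
  \<comment> \<open>\<open>a\<close> differs from \<open>fst l\<close>, so the conjugated power is
    reduced as written and keeps a letter outside \<open>Y\<close>.\<close>
  have "hd v \<noteq> flip l" "flip l \<noteq> flip (last v)" using v la by (auto simp: flip_def)
  then have red: "l # v @ [flip l] \<in> reduced_words P"
    using v l by (auto simp: reduced_words_Cons reduced_words_append hd_append)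
  have "wval G (l # v @ [flip l]) = letter_value G l \<otimes> (a [^] k \<otimes> letter_value G (flip l))"
    using lc vc v(2) by (simp add: wval_append)
  then have "nform G P (letter_value G l \<otimes> (a [^] k \<otimes> letter_value G (flip l))) = l # v @ [flip l]"
    using red by (intro nform_unique[OF P])
  then have "l # v @ [flip l] \<in> reduced_words Y"
    using nform_subgroup(2)[OF A Y P YP *] by simp
  then show False using l(2) by (simp add: reduced_words_Cons)
qed

lemma suffix_tiling_letter:
  assumes X: "free_basis G X" and Y: "Y \<subseteq> X" "subgroup A G" "free_basis (G\<lparr>carrier := A\<rparr>) Y"
    and l: "fst l \<in> X" "fst l \<notin> Y" and p: "p \<in> A" and q: "q \<in> A"
  shows "suffix_tiling G X Y (p \<otimes> (letter_value G l \<otimes> q)) = q"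
proof -
  let ?p = "nform G X p" and ?q = "nform G X q"
  have pq: "?p \<in> reduced_words Y" "?q \<in> reduced_words Y"
    using nform_subgroup(2)[OF Y(2,3) X Y(1)] p q by auto
  have val: "wval G ?p = p" "wval G ?q = q"
    using nform(2)[OF X] subgroup.mem_carrier[OF Y(2)] p q by auto
  have "?p \<noteq> [] \<Longrightarrow> fst (last ?p) \<in> Y" using reduced_words_letters[OF pq(1)] by force
  then have "?p @ [l] \<in> reduced_words X"
    using reduced_words_mono[OF pq(1) Y(1)] l by (auto simp: reduced_words_append reduced_words_Cons)
  then have red: "(?p @ [l]) @ ?q \<in> reduced_words X"
    using l by (intro reduced_split_append[OF X Y _ _ pq(2)]) auto
  have "fst ` set ?p \<subseteq> carrier G" "fst ` set ?q \<subseteq> carrier G" "fst l \<in> carrier G"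
    using pq[THEN reduced_words_letters] Y(1) l free_basis_subset[OF X] by auto
  then have "wval G ((?p @ [l]) @ ?q) = p \<otimes> (letter_value G l \<otimes> q)"
    using val by (simp add: wval_append image_Un)
  moreover have "suffix_tiling G X Y (wval G ((?p @ [l]) @ ?q)) = wval G ?q"
    using l by (intro suffix_tiling_eq[OF X Y red reduced_words_letters[OF pq(2)]]) simp
  ultimately show ?thesis using val by simp
qed

lemma hom_id_on_subgroup:
  assumes A: "subgroup A G" and L: "free_basis (G\<lparr>carrier := A\<rparr>) L" and h: "h \<in> hom G G"
    and "\<And>x. x \<in> L \<Longrightarrow> h x = x" and "x \<in> A"
  shows "h x = x"
proof -
  interpret A: group "G\<lparr>carrier := A\<rparr>" using A by (rule subgroup.subgroup_is_group) (rule is_group)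
  have "h \<in> hom (G\<lparr>carrier := A\<rparr>) G" "id \<in> hom (G\<lparr>carrier := A\<rparr>) G"
    using h subgroup.mem_carrier[OF A] by (auto simp: hom_def)
  then have "h x = id x"
    using assms(4,5) by (intro A.free_basis_hom_ext[OF L is_group, of h id x]) auto
  then show ?thesis by simp
qed

text \<open>The same construction with \<open>inv c\<close> gives the inverse. It adjusts the image
  of \<open>z\<close> without disturbing a basis of \<open>A\<close>.\<close>

lemma twist_auto:
  assumes B: "free_basis G (insert z L)" and z: "z \<notin> L" and A: "subgroup A G"
    and L: "free_basis (G\<lparr>carrier := A\<rparr>) L" and c: "c \<in> A"
  shows "\<exists>t\<in>auto G. (\<forall>x\<in>A. t x = x) \<and> t z = z \<otimes> c"
proof -
  note Bc = free_basis_subset[OF B] and Ac = subgroup.mem_carrier[OF A]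
  have ex: "\<exists>h\<in>hom G G. (\<forall>x\<in>A. h x = x) \<and> h z = z \<otimes> d" if d: "d \<in> A" for d
  proof -
    have "(if b = z then z \<otimes> d else b) \<in> carrier G" if "b \<in> insert z L" for b
      using that Bc Ac[OF d] by auto
    then obtain h where h: "h \<in> hom G G" "\<forall>b\<in>insert z L. h b = (if b = z then z \<otimes> d else b)"
      using free_basis_extend[OF B is_group, of "\<lambda>b. if b = z then z \<otimes> d else b"] by blast
    have "h b = b" if "b \<in> L" for b using h(2) that z by auto
    then have "h x = x" if "x \<in> A" for x using hom_id_on_subgroup[OF A L h(1) _ that] by blast
    then show ?thesis using h by auto
  qed
  obtain h where h: "h \<in> hom G G" "\<forall>x\<in>A. h x = x" "h z = z \<otimes> c" using ex[OF c] by blast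
  obtain h' where h': "h' \<in> hom G G" "\<forall>x\<in>A. h' x = x" "h' z = z \<otimes> inv c"
    using ex[OF subgroup.m_inv_closed[OF A c]] by blast
  have LA: "L \<subseteq> A" using L by (simp add: free_basis_iff)
  have zc: "z \<in> carrier G" using Bc by simp
  have cc: "c \<in> carrier G" "inv c \<in> A" using Ac[OF c] subgroup.m_inv_closed[OF A c] by auto
  have "h' (z \<otimes> c) = z" "h (z \<otimes> inv c) = z"
    using hom_mult[OF h'(1) zc cc(1)] hom_mult[OF h(1) zc inv_closed[OF cc(1)]] h h' c cc zc
    by (simp_all add: m_assoc)
  then have "restrict h (carrier G) \<in> auto G"
    using h h' LA by (intro auto_of_homs[OF B B h(1) h'(1)]) auto
  then show ?thesis using h Ac zc by (intro bexI[of _ "restrict h (carrier G)"]) auto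
qed

lemma flip_auto:
  assumes B: "free_basis G (insert z L)" and z: "z \<notin> L"
  shows "\<exists>t\<in>auto G. (\<forall>x\<in>L. t x = x) \<and> t z = inv z"
proof -
  note Bc = free_basis_subset[OF B]
  have "(if b = z then inv z else b) \<in> carrier G" if "b \<in> insert z L" for b
    using that Bc by auto
  then obtain h where h: "h \<in> hom G G" "\<forall>b\<in>insert z L. h b = (if b = z then inv z else b)"
    using free_basis_extend[OF B is_group, of "\<lambda>b. if b = z then inv z else b"] by blast
  have zc: "z \<in> carrier G" using Bc by simp
  interpret h: group_hom G G h by unfold_locales (rule h(1))
  have "h (h b) = b" if "b \<in> insert z L" for b
    using h(2) that z zc by (cases "b = z") auto
  then have "restrict h (carrier G) \<in> auto G" by (intro auto_of_homs[OF B B h(1) h(1)])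
  moreover have "\<forall>x\<in>L. restrict h (carrier G) x = x" "restrict h (carrier G) z = inv z"
    using h(2) Bc z by auto
  ultimately show ?thesis by blast
qed

lemma inner_auto_subgroup:
  assumes A: "subgroup A G" and h: "h \<in> A" and f: "f ` A = A"
  shows "compose (carrier G) (inner_auto G h) f ` A = A"
proof -
  note Ac = subgroup.mem_carrier[OF A] and mc = subgroup.m_closed[OF A] and ic = subgroup.m_inv_closed[OF A]
  have "compose (carrier G) (inner_auto G h) f x = h \<otimes> f x \<otimes> inv h" if "x \<in> A" for x
    using that f Ac by (auto simp: compose_def inner_auto_def)
  then have "compose (carrier G) (inner_auto G h) f ` A = (\<lambda>y. h \<otimes> y \<otimes> inv h) ` f ` A"
    unfolding image_image by (intro image_cong) auto
  also have "\<dots> = A"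
    unfolding f
  proof (intro equalityI subsetI)
    fix y assume y: "y \<in> A"
    then have "y = h \<otimes> (inv h \<otimes> y \<otimes> h) \<otimes> inv h"
      using h Ac by (simp add: m_assoc cancel_left)
    then show "y \<in> (\<lambda>y. h \<otimes> y \<otimes> inv h) ` A"
      by (rule image_eqI) (use y h mc ic in auto)
  qed (use h mc ic in auto)
  finally show ?thesis .
qed

theorem stab_factor_coarse_retract:
  assumes n: "n \<ge> 2" and rank: "free_group_of_rank G n" and S: "finite_generating_set (Out G) S"
    and corank: "corank1_free_factor G n A"
  shows "coarse_lipschitz_retract (carrier (Out G)) (word_dist (Out G) S) (stab_factor G A)"
proof -
  obtain P0 where P0: "free_basis G P0" "finite P0" "card P0 = n"
    using rank by (auto simp: free_group_of_rank_def)
  have A: "subgroup A G" using corank by (simp add: corank1_free_factor_def)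
  obtain Y where Y: "free_basis (G\<lparr>carrier := A\<rparr>) Y" "finite Y" "card Y = n - 1"
    using corank by (auto simp: corank1_free_factor_def free_group_of_rank_def)
  obtain B where split: "free_splitting G A B"
    using corank by (auto simp: corank1_free_factor_def)
  note B = free_splitting_subgroups(2)[OF split]
  obtain Z where Z: "free_basis (G\<lparr>carrier := B\<rparr>) Z"
    using subgroup_free_basis_exists[OF P0(1) B] by blast
  have YZ: "free_basis G (Y \<union> Z)" "Y \<inter> Z = {}" using free_splitting_basis[OF split Y(1) Z] by auto
  have "finite (Y \<union> Z)" "card (Y \<union> Z) = n" using free_basis_card[OF is_group P0(1,2) YZ(1)] P0(3) by auto
  then have "card Z = 1" using YZ(2) Y(2,3) n by (simp add: card_Un_disjoint)
  then obtain z where z: "Z = {z}" by (auto simp: card_1_singleton_iff)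
  define P where "P = insert z Y"
  have P: "free_basis G P" and zY: "z \<notin> Y" and fin: "finite P" and YP: "Y \<subseteq> P" and zP: "z \<in> P"
    using YZ z Y(2) by (auto simp: P_def)
  note Pc = free_basis_subset[OF P] and Ac = subgroup.mem_carrier[OF A]
  have zc: "z \<in> carrier G" "inv z \<in> carrier G" using Pc zP by auto
  have "Y \<noteq> {}" using Y(3) n by auto
  then obtain a where a: "a \<in> Y" by blast
  have YA: "Y \<subseteq> A" using Y by (simp add: free_basis_iff)
  have ac: "a \<in> carrier G" "a \<in> A" using a YA Ac by auto
  have pow: "a [^] k \<in> A" for k :: nat
    using ac subgroup.one_closed[OF A] subgroup.m_closed[OF A] by (induction k) auto
  have notin: "inv (inv z) \<otimes> (a [^] k \<otimes> inv z) \<notin> A" "inv z \<otimes> (a [^] k \<otimes> z) \<notin> A" if "k \<ge> 1" for k :: nat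
    using conj_basis_power_notin[OF P YP A Y(1) a _ _ that, of "(z, True)"]
      conj_basis_power_notin[OF P YP A Y(1) a _ _ that, of "(z, False)"] zP zY zc
    by (simp_all add: letter_value_def flip_def)
  have stab_sub: "stab_factor G A \<subseteq> carrier (Out G)" by (auto simp: stab_factor_def)
  \<comment> \<open>If \<open>f z = z \<otimes> d\<close> and \<open>f\<close> preserves
    \<open>A\<close>, then \<open>a [^] n \<otimes> z\<close> is, in the image basis, a word in
    which \<open>f z\<close> is followed by \<open>inv d\<close>. Hence \<open>c = inv d\<close>,
    and \<open>z \<otimes> inv c\<close> recovers \<open>f z\<close>.\<close>
  define R where "R f \<psi> \<longleftrightarrow> \<psi> \<in> auto G \<and> (\<exists>\<tau> c. marking G P A Y a (inv z) f \<psi> \<tau> \<and>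
    ends_at G \<tau> a z c \<and> c \<in> A \<and> \<psi> z = z \<otimes> inv c)" for f \<psi>
  show ?thesis
  proof (rule coarse_retract_criterion[OF P fin S stab_sub, of R])
    fix f assume f: "f \<in> auto G"
    have X: "free_basis G (f ` P)" by (rule free_basis_auto_image[OF f P])
    obtain \<tau> where \<tau>: "tiling G A (f ` P) \<tau>" "ends_at G \<tau> a (inv z) \<one>"
      using tiling_at_end_exists[OF A Y(1,2) X ac(1) zc(2) notin(1)] by blast
    let ?L = "tile_labels G (f ` P) \<tau>"
    note L = Nielsen_Schreier_card[OF A Y(1,2) \<tau>(1) X]
    obtain c where c: "c \<in> A" "ends_at G \<tau> a z c"
      using ends_at_exists[OF \<tau>(1) X L(2) ac(1) zc(1) notin(2)] by blast
    have Lz: "free_basis G (?L \<union> {z})" "?L \<inter> {z} = {}"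
      using free_splitting_basis[OF split L(1) Z] z by auto
    obtain \<psi> where \<psi>: "\<psi> \<in> auto G" "\<psi> ` Y = ?L" "\<psi> ` {z} = {z}"
      using auto_of_basis_pairs[of Y "{z}" ?L "{z}"] P zY Lz Y(2) L(2,3) by (auto simp: P_def)
    obtain t where t: "t \<in> auto G" "\<forall>x\<in>A. t x = x" "t z = z \<otimes> inv c"
      using twist_auto[of z ?L A "inv c"] Lz A L(1) subgroup.m_inv_closed[OF A c(1)] by auto
    let ?\<psi> = "compose (carrier G) t \<psi>"
    have LA: "?L \<subseteq> A" using L(1) by (simp add: free_basis_iff)
    have "?\<psi> ` Y = (\<lambda>x. t (\<psi> x)) ` Y" using YP Pc by (intro image_cong) (auto simp: compose_eq)
    also have "\<dots> = t ` ?L" using \<psi>(2) by (simp add: image_image[symmetric])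
    also have "\<dots> = ?L" using t(2) LA by (force simp: image_iff)
    finally have "?\<psi> ` Y = ?L" .
    moreover have "?\<psi> z = z \<otimes> inv c" using \<psi>(3) t(3) zc by (simp add: compose_eq)
    moreover have "?\<psi> \<in> auto G" by (rule compose_auto[OF t(1) \<psi>(1)])
    ultimately show "\<exists>\<psi>. R f \<psi>" unfolding R_def marking_def using \<tau> c by blast
  next
    fix f \<psi> assume f: "f \<in> auto G" and R: "R f \<psi>"
    have \<psi>: "\<psi> \<in> auto G" using R by (simp add: R_def)
    have "free_basis (G\<lparr>carrier := A\<rparr>) (\<psi> ` Y)"
      using marking_image_basis[OF P f A Y(1,2)] R unfolding R_def by blast
    then have "\<psi> ` A = A" using auto_maps_onto[OF \<psi> A Y(1)] by auto
    then show "\<psi> \<in> auto G \<and> outer_class \<psi> \<in> stab_factor G A"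
      using \<psi> outer_class_self[OF \<psi>] Out_carrier unfolding stab_factor_def by blast
  next
    fix f \<psi> x assume "f \<in> auto G" "R f \<psi>" "x \<in> carrier G"
    then show "R (compose (carrier G) (inner_auto G x) f) \<psi>"
      unfolding R_def using marking_inner[OF Pc] ends_at_translate ac(1) zc by blast
  next
    fix k
    let ?M = "2 * card Y * card (ball_of G P k)"
    \<comment> \<open>The additional 1 is for the factor \<open>\<psi> z\<close> in
      \<open>\<psi>' z = \<psi> z \<otimes> (c \<otimes> inv c')\<close>.\<close>
    let ?K = "1 + (?M + k + ?M)"
    have "\<psi>' ` P \<subseteq> ball_of G (\<psi> ` P) ?K"
      if f: "f \<in> auto G" and \<sigma>: "\<sigma> \<in> auto G" "\<sigma> ` P \<subseteq> ball_of G P k"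
        and R: "R f \<psi>" "R (compose (carrier G) f \<sigma>) \<psi>'" for f \<sigma> \<psi> \<psi>'
    proof -
      obtain \<tau> c where m: "marking G P A Y a (inv z) f \<psi> \<tau>" "ends_at G \<tau> a z c" "c \<in> A" "\<psi> z = z \<otimes> inv c"
        using R(1) unfolding R_def by blast
      obtain \<tau>' c' where m': "marking G P A Y a (inv z) (compose (carrier G) f \<sigma>) \<psi>' \<tau>'" "ends_at G \<tau>' a z c'"
        "c' \<in> A" "\<psi>' z = z \<otimes> inv c'"
        using R(2) unfolding R_def by blast
      have \<psi>: "\<psi> \<in> auto G" using R(1) by (simp add: R_def)
      have \<psi>P: "\<psi> ` P \<subseteq> carrier G" using auto_closed[OF \<psi>] Pc by blast
      note close = marking_close[OF P fin f \<sigma> A Y(1,2) m(1) m'(1) ac(1) zc(2) order_refl]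
      have 1: "\<psi>' ` Y \<subseteq> ball_of G (\<psi> ` P) ?K"
        using close(2) ball_of_mono[of "?M + k + ?M" ?K "\<psi> ` Y" "\<psi> ` P" G] YP by (auto simp: image_mono)
      have "\<forall>\<^sub>F n in sequentially. \<tau> (\<one> \<otimes> (a [^] (n::nat) \<otimes> z)) = c"
        "\<forall>\<^sub>F n in sequentially. \<tau>' (\<one> \<otimes> (a [^] (n::nat) \<otimes> z)) = c'"
        using m(2) m'(2) unfolding ends_at_def by blast+
      then have "\<forall>\<^sub>F n in sequentially. \<tau> (\<one> \<otimes> (a [^] (n::nat) \<otimes> z)) = c \<and> \<tau>' (\<one> \<otimes> (a [^] (n::nat) \<otimes> z)) = c'"
        by (rule eventually_conj)
      \<comment> \<open>A vertex far out towards the second end lies in tile \<open>c\<close> of one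
        tiling and in tile \<open>c'\<close> of the other; comparing the tilings there bounds
        \<open>c \<otimes> inv c'\<close>.\<close>
      then obtain n :: nat where n: "\<tau> (\<one> \<otimes> (a [^] n \<otimes> z)) = c" "\<tau>' (\<one> \<otimes> (a [^] n \<otimes> z)) = c'"
        by (auto simp: eventually_sequentially)
      have "\<one> \<otimes> (a [^] n \<otimes> z) \<in> carrier G" using ac zc by simp
      from close(1)[OF this] have "c \<otimes> inv c' \<in> ball_of G (\<psi> ` Y) ?M" unfolding n .
      then have 2: "c \<otimes> inv c' \<in> ball_of G (\<psi> ` P) (?M + k + ?M)"
        using ball_of_mono[of ?M "?M + k + ?M" "\<psi> ` Y" "\<psi> ` P" G] YP by (auto simp: image_mono)
      have "\<psi> z \<in> ball_of G (\<psi> ` P) 1" using zP by (intro ball_of_incl[OF \<psi>P]) auto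
      then have "\<psi> z \<otimes> (c \<otimes> inv c') \<in> ball_of G (\<psi> ` P) ?K"
        using 2 by (rule ball_of_mult[OF \<psi>P])
      moreover have "\<psi> z \<otimes> (c \<otimes> inv c') = \<psi>' z"
        using m(3,4) m'(3,4) zc Ac by (simp add: m_assoc cancel_left)
      ultimately have "\<psi>' z \<in> ball_of G (\<psi> ` P) ?K" by simp
      then show ?thesis using 1 by (simp add: P_def)
    qed
    then show "\<exists>M. \<forall>f\<in>auto G. \<forall>\<sigma>\<in>auto G. \<forall>\<psi> \<psi>'. \<sigma> ` P \<subseteq> ball_of G P k \<longrightarrow> R f \<psi> \<longrightarrow>
      R (compose (carrier G) f \<sigma>) \<psi>' \<longrightarrow> \<psi>' ` P \<subseteq> ball_of G (\<psi> ` P) M" by blast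
  next
    have "\<exists>f\<in>\<phi>. \<exists>\<psi>. R f \<psi> \<and> f ` P \<subseteq> ball_of G (\<psi> ` P) 1" if \<phi>: "\<phi> \<in> stab_factor G A" for \<phi>
    proof -
      obtain f0 where f0: "f0 \<in> \<phi>" "f0 ` A = A" and \<phi>c: "\<phi> \<in> carrier (Out G)"
        using \<phi> by (auto simp: stab_factor_def)
      have f0a: "f0 \<in> auto G" "\<phi> = outer_class f0" using outer_class_mem[OF \<phi>c f0(1)] by auto
      obtain g g' where g: "g \<in> A" "g' \<in> A" "f0 z = g \<otimes> (z \<otimes> g') \<or> f0 z = g \<otimes> (inv z \<otimes> g')"
        using auto_preserving_corank1[OF P[unfolded P_def] zY A Y(1) f0a(1) f0(2)] by blast
      \<comment> \<open>Conjugation by an element of \<open>A\<close> stays in the outer class and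
        preserves \<open>A\<close>; it collects both factors from \<open>A\<close> on one side of
        \<open>z\<close>.\<close>
      have "\<exists>h\<in>A. \<exists>d\<in>A. h \<otimes> f0 z \<otimes> inv h = z \<otimes> d \<or> h \<otimes> f0 z \<otimes> inv h = inv (z \<otimes> d)"
        using g(3)
      proof
        assume eq: "f0 z = g \<otimes> (z \<otimes> g')"
        have "inv g \<otimes> f0 z \<otimes> inv (inv g) = z \<otimes> (g' \<otimes> g)"
          unfolding eq using g Ac zc by (simp add: m_assoc cancel_left)
        then show ?thesis
          using g subgroup.m_closed[OF A] subgroup.m_inv_closed[OF A] by blast
      next
        assume eq: "f0 z = g \<otimes> (inv z \<otimes> g')"
        have "g' \<otimes> f0 z \<otimes> inv g' = inv (z \<otimes> inv (g' \<otimes> g))"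
          unfolding eq using g Ac zc by (simp add: m_assoc inv_mult_group)
        then show ?thesis
          using g subgroup.m_closed[OF A] subgroup.m_inv_closed[OF A] by blast
      qed
      then obtain h d where h: "h \<in> A" and d: "d \<in> A"
        and hd: "h \<otimes> f0 z \<otimes> inv h = z \<otimes> d \<or> h \<otimes> f0 z \<otimes> inv h = inv (z \<otimes> d)" by blast
      define f where "f = compose (carrier G) (inner_auto G h) f0"
      have f\<phi>: "f \<in> \<phi>" unfolding f0a(2) outer_class_iff[OF f0a(1)] f_def using Ac[OF h] by blast
      have fa: "f \<in> auto G" using outer_class_mem[OF \<phi>c f\<phi>] by simp
      have fA: "f ` A = A" unfolding f_def by (rule inner_auto_subgroup[OF A h f0(2)])
      have fz: "f z = z \<otimes> d \<or> f z = inv (z \<otimes> d)"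
        using hd zc auto_closed[OF f0a(1) zc(1)] by (simp add: f_def compose_eq inner_auto_def)
      have X: "free_basis G (f ` P)" by (rule free_basis_auto_image[OF fa P])
      have fY: "free_basis (G\<lparr>carrier := A\<rparr>) (f ` Y)" by (rule auto_subbasis[OF fa P A Y(1) YP fA])
      have fYP: "f ` Y \<subseteq> f ` P" using YP by blast
      have inj: "inj_on f (carrier G)" using autoD(2)[OF fa] by (simp add: bij_betw_def)
      have fzY: "f z \<notin> f ` Y" using inj_on_image_mem_iff[OF inj zc(1), of Y] zY YP Pc by blast
      have zdc: "z \<otimes> d \<in> carrier G" using zc d Ac by simp
      \<comment> \<open>An admissible \<open>\<psi>\<close> sends \<open>z\<close> into the coset
        \<open>z A\<close>, so the sign of \<open>f z\<close> is lost. Inverting \<open>z\<close>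
        before applying \<open>f\<close>, if necessary, alters the image basis only by inverting one
        element.\<close>
      obtain \<psi> where \<psi>: "\<psi> \<in> auto G" "\<forall>y\<in>Y. \<psi> y = f y" "\<psi> z = z \<otimes> d"
        using fz
      proof
        assume "f z = z \<otimes> d"
        then show ?thesis using that[of f] fa by simp
      next
        assume fz: "f z = inv (z \<otimes> d)"
        obtain t where t: "t \<in> auto G" "\<forall>x\<in>Y. t x = x" "t z = inv z"
          using flip_auto[OF P[unfolded P_def] zY] by blast
        have "f (inv z) = z \<otimes> d"
          using group_hom.hom_inv[OF autoD(4)[OF fa] zc(1)] fz zdc by simp
        moreover have "y \<in> carrier G" if "y \<in> Y" for y using that YP Pc by blast
        ultimately show ?thesis
          using that[of "compose (carrier G) f t"] compose_auto[OF fa t(1)] t zc by (simp add: compose_eq)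
      qed
      obtain b where b: "letter_value G (f z, b) = z \<otimes> d" "letter_value G (f z, \<not> b) = inv (z \<otimes> d)"
        using fz
      proof
        assume "f z = z \<otimes> d"
        then show ?thesis using that[of True] by (simp add: letter_value_def)
      next
        assume "f z = inv (z \<otimes> d)"
        then show ?thesis using that[of False] zdc by (simp add: letter_value_def)
      qed
      let ?\<tau> = "suffix_tiling G (f ` P) (f ` Y)"
      have fzP: "f z \<in> f ` P" using zP by blast
      \<comment> \<open>Writing \<open>inv z\<close> as
        \<open>d \<otimes> inv (z \<otimes> d)\<close> exhibits a last letter outside the basis of
        \<open>A\<close>, so the final block is empty.\<close>
      have "?\<tau> (a [^] n \<otimes> inv z) = \<one>" for n :: nat
      proof -
        have "a [^] n \<otimes> d \<in> A" using pow d subgroup.m_closed[OF A] by blast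
        then have "?\<tau> (a [^] n \<otimes> d \<otimes> (letter_value G (f z, \<not> b) \<otimes> \<one>)) = \<one>"
          using fzP fzY subgroup.one_closed[OF A] by (intro suffix_tiling_letter[OF X fYP A fY]) auto
        moreover have "a [^] n \<otimes> d \<otimes> (letter_value G (f z, \<not> b) \<otimes> \<one>) = a [^] n \<otimes> inv z"
          unfolding b(2) using ac zc Ac[OF d] by (simp add: m_assoc inv_mult_group cancel_left)
        ultimately show ?thesis by simp
      qed
      then have e1: "ends_at G ?\<tau> a (inv z) \<one>"
        using Y(2) by (intro ends_at_suffix_tiling[OF X fYP _ A fY ac(1) zc(2) notin(1)]) auto
      have "?\<tau> (a [^] n \<otimes> z) = inv d" for n :: nat
      proof -
        have "?\<tau> (a [^] n \<otimes> (letter_value G (f z, b) \<otimes> inv d)) = inv d"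
          using fzP fzY pow subgroup.m_inv_closed[OF A d] by (intro suffix_tiling_letter[OF X fYP A fY]) auto
        moreover have "a [^] n \<otimes> (letter_value G (f z, b) \<otimes> inv d) = a [^] n \<otimes> z"
          unfolding b(1) using ac zc Ac[OF d] by (simp add: m_assoc)
        ultimately show ?thesis by simp
      qed
      then have e2: "ends_at G ?\<tau> a z (inv d)"
        using Y(2) by (intro ends_at_suffix_tiling[OF X fYP _ A fY ac(1) zc(1) notin(2)]) auto
      have "\<psi> ` Y = f ` Y" using \<psi>(2) by (intro image_cong) auto
      then have "marking G P A Y a (inv z) f \<psi> ?\<tau>"
        unfolding marking_def labels_suffix_tiling[OF X fYP A fY]
        using tiling_suffix_tiling[OF X fYP A fY] e1 by simp
      moreover have "inv d \<in> A" "\<psi> z = z \<otimes> inv (inv d)"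
        using subgroup.m_inv_closed[OF A d] \<psi>(3) Ac[OF d] by auto
      ultimately have "R f \<psi>" unfolding R_def using \<psi>(1) e2 by blast
      moreover have "f ` P \<subseteq> ball_of G (\<psi> ` P) 1"
      proof -
        have \<psi>P: "\<psi> ` P \<subseteq> carrier G" using auto_closed[OF \<psi>(1)] Pc by blast
        have "f y \<in> ball_of G (\<psi> ` P) 1" if "y \<in> Y" for y
          using that \<psi>(2) YP by (intro ball_of_incl[OF \<psi>P]) force+
        moreover have "z \<otimes> d \<in> ball_of G (\<psi> ` P) 1"
          using zP \<psi>(3) by (intro ball_of_incl[OF \<psi>P]) force+
        then have "f z \<in> ball_of G (\<psi> ` P) 1"
          using fz ball_of_inv[OF \<psi>P] by auto
        ultimately show ?thesis by (auto simp: P_def)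
      qed
      ultimately show ?thesis using f\<phi> by blast
    qed
    then show "\<exists>M. \<forall>\<phi>\<in>stab_factor G A. \<exists>f\<in>\<phi>. \<exists>\<psi>. R f \<psi> \<and> f ` P \<subseteq> ball_of G (\<psi> ` P) M"
      by blast
  qed
qed

end

theorem theorem2:
  fixes F :: "('a, 'b) monoid_scheme" and n :: nat and S :: "('a \<Rightarrow> 'a) set set"
  assumes "n \<ge> 2"
    and "free_group_of_rank F n"
    and "finite_generating_set (Out F) S"
  shows "(\<forall>G H. free_splitting F G H \<longrightarrow>
            coarse_lipschitz_retract (carrier (Out F)) (word_dist (Out F) S) (stab_splitting F G H))
       \<and> (\<forall>G. corank1_free_factor F n G \<longrightarrow>
            coarse_lipschitz_retract (carrier (Out F)) (word_dist (Out F) S) (stab_factor F G))"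
proof -
  obtain P where "group F" "free_basis F P" "finite P"
    using assms(2) by (auto simp: free_group_of_rank_def)
  then show ?thesis
    using group.stab_splitting_coarse_retract[of F P S] group.stab_factor_coarse_retract[of F n S] assms
    by blast
qed

end
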